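(* Let $\mathcal T$ be a $k$-linear Krull–Schmidt triangulated category and let $\mathcal R$ be a pre-simple-minded collection in $\mathcal T$. Put $\mathcal H_{\mathcal R}=\mathrm{Filt}(\mathcal R)$, let $\mathcal U=\mathcal T/\mathrm{thick}(\mathcal R)$ be the Verdier quotient, and let $\mathcal Z=\mathcal R[\ge 0]^{\perp}\cap{}^{\perp}\mathcal R[\le 0]\subset\mathcal T$. Assume: (R1) $\mathcal H_{\mathcal R}$ is contravariantly finite in $\mathcal R[>0]^{\perp}$ and covariantly finite in ${}^{\perp}\mathcal R[<0]$; (R2) for every $X\in\mathcal T$, $\mathrm{Hom}_{\mathcal T}(X,\mathcal H_{\mathcal R}[i])=0=\mathrm{Hom}_{\mathcal T}(\mathcal H_{\mathcal R},X[i])$ for $i\ll 0$. Then: (1) the composition $\mathcal Z\hookrightarrow\mathcal T\to\mathcal U$ is an equivalence of additive categories $\mathcal Z\xrightarrow{\simeq}\mathcal U$; (2) there is a bijection $\{\text{SMCs in }\mathcal T\text{ containing }\mathcal R\}\longleftrightarrow\{\text{SMCs in }\mathcal U\}$ sending $\mathcal S$ to (the image in $\mathcal U$ of) $\mathcal S\setminus\mathcal R$.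
   Context: $k$ is a field. Collections of objects are considered up to isomorphism of objects; subcategories are full. For a collection $\mathcal S$ of objects in a triangulated category $\mathcal T$ with suspension $[1]$ and $n\in\mathbb Z$, $\mathcal S[\ge n]=\{S[i]\mid S\in\mathcal S, i\ge n\}$, and similarly $\mathcal S[>n],\mathcal S[\le n],\mathcal S[<n]$. $\mathcal S^{\perp}=\{X\mid \mathrm{Hom}_{\mathcal T}(S,X)=0\ \forall S\in\mathcal S\}$ and ${}^{\perp}\mathcal S=\{X\mid \mathrm{Hom}_{\mathcal T}(X,S)=0\ \forall S\in\mathcal S\}$. $\mathrm{thick}(\mathcal S)$ is the smallest thick subcategory containing $\mathcal S$; $\mathrm{Filt}(\mathcal S)$ is the smallest extension-closed full subcategory containing $\mathcal S$. A collection $\mathcal S$ is a pre-simple-minded collection (pre-SMC) if for all $X,Y\in\mathcal S$: $\mathrm{Hom}_{\mathcal T}(X,Y[i])=0$ for all $i<0$, and $\dim_k\mathrm{Hom}_{\mathcal T}(X,Y)=\delta_{X,Y}$. It is a simple-minded collection (SMC) if moreover $\mathrm{thick}(\mathcal S)=\mathcal T$. A full subcategory $\mathcal C$ is contravariantly finite in $\mathcal D$ if every $D\in\mathcal D$ has a right $\mathcal C$-approximation, i.e. a morphism $f:C\to D$ with $C\in\mathcal C$ through which every morphism from an object of $\mathcal C$ to $D$ factors; covariantly finite is the dual notion. *)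

theory Defs
  imports "HOL-Algebra.Module"
begin

section \<open>Linear categories\<close>

text \<open>
  Hom-objects are \<open>k\<close>-modules in the sense of HOL-Algebra; the ring fields \<open>mult\<close> and \<open>one\<close>
  of the record type are never used for them.  Hom-sets need not be disjoint, hence composition
  carries its three objects: \<open>Comp C X Y Z g f\<close> is \<open>g \<circ> f\<close> for \<open>f : X \<rightarrow> Y\<close> and \<open>g : Y \<rightarrow> Z\<close>.
\<close>

record ('o, 'k, 'm) lincat =
  Obj :: "'o set"
  Hom :: "'o \<Rightarrow> 'o \<Rightarrow> ('k, 'm) module"
  Ident :: "'o \<Rightarrow> 'm"
  Comp :: "'o \<Rightarrow> 'o \<Rightarrow> 'o \<Rightarrow> 'm \<Rightarrow> 'm \<Rightarrow> 'm"

definition Mor :: "('o, 'k, 'm, 'z) lincat_scheme \<Rightarrow> 'o \<Rightarrow> 'o \<Rightarrow> 'm set" where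
  "Mor C X Y = carrier (Hom C X Y)"

locale linear_category =
  fixes k :: "('k, 'r) ring_scheme" and C :: "('o, 'k, 'm, 'z) lincat_scheme"
  assumes field_k: "Ring.field k"
    and Hom_module: "\<lbrakk>X \<in> Obj C; Y \<in> Obj C\<rbrakk> \<Longrightarrow> Module.module k (Hom C X Y)"
    and Ident_closed: "X \<in> Obj C \<Longrightarrow> Ident C X \<in> Mor C X X"
    and Comp_closed: "\<lbrakk>X \<in> Obj C; Y \<in> Obj C; Z \<in> Obj C; f \<in> Mor C X Y; g \<in> Mor C Y Z\<rbrakk>
      \<Longrightarrow> Comp C X Y Z g f \<in> Mor C X Z"
    and Comp_Ident_right: "\<lbrakk>X \<in> Obj C; Y \<in> Obj C; f \<in> Mor C X Y\<rbrakk>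
      \<Longrightarrow> Comp C X X Y f (Ident C X) = f"
    and Comp_Ident_left: "\<lbrakk>X \<in> Obj C; Y \<in> Obj C; f \<in> Mor C X Y\<rbrakk>
      \<Longrightarrow> Comp C X Y Y (Ident C Y) f = f"
    and Comp_assoc: "\<lbrakk>W \<in> Obj C; X \<in> Obj C; Y \<in> Obj C; Z \<in> Obj C;
        f \<in> Mor C W X; g \<in> Mor C X Y; h \<in> Mor C Y Z\<rbrakk>
      \<Longrightarrow> Comp C W X Z (Comp C X Y Z h g) f = Comp C W Y Z h (Comp C W X Y g f)"
    and Comp_add_right: "\<lbrakk>X \<in> Obj C; Y \<in> Obj C; Z \<in> Obj C;
        f \<in> Mor C X Y; f' \<in> Mor C X Y; g \<in> Mor C Y Z\<rbrakk>
      \<Longrightarrow> Comp C X Y Z g (f \<oplus>\<^bsub>Hom C X Y\<^esub> f')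
          = Comp C X Y Z g f \<oplus>\<^bsub>Hom C X Z\<^esub> Comp C X Y Z g f'"
    and Comp_add_left: "\<lbrakk>X \<in> Obj C; Y \<in> Obj C; Z \<in> Obj C;
        f \<in> Mor C X Y; g \<in> Mor C Y Z; g' \<in> Mor C Y Z\<rbrakk>
      \<Longrightarrow> Comp C X Y Z (g \<oplus>\<^bsub>Hom C Y Z\<^esub> g') f
          = Comp C X Y Z g f \<oplus>\<^bsub>Hom C X Z\<^esub> Comp C X Y Z g' f"
    and Comp_smult_right: "\<lbrakk>X \<in> Obj C; Y \<in> Obj C; Z \<in> Obj C;
        c \<in> carrier k; f \<in> Mor C X Y; g \<in> Mor C Y Z\<rbrakk>
      \<Longrightarrow> Comp C X Y Z g (c \<odot>\<^bsub>Hom C X Y\<^esub> f) = c \<odot>\<^bsub>Hom C X Z\<^esub> Comp C X Y Z g f"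
    and Comp_smult_left: "\<lbrakk>X \<in> Obj C; Y \<in> Obj C; Z \<in> Obj C;
        c \<in> carrier k; f \<in> Mor C X Y; g \<in> Mor C Y Z\<rbrakk>
      \<Longrightarrow> Comp C X Y Z (c \<odot>\<^bsub>Hom C Y Z\<^esub> g) f = c \<odot>\<^bsub>Hom C X Z\<^esub> Comp C X Y Z g f"

definition iso_mor :: "('o, 'k, 'm, 'z) lincat_scheme \<Rightarrow> 'o \<Rightarrow> 'o \<Rightarrow> 'm \<Rightarrow> bool" where
  "iso_mor C X Y f \<longleftrightarrow> f \<in> Mor C X Y \<and>
     (\<exists>g \<in> Mor C Y X. Comp C X Y X g f = Ident C X \<and> Comp C Y X Y f g = Ident C Y)"

definition isomorphic :: "('o, 'k, 'm, 'z) lincat_scheme \<Rightarrow> 'o \<Rightarrow> 'o \<Rightarrow> bool" where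
  "isomorphic C X Y \<longleftrightarrow> X \<in> Obj C \<and> Y \<in> Obj C \<and> (\<exists>f. iso_mor C X Y f)"

definition iso_closed :: "('o, 'k, 'm, 'z) lincat_scheme \<Rightarrow> 'o set \<Rightarrow> bool" where
  "iso_closed C P \<longleftrightarrow> P \<subseteq> Obj C \<and> (\<forall>X Y. X \<in> P \<longrightarrow> isomorphic C X Y \<longrightarrow> Y \<in> P)"

definition iso_closure :: "('o, 'k, 'm, 'z) lincat_scheme \<Rightarrow> 'o set \<Rightarrow> 'o set" where
  "iso_closure C A = {Y. \<exists>X\<in>A. isomorphic C X Y}"

definition Hom_vanishes :: "('o, 'k, 'm, 'z) lincat_scheme \<Rightarrow> 'o \<Rightarrow> 'o \<Rightarrow> bool" where
  "Hom_vanishes C X Y \<longleftrightarrow> Mor C X Y = {\<zero>\<^bsub>Hom C X Y\<^esub>}"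

definition zero_object :: "('o, 'k, 'm, 'z) lincat_scheme \<Rightarrow> 'o \<Rightarrow> bool" where
  "zero_object C X \<longleftrightarrow> X \<in> Obj C \<and> (\<forall>Y\<in>Obj C. Hom_vanishes C X Y \<and> Hom_vanishes C Y X)"

text \<open>\<open>X\<close> is a direct sum (biproduct) of the finite family \<open>Ys\<close>, with inclusions \<open>\<iota>\<close> and
  projections \<open>\<pi>\<close>; the direct sum of the empty family is a zero object.\<close>

definition direct_sum :: "('o, 'k, 'm, 'z) lincat_scheme \<Rightarrow> 'o \<Rightarrow> 'o list \<Rightarrow> bool" where
  "direct_sum C X Ys \<longleftrightarrow> X \<in> Obj C \<and> set Ys \<subseteq> Obj C \<and>
     (\<exists>\<iota> \<pi>. (\<forall>i<length Ys. \<iota> i \<in> Mor C (Ys ! i) X \<and> \<pi> i \<in> Mor C X (Ys ! i)) \<and>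
       (\<forall>i<length Ys. \<forall>j<length Ys. Comp C (Ys ! i) X (Ys ! j) (\<pi> j) (\<iota> i)
          = (if i = j then Ident C (Ys ! i) else \<zero>\<^bsub>Hom C (Ys ! i) (Ys ! j)\<^esub>)) \<and>
       (\<Oplus>\<^bsub>Hom C X X\<^esub>i\<in>{..<length Ys}. Comp C X (Ys ! i) X (\<iota> i) (\<pi> i)) = Ident C X)"

definition additive_category ::
    "('k, 'r) ring_scheme \<Rightarrow> ('o, 'k, 'm, 'z) lincat_scheme \<Rightarrow> bool" where
  "additive_category k C \<longleftrightarrow> linear_category k C \<and>
     (\<forall>Ys. set Ys \<subseteq> Obj C \<longrightarrow> (\<exists>X. direct_sum C X Ys))"

definition End_ring :: "('o, 'k, 'm, 'z) lincat_scheme \<Rightarrow> 'o \<Rightarrow> 'm ring" where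
  "End_ring C X = \<lparr>carrier = Mor C X X, mult = Comp C X X X, one = Ident C X,
     zero = \<zero>\<^bsub>Hom C X X\<^esub>, add = add (Hom C X X)\<rparr>"

text \<open>Locality of a not necessarily commutative ring.\<close>

definition local_ring :: "('a, 'r) ring_scheme \<Rightarrow> bool" where
  "local_ring A \<longleftrightarrow> ring A \<and> \<one>\<^bsub>A\<^esub> \<noteq> \<zero>\<^bsub>A\<^esub> \<and>
     (\<forall>a\<in>carrier A. \<forall>b\<in>carrier A. a \<notin> Units A \<longrightarrow> b \<notin> Units A \<longrightarrow> a \<oplus>\<^bsub>A\<^esub> b \<notin> Units A)"

definition krull_schmidt :: "('o, 'k, 'm, 'z) lincat_scheme \<Rightarrow> bool" where
  "krull_schmidt C \<longleftrightarrow> (\<forall>X\<in>Obj C. \<exists>Ys. direct_sum C X Ys \<and>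
     (\<forall>Y\<in>set Ys. local_ring (End_ring C Y)))"

text \<open>\<open>has_dim k V n\<close>: the \<open>k\<close>-vector space \<open>V\<close> has finite dimension \<open>n\<close>.\<close>

definition has_dim :: "('k, 'r) ring_scheme \<Rightarrow> ('k, 'm, 'z) module_scheme \<Rightarrow> nat \<Rightarrow> bool" where
  "has_dim k V n \<longleftrightarrow> (\<exists>B. B \<subseteq> carrier V \<and> finite B \<and> card B = n \<and>
     (\<forall>v\<in>carrier V. \<exists>!c. c \<in> B \<rightarrow>\<^sub>E carrier k \<and> (\<Oplus>\<^bsub>V\<^esub>b\<in>B. c b \<odot>\<^bsub>V\<^esub> b) = v))"

definition full_subcategory ::
    "('o, 'k, 'm, 'z) lincat_scheme \<Rightarrow> 'o set \<Rightarrow> ('o, 'k, 'm) lincat" where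
  "full_subcategory C P = \<lparr>Obj = P, Hom = Hom C, Ident = Ident C, Comp = Comp C\<rparr>"

section \<open>Functors and equivalences\<close>

text \<open>A functor consists of its action \<open>Fo\<close> on objects and its action \<open>Fm X Y\<close> on
  morphisms \<open>X \<rightarrow> Y\<close>.\<close>

definition is_functor :: "('o, 'k, 'm, 'z) lincat_scheme \<Rightarrow> ('p, 'l, 'n, 'w) lincat_scheme
    \<Rightarrow> ('o \<Rightarrow> 'p) \<Rightarrow> ('o \<Rightarrow> 'o \<Rightarrow> 'm \<Rightarrow> 'n) \<Rightarrow> bool" where
  "is_functor C D Fo Fm \<longleftrightarrow>
     (\<forall>X\<in>Obj C. Fo X \<in> Obj D \<and> Fm X X (Ident C X) = Ident D (Fo X)) \<and>
     (\<forall>X\<in>Obj C. \<forall>Y\<in>Obj C. \<forall>f\<in>Mor C X Y. Fm X Y f \<in> Mor D (Fo X) (Fo Y)) \<and>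
     (\<forall>X\<in>Obj C. \<forall>Y\<in>Obj C. \<forall>Z\<in>Obj C. \<forall>f\<in>Mor C X Y. \<forall>g\<in>Mor C Y Z.
        Fm X Z (Comp C X Y Z g f) = Comp D (Fo X) (Fo Y) (Fo Z) (Fm Y Z g) (Fm X Y f))"

definition additive_functor :: "('o, 'k, 'm, 'z) lincat_scheme \<Rightarrow> ('p, 'l, 'n, 'w) lincat_scheme
    \<Rightarrow> ('o \<Rightarrow> 'p) \<Rightarrow> ('o \<Rightarrow> 'o \<Rightarrow> 'm \<Rightarrow> 'n) \<Rightarrow> bool" where
  "additive_functor C D Fo Fm \<longleftrightarrow> is_functor C D Fo Fm \<and>
     (\<forall>X\<in>Obj C. \<forall>Y\<in>Obj C. \<forall>f\<in>Mor C X Y. \<forall>f'\<in>Mor C X Y.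
        Fm X Y (f \<oplus>\<^bsub>Hom C X Y\<^esub> f') = Fm X Y f \<oplus>\<^bsub>Hom D (Fo X) (Fo Y)\<^esub> Fm X Y f')"

definition natural_iso :: "('o, 'k, 'm, 'z) lincat_scheme \<Rightarrow> ('p, 'l, 'n, 'w) lincat_scheme
    \<Rightarrow> ('o \<Rightarrow> 'p) \<Rightarrow> ('o \<Rightarrow> 'o \<Rightarrow> 'm \<Rightarrow> 'n)
    \<Rightarrow> ('o \<Rightarrow> 'p) \<Rightarrow> ('o \<Rightarrow> 'o \<Rightarrow> 'm \<Rightarrow> 'n) \<Rightarrow> ('o \<Rightarrow> 'n) \<Rightarrow> bool" where
  "natural_iso C D Fo Fm Go Gm \<eta> \<longleftrightarrow>
     (\<forall>X\<in>Obj C. iso_mor D (Fo X) (Go X) (\<eta> X)) \<and>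
     (\<forall>X\<in>Obj C. \<forall>Y\<in>Obj C. \<forall>f\<in>Mor C X Y.
        Comp D (Fo X) (Go X) (Go Y) (Gm X Y f) (\<eta> X)
        = Comp D (Fo X) (Fo Y) (Go Y) (\<eta> Y) (Fm X Y f))"

definition additive_equivalence :: "('k, 'r) ring_scheme
    \<Rightarrow> ('o, 'k, 'm, 'z) lincat_scheme \<Rightarrow> ('p, 'k, 'n, 'w) lincat_scheme
    \<Rightarrow> ('o \<Rightarrow> 'p) \<Rightarrow> ('o \<Rightarrow> 'o \<Rightarrow> 'm \<Rightarrow> 'n) \<Rightarrow> bool" where
  "additive_equivalence k C D Fo Fm \<longleftrightarrow>
     additive_category k C \<and> additive_category k D \<and> additive_functor C D Fo Fm \<and>
     (\<exists>Go Gm \<eta> \<epsilon>. additive_functor D C Go Gm \<and>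
        natural_iso C C (\<lambda>X. X) (\<lambda>X Y f. f)
          (\<lambda>X. Go (Fo X)) (\<lambda>X Y f. Gm (Fo X) (Fo Y) (Fm X Y f)) \<eta> \<and>
        natural_iso D D (\<lambda>X. Fo (Go X)) (\<lambda>X Y f. Fm (Go X) (Go Y) (Gm X Y f))
          (\<lambda>X. X) (\<lambda>X Y f. f) \<epsilon>)"

section \<open>Triangulated categories\<close>

text \<open>\<open>Susp\<close> and \<open>SuspMor X Y\<close> are the suspension \<open>[1]\<close> on objects and on morphisms
  \<open>X \<rightarrow> Y\<close>; \<open>Tri T X Y Z f g h\<close> says that \<open>X \<midarrow>f\<rightarrow> Y \<midarrow>g\<rightarrow> Z \<midarrow>h\<rightarrow> X[1]\<close> is distinguished.\<close>

record ('o, 'k, 'm) tricat = "('o, 'k, 'm) lincat" +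
  Susp :: "'o \<Rightarrow> 'o"
  SuspMor :: "'o \<Rightarrow> 'o \<Rightarrow> 'm \<Rightarrow> 'm"
  Tri :: "'o \<Rightarrow> 'o \<Rightarrow> 'o \<Rightarrow> 'm \<Rightarrow> 'm \<Rightarrow> 'm \<Rightarrow> bool"

definition triangle_diagram :: "('o, 'k, 'm, 'z) tricat_scheme
    \<Rightarrow> 'o \<Rightarrow> 'o \<Rightarrow> 'o \<Rightarrow> 'm \<Rightarrow> 'm \<Rightarrow> 'm \<Rightarrow> bool" where
  "triangle_diagram T X Y Z f g h \<longleftrightarrow> X \<in> Obj T \<and> Y \<in> Obj T \<and> Z \<in> Obj T \<and>
     f \<in> Mor T X Y \<and> g \<in> Mor T Y Z \<and> h \<in> Mor T Z (Susp T X)"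

text \<open>The suspension is a \<open>k\<close>-linear automorphism; the exactness axioms are Verdier's TR1 to TR4.\<close>

locale triangulated_category = linear_category k T
  for k :: "('k, 'r) ring_scheme" and T :: "('o, 'k, 'm, 'z) tricat_scheme" +
  assumes additive: "additive_category k T"
    and Susp_functor: "is_functor T T (Susp T) (SuspMor T)"
    and Susp_add: "\<lbrakk>X \<in> Obj T; Y \<in> Obj T; f \<in> Mor T X Y; f' \<in> Mor T X Y\<rbrakk>
      \<Longrightarrow> SuspMor T X Y (f \<oplus>\<^bsub>Hom T X Y\<^esub> f')
          = SuspMor T X Y f \<oplus>\<^bsub>Hom T (Susp T X) (Susp T Y)\<^esub> SuspMor T X Y f'"
    and Susp_smult: "\<lbrakk>X \<in> Obj T; Y \<in> Obj T; r \<in> carrier k; f \<in> Mor T X Y\<rbrakk>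
      \<Longrightarrow> SuspMor T X Y (r \<odot>\<^bsub>Hom T X Y\<^esub> f)
          = r \<odot>\<^bsub>Hom T (Susp T X) (Susp T Y)\<^esub> SuspMor T X Y f"
    and Susp_bij: "bij_betw (Susp T) (Obj T) (Obj T)"
    and SuspMor_bij: "\<lbrakk>X \<in> Obj T; Y \<in> Obj T\<rbrakk>
      \<Longrightarrow> bij_betw (SuspMor T X Y) (Mor T X Y) (Mor T (Susp T X) (Susp T Y))"
    and Tri_diagram: "Tri T X Y Z f g h \<Longrightarrow> triangle_diagram T X Y Z f g h"
    and TR1_iso: "\<lbrakk>Tri T X Y Z f g h; triangle_diagram T X' Y' Z' f' g' h';
        iso_mor T X X' a; iso_mor T Y Y' b; iso_mor T Z Z' c;
        Comp T X Y Y' b f = Comp T X X' Y' f' a;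
        Comp T Y Z Z' c g = Comp T Y Y' Z' g' b;
        Comp T Z (Susp T X) (Susp T X') (SuspMor T X X' a) h
          = Comp T Z Z' (Susp T X') h' c\<rbrakk>
      \<Longrightarrow> Tri T X' Y' Z' f' g' h'"
    and TR1_Ident: "\<lbrakk>X \<in> Obj T; zero_object T E\<rbrakk>
      \<Longrightarrow> Tri T X X E (Ident T X) \<zero>\<^bsub>Hom T X E\<^esub> \<zero>\<^bsub>Hom T E (Susp T X)\<^esub>"
    and TR1_cone: "\<lbrakk>X \<in> Obj T; Y \<in> Obj T; f \<in> Mor T X Y\<rbrakk> \<Longrightarrow> \<exists>Z g h. Tri T X Y Z f g h"
    and TR2: "triangle_diagram T X Y Z f g h
      \<Longrightarrow> Tri T X Y Z f g h \<longleftrightarrow>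
          Tri T Y Z (Susp T X) g h (\<ominus>\<^bsub>Hom T (Susp T X) (Susp T Y)\<^esub> SuspMor T X Y f)"
    and TR3: "\<lbrakk>Tri T X Y Z f g h; Tri T X' Y' Z' f' g' h';
        a \<in> Mor T X X'; b \<in> Mor T Y Y'; Comp T X Y Y' b f = Comp T X X' Y' f' a\<rbrakk>
      \<Longrightarrow> \<exists>c \<in> Mor T Z Z'. Comp T Y Z Z' c g = Comp T Y Y' Z' g' b \<and>
            Comp T Z (Susp T X) (Susp T X') (SuspMor T X X' a) h
              = Comp T Z Z' (Susp T X') h' c"
    and TR4: "\<lbrakk>Tri T X Y A f u u'; Tri T Y Z B g v v'; Tri T X Z C (Comp T X Y Z g f) w w'\<rbrakk>
      \<Longrightarrow> \<exists>a \<in> Mor T A C. \<exists>b \<in> Mor T C B.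
            Tri T A C B a b (Comp T B (Susp T Y) (Susp T A) (SuspMor T Y A u) v') \<and>
            Comp T Y A C a u = Comp T Y Z C w g \<and>
            Comp T A C (Susp T X) w' a = u' \<and>
            Comp T Z C B b w = v \<and>
            Comp T C B (Susp T Y) v' b = Comp T C (Susp T X) (Susp T Y) (SuspMor T X Y f) w'"

definition shift :: "('o, 'k, 'm, 'z) tricat_scheme \<Rightarrow> 'o \<Rightarrow> int \<Rightarrow> 'o" where
  "shift T X i = (if i \<ge> 0 then (Susp T ^^ nat i) X
                  else (inv_into (Obj T) (Susp T) ^^ nat (- i)) X)"

definition shifts :: "('o, 'k, 'm, 'z) tricat_scheme \<Rightarrow> 'o set \<Rightarrow> int set \<Rightarrow> 'o set" where
  "shifts T S I = {shift T X i | X i. X \<in> S \<and> i \<in> I}"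

definition right_perp :: "('o, 'k, 'm, 'z) lincat_scheme \<Rightarrow> 'o set \<Rightarrow> 'o set" where
  "right_perp C S = {X \<in> Obj C. \<forall>A\<in>S. Hom_vanishes C A X}"

definition left_perp :: "('o, 'k, 'm, 'z) lincat_scheme \<Rightarrow> 'o set \<Rightarrow> 'o set" where
  "left_perp C S = {X \<in> Obj C. \<forall>A\<in>S. Hom_vanishes C X A}"

text \<open>Full subcategories are identified with their isomorphism-closed sets of objects.\<close>

definition thick_subcategory :: "('o, 'k, 'm, 'z) tricat_scheme \<Rightarrow> 'o set \<Rightarrow> bool" where
  "thick_subcategory T P \<longleftrightarrow> iso_closed T P \<and> (\<forall>X. zero_object T X \<longrightarrow> X \<in> P) \<and>
     (\<forall>X\<in>Obj T. X \<in> P \<longleftrightarrow> Susp T X \<in> P) \<and>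
     (\<forall>X Y Z f g h. Tri T X Y Z f g h \<longrightarrow> X \<in> P \<longrightarrow> Y \<in> P \<longrightarrow> Z \<in> P) \<and>
     (\<forall>X Y Z. direct_sum T X [Y, Z] \<longrightarrow> X \<in> P \<longrightarrow> Y \<in> P)"

definition thick :: "('o, 'k, 'm, 'z) tricat_scheme \<Rightarrow> 'o set \<Rightarrow> 'o set" where
  "thick T S = \<Inter>{P. thick_subcategory T P \<and> S \<subseteq> P}"

definition extension_closed :: "('o, 'k, 'm, 'z) tricat_scheme \<Rightarrow> 'o set \<Rightarrow> bool" where
  "extension_closed T P \<longleftrightarrow> iso_closed T P \<and> (\<forall>X. zero_object T X \<longrightarrow> X \<in> P) \<and>
     (\<forall>X Y Z f g h. Tri T X Y Z f g h \<longrightarrow> X \<in> P \<longrightarrow> Z \<in> P \<longrightarrow> Y \<in> P)"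

definition Filt :: "('o, 'k, 'm, 'z) tricat_scheme \<Rightarrow> 'o set \<Rightarrow> 'o set" where
  "Filt T S = \<Inter>{P. extension_closed T P \<and> S \<subseteq> P}"

definition right_approximation ::
    "('o, 'k, 'm, 'z) lincat_scheme \<Rightarrow> 'o set \<Rightarrow> 'o \<Rightarrow> 'o \<Rightarrow> 'm \<Rightarrow> bool" where
  "right_approximation C P D A f \<longleftrightarrow> A \<in> P \<and> f \<in> Mor C A D \<and>
     (\<forall>B\<in>P. \<forall>g\<in>Mor C B D. \<exists>h\<in>Mor C B A. g = Comp C B A D f h)"

definition left_approximation ::
    "('o, 'k, 'm, 'z) lincat_scheme \<Rightarrow> 'o set \<Rightarrow> 'o \<Rightarrow> 'o \<Rightarrow> 'm \<Rightarrow> bool" where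
  "left_approximation C P D A f \<longleftrightarrow> A \<in> P \<and> f \<in> Mor C D A \<and>
     (\<forall>B\<in>P. \<forall>g\<in>Mor C D B. \<exists>h\<in>Mor C A B. g = Comp C D A B h f)"

definition contravariantly_finite ::
    "('o, 'k, 'm, 'z) lincat_scheme \<Rightarrow> 'o set \<Rightarrow> 'o set \<Rightarrow> bool" where
  "contravariantly_finite C P Q \<longleftrightarrow> (\<forall>D\<in>Q. \<exists>A f. right_approximation C P D A f)"

definition covariantly_finite ::
    "('o, 'k, 'm, 'z) lincat_scheme \<Rightarrow> 'o set \<Rightarrow> 'o set \<Rightarrow> bool" where
  "covariantly_finite C P Q \<longleftrightarrow> (\<forall>D\<in>Q. \<exists>A f. left_approximation C P D A f)"

section \<open>Verdier quotients\<close>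

text \<open>The quotient \<open>T/N\<close> is the calculus-of-fractions localization: a morphism \<open>X \<rightarrow> Y\<close> is an equivalence
  class of roofs \<open>X \<leftarrow>s\<midarrow> W \<midarrow>f\<rightarrow> Y\<close>, written \<open>(W, s, f)\<close>, where the cone of \<open>s\<close> lies in \<open>N\<close>.\<close>

definition cone_in :: "('o, 'k, 'm, 'z) tricat_scheme \<Rightarrow> 'o set \<Rightarrow> 'o \<Rightarrow> 'o \<Rightarrow> 'm \<Rightarrow> bool" where
  "cone_in T N X Y s \<longleftrightarrow> (\<exists>Z\<in>N. \<exists>g h. Tri T X Y Z s g h)"

definition roofs :: "('o, 'k, 'm, 'z) tricat_scheme \<Rightarrow> 'o set \<Rightarrow> 'o \<Rightarrow> 'o
    \<Rightarrow> ('o \<times> 'm \<times> 'm) set" where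
  "roofs T N X Y = {(W, s, f). W \<in> Obj T \<and> s \<in> Mor T W X \<and> cone_in T N W X s \<and> f \<in> Mor T W Y}"

definition roof_rel :: "('o, 'k, 'm, 'z) tricat_scheme \<Rightarrow> 'o set \<Rightarrow> 'o \<Rightarrow> 'o
    \<Rightarrow> (('o \<times> 'm \<times> 'm) \<times> ('o \<times> 'm \<times> 'm)) set" where
  "roof_rel T N X Y = {((W, s, f), (W', s', f')).
     (W, s, f) \<in> roofs T N X Y \<and> (W', s', f') \<in> roofs T N X Y \<and>
     (\<exists>V\<in>Obj T. \<exists>a\<in>Mor T V W. \<exists>b\<in>Mor T V W'.
        Comp T V W X s a = Comp T V W' X s' b \<and> cone_in T N V X (Comp T V W X s a) \<and>
        Comp T V W Y f a = Comp T V W' Y f' b)}"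

abbreviation roof_class :: "('o, 'k, 'm, 'z) tricat_scheme \<Rightarrow> 'o set \<Rightarrow> 'o \<Rightarrow> 'o
    \<Rightarrow> 'o \<times> 'm \<times> 'm \<Rightarrow> ('o \<times> 'm \<times> 'm) set" where
  "roof_class T N X Y r \<equiv> roof_rel T N X Y `` {r}"

text \<open>Operations on classes are unions of the classes of the results on representatives; by
  well-definedness each such union is a single class.  Sums are computed on representatives with
  a common denominator, composites by completing \<open>W \<midarrow>f\<rightarrow> Y \<leftarrow>t\<midarrow> V\<close> to a commutative square.\<close>

definition quotient_Hom :: "('o, 'k, 'm, 'z) tricat_scheme \<Rightarrow> 'o set \<Rightarrow> 'o \<Rightarrow> 'o
    \<Rightarrow> ('k, ('o \<times> 'm \<times> 'm) set) module" where
  "quotient_Hom T N X Y = \<lparr>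
     carrier = roofs T N X Y // roof_rel T N X Y,
     mult = undefined, one = undefined,
     zero = roof_class T N X Y (X, Ident T X, \<zero>\<^bsub>Hom T X Y\<^esub>),
     add = (\<lambda>\<alpha> \<beta>. \<Union>{roof_class T N X Y (W, s, f \<oplus>\<^bsub>Hom T W Y\<^esub> f') | W s f f'.
                    (W, s, f) \<in> \<alpha> \<and> (W, s, f') \<in> \<beta>}),
     smult = (\<lambda>c \<alpha>. \<Union>{roof_class T N X Y (W, s, c \<odot>\<^bsub>Hom T W Y\<^esub> f) | W s f. (W, s, f) \<in> \<alpha>})\<rparr>"

definition quotient_Comp :: "('o, 'k, 'm, 'z) tricat_scheme \<Rightarrow> 'o set \<Rightarrow> 'o \<Rightarrow> 'o \<Rightarrow> 'o
    \<Rightarrow> ('o \<times> 'm \<times> 'm) set \<Rightarrow> ('o \<times> 'm \<times> 'm) set \<Rightarrow> ('o \<times> 'm \<times> 'm) set" where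
  "quotient_Comp T N X Y Z \<beta> \<alpha> =
     \<Union>{roof_class T N X Z (P, Comp T P W X s t', Comp T P V Z g f') | W s f V t g P t' f'.
        (W, s, f) \<in> \<alpha> \<and> (V, t, g) \<in> \<beta> \<and>
        P \<in> Obj T \<and> t' \<in> Mor T P W \<and> cone_in T N P W t' \<and> f' \<in> Mor T P V \<and>
        Comp T P W Y f t' = Comp T P V Y t f'}"

definition quotient_cat :: "('o, 'k, 'm, 'z) tricat_scheme \<Rightarrow> 'o set
    \<Rightarrow> ('o, 'k, ('o \<times> 'm \<times> 'm) set) lincat" where
  "quotient_cat T N = \<lparr>Obj = Obj T, Hom = quotient_Hom T N,
     Ident = (\<lambda>X. roof_class T N X X (X, Ident T X, Ident T X)), Comp = quotient_Comp T N\<rparr>"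

text \<open>The quotient functor \<open>T \<rightarrow> T/N\<close> is the identity on objects.\<close>

definition quotient_mor :: "('o, 'k, 'm, 'z) tricat_scheme \<Rightarrow> 'o set \<Rightarrow> 'o \<Rightarrow> 'o \<Rightarrow> 'm
    \<Rightarrow> ('o \<times> 'm \<times> 'm) set" where
  "quotient_mor T N X Y f = roof_class T N X Y (X, Ident T X, f)"

definition quotient_SuspMor :: "('o, 'k, 'm, 'z) tricat_scheme \<Rightarrow> 'o set \<Rightarrow> 'o \<Rightarrow> 'o
    \<Rightarrow> ('o \<times> 'm \<times> 'm) set \<Rightarrow> ('o \<times> 'm \<times> 'm) set" where
  "quotient_SuspMor T N X Y \<alpha> =
     \<Union>{roof_class T N (Susp T X) (Susp T Y) (Susp T W, SuspMor T W X s, SuspMor T W Y f) | W s f.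
        (W, s, f) \<in> \<alpha>}"

text \<open>The distinguished triangles of \<open>T/N\<close> are the diagrams isomorphic in \<open>T/N\<close> to the image of a
  distinguished triangle of \<open>T\<close>.\<close>

definition quotient_Tri :: "('o, 'k, 'm, 'z) tricat_scheme \<Rightarrow> 'o set \<Rightarrow> 'o \<Rightarrow> 'o \<Rightarrow> 'o
    \<Rightarrow> ('o \<times> 'm \<times> 'm) set \<Rightarrow> ('o \<times> 'm \<times> 'm) set \<Rightarrow> ('o \<times> 'm \<times> 'm) set \<Rightarrow> bool" where
  "quotient_Tri T N X Y Z \<alpha> \<beta> \<gamma> \<longleftrightarrow> (let U = quotient_cat T N; Q = quotient_mor T N in
     X \<in> Obj U \<and> Y \<in> Obj U \<and> Z \<in> Obj U \<and>
     \<alpha> \<in> Mor U X Y \<and> \<beta> \<in> Mor U Y Z \<and> \<gamma> \<in> Mor U Z (Susp T X) \<and>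
     (\<exists>X' Y' Z' f g h a b c. Tri T X' Y' Z' f g h \<and>
        iso_mor U X X' a \<and> iso_mor U Y Y' b \<and> iso_mor U Z Z' c \<and>
        Comp U X Y Y' b \<alpha> = Comp U X X' Y' (Q X' Y' f) a \<and>
        Comp U Y Z Z' c \<beta> = Comp U Y Y' Z' (Q Y' Z' g) b \<and>
        Comp U Z (Susp T X) (Susp T X') (quotient_SuspMor T N X X' a) \<gamma>
          = Comp U Z Z' (Susp T X') (Q Z' (Susp T X') h) c))"

definition verdier_quotient :: "('o, 'k, 'm, 'z) tricat_scheme \<Rightarrow> 'o set
    \<Rightarrow> ('o, 'k, ('o \<times> 'm \<times> 'm) set) tricat" where
  "verdier_quotient T N = lincat.extend (quotient_cat T N)
     (tricat.fields (Susp T) (quotient_SuspMor T N) (quotient_Tri T N))"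

section \<open>Simple-minded collections\<close>

text \<open>A collection of objects up to isomorphism is represented by an isomorphism-closed set of
  objects; accordingly the Kronecker delta compares isomorphism classes.\<close>

definition pre_SMC :: "('k, 'r) ring_scheme \<Rightarrow> ('o, 'k, 'm, 'z) tricat_scheme \<Rightarrow> 'o set \<Rightarrow> bool" where
  "pre_SMC k T S \<longleftrightarrow> iso_closed T S \<and>
     (\<forall>X\<in>S. \<forall>Y\<in>S. (\<forall>i<0. Hom_vanishes T X (shift T Y i)) \<and>
        has_dim k (Hom T X Y) (if isomorphic T X Y then 1 else 0))"

definition SMC :: "('k, 'r) ring_scheme \<Rightarrow> ('o, 'k, 'm, 'z) tricat_scheme \<Rightarrow> 'o set \<Rightarrow> bool" where
  "SMC k T S \<longleftrightarrow> pre_SMC k T S \<and> thick T S = Obj T"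

definition reduction_subcategory :: "('o, 'k, 'm, 'z) tricat_scheme \<Rightarrow> 'o set \<Rightarrow> 'o set" where
  "reduction_subcategory T R =
     right_perp T (shifts T R {0..}) \<inter> left_perp T (shifts T R {..0})"

end

theory Submission
  imports Defs
begin

text \<open>
  The filtrations by shifts of \<open>Filt(R)\<close> behave like a bounded t-structure on \<open>thick(R)\<close>, and (R1), (R2) extend
  its truncations to all of \<open>T\<close>: iterating approximations of minimal length, every object is an
  extension of an object of \<open>R[\<ge>m]\<^sup>\<bottom>\<close> by one filtered by \<open>R[\<ge>m]\<close>, and dually.  Truncating an object
  from both sides changes it only by objects of \<open>thick(R)\<close> and produces an object of \<open>Z\<close>, whence \<open>Z \<rightarrow> U\<close> is
  essentially surjective.  The denominators over an object of \<open>Z\<close> can be chosen with cone filtered by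
  \<open>R[>0]\<close>; neither this cone nor its desuspension has nonzero maps to \<open>Z\<close>, whence \<open>Z \<rightarrow> U\<close> is fully
  faithful.  If \<open>S \<supseteq> R\<close> is simple-minded then \<open>S - R \<subseteq> Z\<close>, and the thick subcategories of \<open>U\<close> are the thick
  subcategories of \<open>T\<close> containing \<open>R\<close>; so \<open>S \<mapsto> S - R\<close> has the inverse \<open>W \<mapsto> R \<union> (W \<inter> Z)\<close>.
  That \<open>U\<close> is triangulated is never used.
\<close>

section \<open>Linear categories\<close>

text \<open>For an arbitrary approximation of \<open>X\<close> by the heart, \<open>R\<close> may
  still have maps into the desuspended cone. They vanish once the approximation is injective on maps
  from the heart, and minimal length forces this: by Schur's lemma a nonzero map from a member of
  \<open>R\<close> into an object of the heart has a cone one step shorter, so a member of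
  \<open>R\<close> killed by the approximation could be divided out. (R2) supplies the shift at
  which the descent starts, so that finitely many approximations are enough. Objects of
  \<open>thick(R)\<close> have to be cut into factors of shift above and below a given bound. This
  is done by sorting a filtration: factors of adjacent shifts are exchanged through the kernel and
  cokernel of the map that glues them, and for factors further apart the gluing map is zero. Closure
  under direct summands is not formal for filtered objects either; a summand is truncated at a lower
  bound for the shifts of the ambient object, and the remainder is shown to be zero.\<close>

definition arr :: "('o, 'k, 'm, 'z) lincat_scheme \<Rightarrow> 'o \<Rightarrow> 'o \<Rightarrow> 'm \<Rightarrow> bool" where
  "arr C X Y f \<longleftrightarrow> X \<in> Obj C \<and> Y \<in> Obj C \<and> f \<in> Mor C X Y"

lemma arrI: "X \<in> Obj C \<Longrightarrow> Y \<in> Obj C \<Longrightarrow> f \<in> Mor C X Y \<Longrightarrow> arr C X Y f"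
  by (simp add: arr_def)

lemma arrD: assumes "arr C X Y f" shows "X \<in> Obj C" "Y \<in> Obj C" "f \<in> Mor C X Y"
  using assms by (simp_all add: arr_def)

abbreviation zr :: "('o, 'k, 'm, 'z) lincat_scheme \<Rightarrow> 'o \<Rightarrow> 'o \<Rightarrow> 'm" where
  "zr C X Y \<equiv> \<zero>\<^bsub>Hom C X Y\<^esub>"

lemma iso_closedD: "iso_closed C P \<Longrightarrow> X \<in> P \<Longrightarrow> isomorphic C X Y \<Longrightarrow> Y \<in> P"
  by (auto simp: iso_closed_def)

context linear_category
begin

lemma Hom_abelian: "X \<in> Obj C \<Longrightarrow> Y \<in> Obj C \<Longrightarrow> abelian_group (Hom C X Y)"
  using Hom_module module.axioms(2) by blast

text \<open>\<open>arr\<close> includes the membership of both objects, which membership in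
  \<open>Mor\<close> alone does not give. As a rewrite rule it lets the simplifier type nested
  composites without further side conditions.\<close>

lemma arr_comp [simp]: "arr C X Y f \<Longrightarrow> arr C Y Z g \<Longrightarrow> arr C X Z (Comp C X Y Z g f)"
  using Comp_closed by (auto simp: arr_def)

lemma arr_id [simp]: "X \<in> Obj C \<Longrightarrow> arr C X X (Ident C X)"
  using Ident_closed by (auto simp: arr_def)

lemma arr_zero [simp]: "X \<in> Obj C \<Longrightarrow> Y \<in> Obj C \<Longrightarrow> arr C X Y (zr C X Y)"
  using abelian_group.axioms(1)[OF Hom_abelian] abelian_monoid.zero_closed
  by (fastforce simp: arr_def Mor_def)

lemma arr_add [simp]: "arr C X Y f \<Longrightarrow> arr C X Y g \<Longrightarrow> arr C X Y (f \<oplus>\<^bsub>Hom C X Y\<^esub> g)"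
  using abelian_group.axioms(1)[OF Hom_abelian] abelian_monoid.a_closed
  by (fastforce simp: arr_def Mor_def)

lemma arr_neg [simp]: "arr C X Y f \<Longrightarrow> arr C X Y (\<ominus>\<^bsub>Hom C X Y\<^esub> f)"
  using abelian_group.a_inv_closed[OF Hom_abelian]
  by (fastforce simp: arr_def Mor_def)

lemma arr_minus [simp]: "arr C X Y f \<Longrightarrow> arr C X Y g \<Longrightarrow> arr C X Y (f \<ominus>\<^bsub>Hom C X Y\<^esub> g)"
  by (simp add: a_minus_def)

lemma arr_smult [simp]: "c \<in> carrier k \<Longrightarrow> arr C X Y f \<Longrightarrow> arr C X Y (c \<odot>\<^bsub>Hom C X Y\<^esub> f)"
  using module.smult_closed[OF Hom_module] by (fastforce simp: arr_def Mor_def)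

lemma comp_id_right [simp]: "arr C X Y f \<Longrightarrow> Comp C X X Y f (Ident C X) = f"
  by (simp add: arr_def Comp_Ident_right)

lemma comp_id_left [simp]: "arr C X Y f \<Longrightarrow> Comp C X Y Y (Ident C Y) f = f"
  by (simp add: arr_def Comp_Ident_left)

lemma comp_assoc: "arr C W X f \<Longrightarrow> arr C X Y g \<Longrightarrow> arr C Y Z h \<Longrightarrow>
    Comp C W X Z (Comp C X Y Z h g) f = Comp C W Y Z h (Comp C W X Y g f)"
  by (simp add: arr_def Comp_assoc)

text \<open>Once \<open>comp_assoc\<close> has moved all brackets to the right, a known value of
  \<open>g\<close> after \<open>f\<close> is hidden behind the inner composite with
  \<open>x\<close>; this form applies it there.\<close>

lemma comp_reassoc:
  assumes "Comp C X Y Z g f = u" "arr C W X x" "arr C X Y f" "arr C Y Z g"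
  shows "Comp C W Y Z g (Comp C W X Y f x) = Comp C W X Z u x"
  using comp_assoc[OF assms(2-4)] assms(1) by simp

lemma comp_add_right: "arr C X Y f \<Longrightarrow> arr C X Y f' \<Longrightarrow> arr C Y Z g \<Longrightarrow>
    Comp C X Y Z g (f \<oplus>\<^bsub>Hom C X Y\<^esub> f') = Comp C X Y Z g f \<oplus>\<^bsub>Hom C X Z\<^esub> Comp C X Y Z g f'"
  by (simp add: arr_def Comp_add_right)

lemma comp_add_left: "arr C X Y f \<Longrightarrow> arr C Y Z g \<Longrightarrow> arr C Y Z g' \<Longrightarrow>
    Comp C X Y Z (g \<oplus>\<^bsub>Hom C Y Z\<^esub> g') f = Comp C X Y Z g f \<oplus>\<^bsub>Hom C X Z\<^esub> Comp C X Y Z g' f"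
  by (simp add: arr_def Comp_add_left)

lemma add_zero [simp]:
  assumes "arr C X Y f"
  shows "f \<oplus>\<^bsub>Hom C X Y\<^esub> zr C X Y = f" "zr C X Y \<oplus>\<^bsub>Hom C X Y\<^esub> f = f"
proof -
  interpret abelian_group "Hom C X Y" using assms Hom_abelian by (auto simp: arr_def)
  show "f \<oplus>\<^bsub>Hom C X Y\<^esub> zr C X Y = f" "zr C X Y \<oplus>\<^bsub>Hom C X Y\<^esub> f = f"
    using assms by (auto simp: arr_def Mor_def)
qed

text \<open>Additive operations send zero to an element equal to its own double; preservation of
  zero by composition, suspension and functors is obtained this way.\<close>

lemma add_self_zero:
  assumes "arr C X Y f" "f \<oplus>\<^bsub>Hom C X Y\<^esub> f = f" shows "f = zr C X Y"
proof -
  interpret abelian_group "Hom C X Y" using assms Hom_abelian by (auto simp: arr_def)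
  have "f \<in> carrier (Hom C X Y)" using assms by (auto simp: arr_def Mor_def)
  then show ?thesis using assms(2) by (metis r_neg1 l_neg)
qed

lemma neg_unique:
  assumes "arr C X Y f" "arr C X Y g" "g \<oplus>\<^bsub>Hom C X Y\<^esub> f = zr C X Y"
  shows "g = \<ominus>\<^bsub>Hom C X Y\<^esub> f"
proof -
  interpret abelian_group "Hom C X Y" using assms Hom_abelian by (auto simp: arr_def)
  show ?thesis using assms by (simp add: arr_def Mor_def minus_equality[symmetric])
qed

lemma minus_zero_iff:
  assumes "arr C X Y f" "arr C X Y g"
  shows "f \<ominus>\<^bsub>Hom C X Y\<^esub> g = zr C X Y \<longleftrightarrow> f = g"
proof -
  interpret abelian_group "Hom C X Y" using assms Hom_abelian by (auto simp: arr_def)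
  have c: "f \<in> carrier (Hom C X Y)" "g \<in> carrier (Hom C X Y)"
    using assms by (auto simp: arr_def Mor_def)
  have "f = g" if "f \<oplus>\<^bsub>Hom C X Y\<^esub> \<ominus>\<^bsub>Hom C X Y\<^esub> g = zr C X Y"
    using minus_equality[OF that] c by simp
  then show ?thesis using c by (auto simp: a_minus_def r_neg)
qed

lemma neg_add:
  assumes "arr C X Y f"
  shows "\<ominus>\<^bsub>Hom C X Y\<^esub> f \<oplus>\<^bsub>Hom C X Y\<^esub> f = zr C X Y"
    "f \<oplus>\<^bsub>Hom C X Y\<^esub> \<ominus>\<^bsub>Hom C X Y\<^esub> f = zr C X Y"
    "\<ominus>\<^bsub>Hom C X Y\<^esub> (\<ominus>\<^bsub>Hom C X Y\<^esub> f) = f"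
proof -
  interpret abelian_group "Hom C X Y" using assms Hom_abelian by (auto simp: arr_def)
  show "\<ominus>\<^bsub>Hom C X Y\<^esub> f \<oplus>\<^bsub>Hom C X Y\<^esub> f = zr C X Y"
    "f \<oplus>\<^bsub>Hom C X Y\<^esub> \<ominus>\<^bsub>Hom C X Y\<^esub> f = zr C X Y"
    "\<ominus>\<^bsub>Hom C X Y\<^esub> (\<ominus>\<^bsub>Hom C X Y\<^esub> f) = f" 
    using assms by (auto simp: arr_def Mor_def l_neg r_neg)
qed

lemma comp_zero_right [simp]:
  assumes "X \<in> Obj C" "arr C Y Z g" shows "Comp C X Y Z g (zr C X Y) = zr C X Z"
proof (rule add_self_zero)
  have z: "arr C X Y (zr C X Y)" using assms by (simp add: arrD)
  then show "arr C X Z (Comp C X Y Z g (zr C X Y))" using assms by simp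
  show "Comp C X Y Z g (zr C X Y) \<oplus>\<^bsub>Hom C X Z\<^esub> Comp C X Y Z g (zr C X Y)
    = Comp C X Y Z g (zr C X Y)"
    using comp_add_right[OF z z assms(2)] z by simp
qed

lemma comp_zero_left [simp]:
  assumes "Z \<in> Obj C" "arr C X Y f" shows "Comp C X Y Z (zr C Y Z) f = zr C X Z"
proof (rule add_self_zero)
  have z: "arr C Y Z (zr C Y Z)" using assms by (simp add: arrD)
  then show "arr C X Z (Comp C X Y Z (zr C Y Z) f)" using assms by simp
  show "Comp C X Y Z (zr C Y Z) f \<oplus>\<^bsub>Hom C X Z\<^esub> Comp C X Y Z (zr C Y Z) f
    = Comp C X Y Z (zr C Y Z) f"
    using comp_add_left[OF assms(2) z z] z by simp
qed

lemma comp_neg_right: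
  assumes "arr C X Y f" "arr C Y Z g"
  shows "Comp C X Y Z g (\<ominus>\<^bsub>Hom C X Y\<^esub> f) = \<ominus>\<^bsub>Hom C X Z\<^esub> Comp C X Y Z g f"
  using assms by (intro neg_unique) (auto simp: comp_add_right[symmetric] neg_add arrD)

lemma comp_neg_left:
  assumes "arr C X Y f" "arr C Y Z g"
  shows "Comp C X Y Z (\<ominus>\<^bsub>Hom C Y Z\<^esub> g) f = \<ominus>\<^bsub>Hom C X Z\<^esub> Comp C X Y Z g f"
  using assms by (intro neg_unique) (auto simp: comp_add_left[symmetric] neg_add arrD)

lemma comp_minus_right:
  assumes "arr C X Y f" "arr C X Y f'" "arr C Y Z g"
  shows "Comp C X Y Z g (f \<ominus>\<^bsub>Hom C X Y\<^esub> f')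
    = Comp C X Y Z g f \<ominus>\<^bsub>Hom C X Z\<^esub> Comp C X Y Z g f'"
  using assms by (simp add: a_minus_def comp_add_right comp_neg_right)

lemma comp_minus_left:
  assumes "arr C X Y f" "arr C Y Z g" "arr C Y Z g'"
  shows "Comp C X Y Z (g \<ominus>\<^bsub>Hom C Y Z\<^esub> g') f
    = Comp C X Y Z g f \<ominus>\<^bsub>Hom C X Z\<^esub> Comp C X Y Z g' f"
  using assms by (simp add: a_minus_def comp_add_left comp_neg_left)

lemma neg_zero: "X \<in> Obj C \<Longrightarrow> Y \<in> Obj C \<Longrightarrow> \<ominus>\<^bsub>Hom C X Y\<^esub> zr C X Y = zr C X Y"
  using neg_unique[of X Y "zr C X Y" "zr C X Y"] by simp

lemma neg_eq_zero_iff: "arr C X Y f \<Longrightarrow> \<ominus>\<^bsub>Hom C X Y\<^esub> f = zr C X Y \<longleftrightarrow> f = zr C X Y"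
  using neg_add(3)[of X Y f] neg_zero[of X Y] arrD by metis

lemma vanishes_iff:
  "X \<in> Obj C \<Longrightarrow> Y \<in> Obj C \<Longrightarrow> Hom_vanishes C X Y \<longleftrightarrow> (\<forall>f. arr C X Y f \<longrightarrow> f = zr C X Y)"
  using arr_zero[of X Y] by (auto simp: Hom_vanishes_def arr_def)

lemma vanishesD: "Hom_vanishes C X Y \<Longrightarrow> arr C X Y f \<Longrightarrow> f = zr C X Y"
  using vanishes_iff arrD by metis

text \<open>If the identity vanishes, every morphism from or to \<open>X\<close> is a composite with
  zero. The criterion is an equation between two morphisms, so additive functors preserve
  it.\<close>

lemma zero_object_iff: "zero_object C X \<longleftrightarrow> X \<in> Obj C \<and> Ident C X = zr C X X"
proof
  assume "zero_object C X"
  then show "X \<in> Obj C \<and> Ident C X = zr C X X"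
    using vanishesD[of X X "Ident C X"] by (auto simp: zero_object_def)
next
  assume a: "X \<in> Obj C \<and> Ident C X = zr C X X"
  have "f = zr C X Y" if "arr C X Y f" for Y f
    using comp_id_right[OF that] a that comp_zero_right[of X X Y f] by simp
  moreover have "f = zr C Y X" if "arr C Y X f" for Y f
    using comp_id_left[OF that] a that comp_zero_left[of X Y X f] by simp
  ultimately show "zero_object C X"
    using a by (auto simp: zero_object_def vanishes_iff)
qed

lemma zero_objectD: "zero_object C E \<Longrightarrow> E \<in> Obj C"
  by (simp add: zero_object_def)

lemma to_zero_object: "zero_object C E \<Longrightarrow> arr C X E f \<Longrightarrow> f = zr C X E"
  by (auto simp: zero_object_def dest: vanishesD arrD)

lemma from_zero_object: "zero_object C E \<Longrightarrow> arr C E X f \<Longrightarrow> f = zr C E X"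
  by (auto simp: zero_object_def dest: vanishesD arrD)

lemma iso_morI:
  assumes "arr C X Y f" "arr C Y X g" "Comp C X Y X g f = Ident C X"
    "Comp C Y X Y f g = Ident C Y"
  shows "iso_mor C X Y f"
  using assms by (auto simp: iso_mor_def arr_def)

lemma iso_morE:
  assumes "iso_mor C X Y f" "X \<in> Obj C" "Y \<in> Obj C"
  obtains g where "arr C X Y f" "arr C Y X g" "Comp C X Y X g f = Ident C X"
    "Comp C Y X Y f g = Ident C Y" "iso_mor C Y X g"
  using assms by (auto simp: iso_mor_def arr_def)

lemma iso_mor_id: "X \<in> Obj C \<Longrightarrow> iso_mor C X X (Ident C X)"
  by (rule iso_morI[of _ _ _ "Ident C X"]) auto

lemma isomorphicI: "X \<in> Obj C \<Longrightarrow> Y \<in> Obj C \<Longrightarrow> iso_mor C X Y f \<Longrightarrow> isomorphic C X Y"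
  by (auto simp: isomorphic_def)

lemma isomorphicE:
  assumes "isomorphic C X Y"
  obtains f g where "arr C X Y f" "arr C Y X g" "Comp C X Y X g f = Ident C X"
    "Comp C Y X Y f g = Ident C Y" "iso_mor C X Y f" "iso_mor C Y X g"
  using assms by (metis isomorphic_def iso_morE)

lemma isomorphicD: "isomorphic C X Y \<Longrightarrow> X \<in> Obj C" "isomorphic C X Y \<Longrightarrow> Y \<in> Obj C"
  by (auto simp: isomorphic_def)

lemma isomorphic_refl [simp]: "X \<in> Obj C \<Longrightarrow> isomorphic C X X"
  by (auto simp: isomorphic_def intro: iso_mor_id)

lemma isomorphic_sym: "isomorphic C X Y \<Longrightarrow> isomorphic C Y X"
  by (metis isomorphicE isomorphic_def)

lemma iso_mor_comp:
  assumes f: "iso_mor C X Y f" and g: "iso_mor C Y Z g"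
    and o: "X \<in> Obj C" "Y \<in> Obj C" "Z \<in> Obj C"
  shows "iso_mor C X Z (Comp C X Y Z g f)"
proof -
  obtain f' where f': "arr C X Y f" "arr C Y X f'" "Comp C X Y X f' f = Ident C X"
    "Comp C Y X Y f f' = Ident C Y" using iso_morE[OF f o(1,2)] by blast
  obtain g' where g': "arr C Y Z g" "arr C Z Y g'" "Comp C Y Z Y g' g = Ident C Y"
    "Comp C Z Y Z g g' = Ident C Z" using iso_morE[OF g o(2,3)] by blast
  show ?thesis
  proof (rule iso_morI)
    show "arr C X Z (Comp C X Y Z g f)" "arr C Z X (Comp C Z Y X f' g')" using f' g' by auto
    show "Comp C X Z X (Comp C Z Y X f' g') (Comp C X Y Z g f) = Ident C X"
      using f' g' comp_reassoc[OF g'(3) f'(1) g'(1,2)] by (simp add: comp_assoc)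
    show "Comp C Z X Z (Comp C X Y Z g f) (Comp C Z Y X f' g') = Ident C Z"
      using f' g' comp_reassoc[OF f'(4) g'(2) f'(2,1)] by (simp add: comp_assoc)
  qed
qed

lemma isomorphic_trans: "isomorphic C X Y \<Longrightarrow> isomorphic C Y Z \<Longrightarrow> isomorphic C X Z"
  by (meson isomorphic_def iso_mor_comp)

lemma vanishes_iso:
  assumes "isomorphic C X X'" "isomorphic C Y Y'" "Hom_vanishes C X Y"
  shows "Hom_vanishes C X' Y'"
proof -
  obtain f g where f: "arr C X X' f" "arr C X' X g" "Comp C X' X X' f g = Ident C X'"
    using isomorphicE[OF assms(1)] by metis
  obtain p q where p: "arr C Y Y' p" "arr C Y' Y q" "Comp C Y' Y Y' p q = Ident C Y'"
    using isomorphicE[OF assms(2)] by metis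
  have "h = zr C X' Y'" if h: "arr C X' Y' h" for h
  proof -
    have a: "arr C X' Y (Comp C X' Y' Y q h)" using h p by simp
    have b: "Comp C X Y' Y q (Comp C X X' Y' h f) = zr C X Y"
      by (rule vanishesD[OF assms(3)]) (use h p f in auto)
    have "Comp C X' Y' Y q h = Comp C X' X' Y (Comp C X' Y' Y q h) (Comp C X' X X' f g)"
      using f a by simp
    also have "\<dots> = Comp C X' X Y (Comp C X Y' Y q (Comp C X X' Y' h f)) g"
      using f p h by (simp add: comp_assoc)
    also have "\<dots> = zr C X' Y" using b f p by (simp add: arrD(2))
    finally have c: "Comp C X' Y' Y q h = zr C X' Y" .
    have "h = Comp C X' Y Y' p (Comp C X' Y' Y q h)"
      using comp_reassoc[OF p(3) h p(2,1)] h by simp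
    also have "\<dots> = zr C X' Y'" using c p f by (simp add: arrD(2))
    finally show ?thesis .
  qed
  then show ?thesis using vanishes_iff f p by (meson arrD)
qed

lemma zero_object_iso: "isomorphic C X Y \<Longrightarrow> zero_object C X \<Longrightarrow> zero_object C Y"
  unfolding zero_object_def using vanishes_iso isomorphicD isomorphic_refl by metis

lemma zero_objects_isomorphic:
  assumes "zero_object C X" "zero_object C Y" shows "isomorphic C X Y"
proof -
  have o: "X \<in> Obj C" "Y \<in> Obj C" using assms zero_objectD by auto
  have "iso_mor C X Y (zr C X Y)"
    by (rule iso_morI[of _ _ _ "zr C Y X"])
      (use assms o in \<open>auto simp: zero_object_iff\<close>)
  then show ?thesis using o isomorphicI by blast
qed

lemma direct_sum_pair_iff:
  "direct_sum C X [Y, Z] \<longleftrightarrow> (\<exists>i j p q. arr C Y X i \<and> arr C Z X j \<and> arr C X Y p \<and> arr C X Z q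
    \<and> Comp C Y X Y p i = Ident C Y \<and> Comp C Z X Z q j = Ident C Z
    \<and> Comp C Y X Z q i = zr C Y Z \<and> Comp C Z X Y p j = zr C Z Y
    \<and> Comp C X Y X i p \<oplus>\<^bsub>Hom C X X\<^esub> Comp C X Z X j q = Ident C X)" (is "?L \<longleftrightarrow> ?R")
proof -
  have fs: "finsum (Hom C X X) f {..<2::nat} = f 0 \<oplus>\<^bsub>Hom C X X\<^esub> f 1"
    if "arr C X X (f 0)" "arr C X X (f 1)" for f
  proof -
    interpret abelian_group "Hom C X X" using that Hom_abelian by (auto simp: arr_def)
    have "{..<2::nat} = {0,1}" by auto
    then show ?thesis using that by (simp add: arr_def Mor_def Pi_def)
  qed
  have all2: "(\<forall>i<length [Y,Z]. P i) \<longleftrightarrow> P 0 \<and> P 1" for P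
    by (auto simp: less_Suc_eq)
  show ?thesis
  proof
    assume ?L
    then obtain \<iota> \<pi> where o: "X \<in> Obj C" "Y \<in> Obj C" "Z \<in> Obj C"
      and a: "\<forall>i<length [Y,Z]. \<iota> i \<in> Mor C ([Y,Z] ! i) X \<and> \<pi> i \<in> Mor C X ([Y,Z] ! i)"
      and b: "\<forall>i<length [Y,Z]. \<forall>j<length [Y,Z]. Comp C ([Y,Z] ! i) X ([Y,Z] ! j) (\<pi> j) (\<iota> i)
          = (if i = j then Ident C ([Y,Z] ! i) else zr C ([Y,Z] ! i) ([Y,Z] ! j))"
      and c: "(\<Oplus>\<^bsub>Hom C X X\<^esub>i\<in>{..<length [Y,Z]}. Comp C X ([Y,Z] ! i) X (\<iota> i) (\<pi> i)) = Ident C X"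
      unfolding direct_sum_def by auto
    have ar: "arr C Y X (\<iota> 0)" "arr C Z X (\<iota> 1)" "arr C X Y (\<pi> 0)" "arr C X Z (\<pi> 1)"
      using a o unfolding all2 by (auto intro: arrI)
    have "Comp C X Y X (\<iota> 0) (\<pi> 0) \<oplus>\<^bsub>Hom C X X\<^esub> Comp C X Z X (\<iota> 1) (\<pi> 1) = Ident C X"
      using c fs[of "\<lambda>i. Comp C X ([Y,Z] ! i) X (\<iota> i) (\<pi> i)"] ar by (simp add: numeral_2_eq_2)
    then show ?R using ar b unfolding all2 by auto
  next
    assume ?R
    then obtain i j p q where ar: "arr C Y X i" "arr C Z X j" "arr C X Y p" "arr C X Z q"
      and e: "Comp C Y X Y p i = Ident C Y" "Comp C Z X Z q j = Ident C Z"
      "Comp C Y X Z q i = zr C Y Z" "Comp C Z X Y p j = zr C Z Y"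
      "Comp C X Y X i p \<oplus>\<^bsub>Hom C X X\<^esub> Comp C X Z X j q = Ident C X" by blast
    have "(\<Oplus>\<^bsub>Hom C X X\<^esub>n\<in>{..<length [Y,Z]}. Comp C X ([Y,Z] ! n) X ([i,j]!n) ([p,q]!n)) = Ident C X"
      using e(5) fs[of "\<lambda>n. Comp C X ([Y,Z] ! n) X ([i,j]!n) ([p,q]!n)"] ar
      by (simp add: numeral_2_eq_2)
    then show ?L unfolding direct_sum_def all2
      using ar e by (intro conjI exI[of _ "\<lambda>n. [i,j]!n"] exI[of _ "\<lambda>n. [p,q]!n"]) (auto simp: arr_def)
  qed
qed

text \<open>In the quotient a direct sum need not be given as the image of one in \<open>T\<close>;
  uniqueness compares it with such an image.\<close>

lemma direct_sum_pair_unique: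
  assumes "direct_sum C X [Y, Z]" "direct_sum C X' [Y, Z]"
  shows "isomorphic C X X'"
proof -
  obtain i j p q where ar: "arr C Y X i" "arr C Z X j" "arr C X Y p" "arr C X Z q"
    and e: "Comp C Y X Y p i = Ident C Y" "Comp C Z X Z q j = Ident C Z"
      "Comp C Y X Z q i = zr C Y Z" "Comp C Z X Y p j = zr C Z Y"
      "Comp C X Y X i p \<oplus>\<^bsub>Hom C X X\<^esub> Comp C X Z X j q = Ident C X"
    using assms(1) unfolding direct_sum_pair_iff by blast
  obtain i' j' p' q' where ar': "arr C Y X' i'" "arr C Z X' j'" "arr C X' Y p'" "arr C X' Z q'"
    and e': "Comp C Y X' Y p' i' = Ident C Y" "Comp C Z X' Z q' j' = Ident C Z"
      "Comp C Y X' Z q' i' = zr C Y Z" "Comp C Z X' Y p' j' = zr C Z Y"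
      "Comp C X' Y X' i' p' \<oplus>\<^bsub>Hom C X' X'\<^esub> Comp C X' Z X' j' q' = Ident C X'"
    using assms(2) unfolding direct_sum_pair_iff by blast
  note o = arrD(1)[OF ar(1)] arrD(1)[OF ar(2)] arrD(1)[OF ar(3)] arrD(1)[OF ar'(3)]
  have *: "Comp C A B A
      (Comp C B Y A i p' \<oplus>\<^bsub>Hom C B A\<^esub> Comp C B Z A j q')
      (Comp C A Y B i' p \<oplus>\<^bsub>Hom C A B\<^esub> Comp C A Z B j' q) = Ident C A"
    if ar: "arr C Y A i" "arr C Z A j" "arr C A Y p" "arr C A Z q"
      and e: "Comp C A Y A i p \<oplus>\<^bsub>Hom C A A\<^esub> Comp C A Z A j q = Ident C A"
    and ar': "arr C Y B i'" "arr C Z B j'" "arr C B Y p'" "arr C B Z q'"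
      and e': "Comp C Y B Y p' i' = Ident C Y" "Comp C Z B Z q' j' = Ident C Z"
      "Comp C Y B Z q' i' = zr C Y Z" "Comp C Z B Y p' j' = zr C Z Y"
    for A B i j p q i' j' p' q'
  proof -
    note oo = arrD(1)[OF ar(1)] arrD(1)[OF ar(2)] arrD(1)[OF ar(3)] arrD(1)[OF ar'(3)]
    show ?thesis
      using ar ar' e e' oo
      by (simp add: comp_add_right comp_add_left comp_assoc
       comp_reassoc[OF e'(1) ar(3) ar'(1,3)] comp_reassoc[OF e'(2) ar(4) ar'(2,4)]
       comp_reassoc[OF e'(3) ar(3) ar'(1,4)] comp_reassoc[OF e'(4) ar(4) ar'(2,3)])
  qed
  have "iso_mor C X X' (Comp C X Y X' i' p \<oplus>\<^bsub>Hom C X X'\<^esub> Comp C X Z X' j' q)"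
    by (rule iso_morI[of _ _ _ "(Comp C X' Y X i p' \<oplus>\<^bsub>Hom C X' X\<^esub> Comp C X' Z X j q')"])
      (use ar ar' in \<open>auto intro!: * e e'\<close>)
  then show ?thesis using isomorphicI o by blast
qed

end

section \<open>Functors\<close>

text \<open>Instantiated for the quotient functor, and again for its restriction to the full
  subcategory on \<open>reduction_subcategory T R\<close>.\<close>

locale linear_functor_pair = C: linear_category k C + D: linear_category k D
  for k :: "('k, 'r) ring_scheme"
    and C :: "('o, 'k, 'm, 'z) lincat_scheme" and D :: "('p, 'k, 'n, 'w) lincat_scheme" +
  fixes Fo :: "'o \<Rightarrow> 'p" and Fm :: "'o \<Rightarrow> 'o \<Rightarrow> 'm \<Rightarrow> 'n"
  assumes F_additive: "additive_functor C D Fo Fm"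
begin

lemma F_obj: "X \<in> Obj C \<Longrightarrow> Fo X \<in> Obj D"
  using F_additive by (simp add: additive_functor_def is_functor_def)

lemma F_id: "X \<in> Obj C \<Longrightarrow> Fm X X (Ident C X) = Ident D (Fo X)"
  using F_additive by (simp add: additive_functor_def is_functor_def)

lemma F_arr: "arr C X Y f \<Longrightarrow> arr D (Fo X) (Fo Y) (Fm X Y f)"
  using F_additive by (simp add: additive_functor_def is_functor_def arr_def)

lemma F_comp: "arr C X Y f \<Longrightarrow> arr C Y Z g \<Longrightarrow>
    Fm X Z (Comp C X Y Z g f) = Comp D (Fo X) (Fo Y) (Fo Z) (Fm Y Z g) (Fm X Y f)"
  using F_additive by (simp add: additive_functor_def is_functor_def arr_def)

lemma F_add: "arr C X Y f \<Longrightarrow> arr C X Y g \<Longrightarrow>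
    Fm X Y (f \<oplus>\<^bsub>Hom C X Y\<^esub> g) = Fm X Y f \<oplus>\<^bsub>Hom D (Fo X) (Fo Y)\<^esub> Fm X Y g"
  using F_additive by (simp add: additive_functor_def arr_def)

lemma F_zero: "X \<in> Obj C \<Longrightarrow> Y \<in> Obj C \<Longrightarrow> Fm X Y (zr C X Y) = zr D (Fo X) (Fo Y)"
  using F_add[of X Y "zr C X Y" "zr C X Y"] F_arr[of X Y "zr C X Y"] D.add_self_zero by simp

lemma F_iso_mor:
  assumes "iso_mor C X Y f" "X \<in> Obj C" "Y \<in> Obj C"
  shows "iso_mor D (Fo X) (Fo Y) (Fm X Y f)"
proof -
  obtain g where g: "arr C X Y f" "arr C Y X g" "Comp C X Y X g f = Ident C X"
    "Comp C Y X Y f g = Ident C Y" using C.iso_morE[OF assms] by blast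
  show ?thesis
    by (rule D.iso_morI[of _ _ _ "Fm Y X g"])
      (use g assms in \<open>auto simp: F_arr F_comp[symmetric] F_id\<close>)
qed

lemma F_isomorphic: "isomorphic C X Y \<Longrightarrow> isomorphic D (Fo X) (Fo Y)"
  unfolding isomorphic_def using F_iso_mor F_obj by blast

lemma F_zero_object: "zero_object C X \<Longrightarrow> zero_object D (Fo X)"
  unfolding C.zero_object_iff D.zero_object_iff using F_id F_zero F_obj by metis

text \<open>Typing of the partial sums is part of the induction, because additivity of
  \<open>Fm\<close> applies to well-typed summands.\<close>

lemma F_finsum:
  assumes "finite I" "\<And>i. i \<in> I \<Longrightarrow> arr C X Y (f i)" "X \<in> Obj C" "Y \<in> Obj C"
  shows "Fm X Y (\<Oplus>\<^bsub>Hom C X Y\<^esub>i\<in>I. f i) = (\<Oplus>\<^bsub>Hom D (Fo X) (Fo Y)\<^esub>i\<in>I. Fm X Y (f i))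
    \<and> arr C X Y (\<Oplus>\<^bsub>Hom C X Y\<^esub>i\<in>I. f i)"
  using assms(1,2)
proof (induction I)
  interpret A: abelian_group "Hom C X Y" by (rule C.Hom_abelian) fact+
  interpret B: abelian_group "Hom D (Fo X) (Fo Y)" by (rule D.Hom_abelian) (use assms F_obj in auto)
  case empty
  then show ?case using assms by (simp add: F_zero)
next
  interpret A: abelian_group "Hom C X Y" by (rule C.Hom_abelian) fact+
  interpret B: abelian_group "Hom D (Fo X) (Fo Y)" by (rule D.Hom_abelian) (use assms F_obj in auto)
  case (insert i I)
  have 1: "f \<in> I \<rightarrow> carrier (Hom C X Y)" "f i \<in> carrier (Hom C X Y)"
    using insert.prems by (auto simp: arr_def Mor_def)
  have 2: "(\<lambda>i. Fm X Y (f i)) \<in> I \<rightarrow> carrier (Hom D (Fo X) (Fo Y))"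
    "Fm X Y (f i) \<in> carrier (Hom D (Fo X) (Fo Y))"
    using insert.prems F_arr[of X Y] by (auto simp: arr_def Mor_def)
  show ?case using insert by (simp add: A.finsum_insert[OF _ _ 1] B.finsum_insert[OF _ _ 2] F_add)
qed

lemma F_direct_sum:
  assumes "direct_sum C X Ys" shows "direct_sum D (Fo X) (map Fo Ys)"
proof -
  have o: "X \<in> Obj C" "set Ys \<subseteq> Obj C" using assms unfolding direct_sum_def by auto
  obtain \<iota> \<pi> where a: "\<And>i. i<length Ys \<Longrightarrow> \<iota> i \<in> Mor C (Ys ! i) X \<and> \<pi> i \<in> Mor C X (Ys ! i)"
    and b: "\<And>i j. i<length Ys \<Longrightarrow> j<length Ys \<Longrightarrow> Comp C (Ys ! i) X (Ys ! j) (\<pi> j) (\<iota> i)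
        = (if i = j then Ident C (Ys ! i) else zr C (Ys ! i) (Ys ! j))"
    and c: "(\<Oplus>\<^bsub>Hom C X X\<^esub>i\<in>{..<length Ys}. Comp C X (Ys ! i) X (\<iota> i) (\<pi> i)) = Ident C X"
    using assms unfolding direct_sum_def by (elim conjE exE) (rule that, blast+)
  have ar: "arr C (Ys ! i) X (\<iota> i)" "arr C X (Ys ! i) (\<pi> i)" if "i < length Ys" for i
    using a[OF that] o that by (auto simp: arr_def)
  have fs: "(\<Oplus>\<^bsub>Hom D (Fo X) (Fo X)\<^esub>i\<in>{..<length Ys}. Comp D (Fo X) (map Fo Ys ! i) (Fo X)
      (Fm (Ys ! i) X (\<iota> i)) (Fm X (Ys ! i) (\<pi> i))) = Ident D (Fo X)"
  proof -
    interpret B: abelian_group "Hom D (Fo X) (Fo X)" by (rule D.Hom_abelian) (use o F_obj in auto)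
    have "(\<Oplus>\<^bsub>Hom D (Fo X) (Fo X)\<^esub>i\<in>{..<length Ys}. Comp D (Fo X) (map Fo Ys ! i) (Fo X)
      (Fm (Ys ! i) X (\<iota> i)) (Fm X (Ys ! i) (\<pi> i)))
      = (\<Oplus>\<^bsub>Hom D (Fo X) (Fo X)\<^esub>i\<in>{..<length Ys}. Fm X X (Comp C X (Ys ! i) X (\<iota> i) (\<pi> i)))"
      using F_arr[OF ar(1)] F_arr[OF ar(2)]
      by (intro B.add.finprod_cong') (auto simp: F_comp[OF ar(2) ar(1)] 
          intro!: D.arr_comp[THEN arrD(3), unfolded Mor_def])
    also have "\<dots> = Fm X X (\<Oplus>\<^bsub>Hom C X X\<^esub>i\<in>{..<length Ys}. Comp C X (Ys ! i) X (\<iota> i) (\<pi> i))"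
      by (rule F_finsum[THEN conjunct1, symmetric])
        (use o in \<open>auto intro!: C.arr_comp[OF ar(2) ar(1)]\<close>)
    finally show ?thesis using c F_id o by simp
  qed
  have o': "Fo X \<in> Obj D" "set (map Fo Ys) \<subseteq> Obj D" using o F_obj by auto
  show ?thesis unfolding direct_sum_def
  proof (intro conjI o', rule exI[of _ "\<lambda>i. Fm (Ys ! i) X (\<iota> i)"],
      rule exI[of _ "\<lambda>i. Fm X (Ys ! i) (\<pi> i)"], intro conjI allI impI)
    fix i assume "i < length (map Fo Ys)"
    then have i: "i < length Ys" by simp
    show "Fm (Ys ! i) X (\<iota> i) \<in> Mor D (map Fo Ys ! i) (Fo X)"
      "Fm X (Ys ! i) (\<pi> i) \<in> Mor D (Fo X) (map Fo Ys ! i)"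
      using F_arr[OF ar(1)[OF i]] F_arr[OF ar(2)[OF i]] i by (auto simp: arr_def)
    fix j assume "j < length (map Fo Ys)"
    then have j: "j < length Ys" by simp
    show "Comp D (map Fo Ys ! i) (Fo X) (map Fo Ys ! j) (Fm X (Ys ! j) (\<pi> j)) (Fm (Ys ! i) X (\<iota> i)) =
      (if i = j then Ident D (map Fo Ys ! i) else zr D (map Fo Ys ! i) (map Fo Ys ! j))"
      using F_comp[OF ar(1)[OF i] ar(2)[OF j], symmetric] b[OF i j] i j
        F_id[of "Ys ! i"] F_zero[of "Ys ! i" "Ys ! j"] arrD(1)[OF ar(1)[OF i]] arrD(1)[OF ar(1)[OF j]]
      by (cases "i = j") simp_all
  qed (use fs in simp)
qed

text \<open>The quasi-inverse picks for each \<open>Y\<close> an object \<open>G Y\<close> with an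
  isomorphism from its image to \<open>Y\<close>. As \<open>Fm\<close> is injective on hom-sets, the
  functor laws and the naturality of the unit may be checked after applying the functor.\<close>

lemma additive_equivalenceI:
  assumes "additive_category k C" "additive_category k D"
    and ff: "\<And>X Y. X \<in> Obj C \<Longrightarrow> Y \<in> Obj C \<Longrightarrow>
      bij_betw (Fm X Y) (Mor C X Y) (Mor D (Fo X) (Fo Y))"
    and es: "\<And>Y. Y \<in> Obj D \<Longrightarrow> \<exists>X\<in>Obj C. isomorphic D (Fo X) Y"
  shows "additive_equivalence k C D Fo Fm"
proof -
  have "\<forall>Y\<in>Obj D. \<exists>X e e'. X \<in> Obj C \<and> arr D (Fo X) Y e \<and> arr D Y (Fo X) e' \<and>
    Comp D (Fo X) Y (Fo X) e' e = Ident D (Fo X) \<and> Comp D Y (Fo X) Y e e' = Ident D Y"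
    using es D.isomorphicE by metis
  then obtain G e e' where G: "\<And>Y. Y \<in> Obj D \<Longrightarrow> G Y \<in> Obj C"
    and e: "\<And>Y. Y \<in> Obj D \<Longrightarrow> arr D (Fo (G Y)) Y (e Y)"
    and e': "\<And>Y. Y \<in> Obj D \<Longrightarrow> arr D Y (Fo (G Y)) (e' Y)"
    and ee1: "\<And>Y. Y \<in> Obj D \<Longrightarrow> Comp D (Fo (G Y)) Y (Fo (G Y)) (e' Y) (e Y) = Ident D (Fo (G Y))"
    and ee2: "\<And>Y. Y \<in> Obj D \<Longrightarrow> Comp D Y (Fo (G Y)) Y (e Y) (e' Y) = Ident D Y"
    by metis
  have inj: "f = g" if "arr C X Y f" "arr C X Y g" "Fm X Y f = Fm X Y g" for X Y f g
    using ff[of X Y] that by (auto simp: bij_betw_def inj_on_def arr_def)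
  define L where "L X Y a = inv_into (Mor C X Y) (Fm X Y) a" for X Y a
  have L: "arr C X Y (L X Y a)" "Fm X Y (L X Y a) = a"
    if "arr D (Fo X) (Fo Y) a" "X \<in> Obj C" "Y \<in> Obj C" for X Y a
  proof -
    have "a \<in> Fm X Y ` Mor C X Y" using ff[of X Y] that by (auto simp: bij_betw_def arr_def)
    then show "arr C X Y (L X Y a)" "Fm X Y (L X Y a) = a"
      using that by (auto simp: L_def arr_def intro: inv_into_into f_inv_into_f)
  qed
  \<comment> \<open>\<open>a\<close> conjugated by the chosen isomorphisms; \<open>L\<close> then
    lifts the result along the bijection \<open>Fm\<close>.\<close>
  define K where "K X Y a = Comp D (Fo (G X)) Y (Fo (G Y)) (e' Y) (Comp D (Fo (G X)) X Y a (e X))" for X Y a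
  have K: "arr D (Fo (G X)) (Fo (G Y)) (K X Y a)" if "arr D X Y a" for X Y a
    using that e[OF arrD(1)[OF that]] e'[OF arrD(2)[OF that]] by (simp add: K_def)
  define Gm where "Gm X Y a = L (G X) (G Y) (K X Y a)" for X Y a
  have Gm: "arr C (G X) (G Y) (Gm X Y a)" "Fm (G X) (G Y) (Gm X Y a) = K X Y a"
    if "arr D X Y a" for X Y a
    using L[OF K[OF that]] G that by (auto simp: Gm_def dest: arrD)
  have Gfun: "additive_functor D C G Gm"
    unfolding additive_functor_def is_functor_def
  proof (intro conjI ballI)
    fix X assume X: "X \<in> Obj D"
    then show "G X \<in> Obj C" by (rule G)
    show "Gm X X (Ident D X) = Ident C (G X)"
      by (rule inj[of "G X" "G X"]) (use X G Gm e e' in \<open>auto simp: F_id K_def ee1\<close>)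
  next
    fix X Y f assume "X \<in> Obj D" "Y \<in> Obj D" "f \<in> Mor D X Y"
    then show "Gm X Y f \<in> Mor C (G X) (G Y)" using Gm(1)[of X Y f] by (auto simp: arr_def)
  next
    fix X Y Z f g assume a: "X \<in> Obj D" "Y \<in> Obj D" "Z \<in> Obj D" "f \<in> Mor D X Y" "g \<in> Mor D Y Z"
    then have f: "arr D X Y f" "arr D Y Z g" by (auto simp: arr_def)
    show "Gm X Z (Comp D X Y Z g f) = Comp C (G X) (G Y) (G Z) (Gm Y Z g) (Gm X Y f)"
    proof (rule inj)
      show "arr C (G X) (G Z) (Gm X Z (Comp D X Y Z g f))" using f Gm by simp
      show "arr C (G X) (G Z) (Comp C (G X) (G Y) (G Z) (Gm Y Z g) (Gm X Y f))" using f Gm by simp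
      show "Fm (G X) (G Z) (Gm X Z (Comp D X Y Z g f))
        = Fm (G X) (G Z) (Comp C (G X) (G Y) (G Z) (Gm Y Z g) (Gm X Y f))"
        using f Gm e[OF a(1)] e[OF a(2)] e'[OF a(2)] e'[OF a(3)]
          D.comp_reassoc[OF ee2[OF a(2)] _ e'[OF a(2)] e[OF a(2)]]
        by (simp add: F_comp K_def D.comp_assoc)
    qed
  next
    fix X Y f g assume a: "X \<in> Obj D" "Y \<in> Obj D" "f \<in> Mor D X Y" "g \<in> Mor D X Y"
    then have f: "arr D X Y f" "arr D X Y g" by (auto simp: arr_def)
    show "Gm X Y (f \<oplus>\<^bsub>Hom D X Y\<^esub> g) = Gm X Y f \<oplus>\<^bsub>Hom C (G X) (G Y)\<^esub> Gm X Y g"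
    proof (rule inj)
      show "arr C (G X) (G Y) (Gm X Y (f \<oplus>\<^bsub>Hom D X Y\<^esub> g))" using f Gm by simp
      show "arr C (G X) (G Y) (Gm X Y f \<oplus>\<^bsub>Hom C (G X) (G Y)\<^esub> Gm X Y g)" using f Gm by simp
      show "Fm (G X) (G Y) (Gm X Y (f \<oplus>\<^bsub>Hom D X Y\<^esub> g)) =
         Fm (G X) (G Y) (Gm X Y f \<oplus>\<^bsub>Hom C (G X) (G Y)\<^esub> Gm X Y g)"
        using f Gm e[OF a(1)] e'[OF a(2)]
        by (simp add: F_add K_def D.comp_add_left[OF e[OF a(1)] f]
            D.comp_add_right[OF _ _ e'[OF a(2)]])
    qed
  qed
  \<comment> \<open>The unit is the lift of the inverse isomorphism \<open>e'\<close> at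
    \<open>Fo X\<close>; the counit is \<open>e\<close> itself.\<close>
  define \<eta> where "\<eta> X = L X (G (Fo X)) (e' (Fo X))" for X
  have eta: "arr C X (G (Fo X)) (\<eta> X)" "Fm X (G (Fo X)) (\<eta> X) = e' (Fo X)" if "X \<in> Obj C" for X
    using L[of X "G (Fo X)" "e' (Fo X)"] e' G F_obj that by (auto simp: \<eta>_def)
  have n1: "natural_iso C C (\<lambda>X. X) (\<lambda>X Y f. f)
          (\<lambda>X. G (Fo X)) (\<lambda>X Y f. Gm (Fo X) (Fo Y) (Fm X Y f)) \<eta>"
    unfolding natural_iso_def
  proof (intro conjI ballI)
    fix X assume X: "X \<in> Obj C"
    let ?h = "L (G (Fo X)) X (e (Fo X))"
    have h: "arr C (G (Fo X)) X ?h" "Fm (G (Fo X)) X ?h = e (Fo X)"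
      using L[of "G (Fo X)" X "e (Fo X)"] e G F_obj X by auto
    show "iso_mor C X (G (Fo X)) (\<eta> X)"
    proof (rule C.iso_morI)
      show "Comp C X (G (Fo X)) X ?h (\<eta> X) = Ident C X"
        by (rule inj[of X X]) (use X h eta F_obj in \<open>auto simp: F_comp F_id ee2\<close>)
      show "Comp C (G (Fo X)) X (G (Fo X)) (\<eta> X) ?h = Ident C (G (Fo X))"
        by (rule inj[of "G (Fo X)" "G (Fo X)"]) (use X h eta G F_obj in \<open>auto simp: F_comp F_id ee1\<close>)
    qed (use X h eta in auto)
  next
    fix X Y f assume o: "X \<in> Obj C" "Y \<in> Obj C" and "f \<in> Mor C X Y"
    then have f: "arr C X Y f" by (auto simp: arr_def)
    note o' = F_obj[OF o(1)] F_obj[OF o(2)]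
    note ff = F_arr[OF f]
    show "Comp C X (G (Fo X)) (G (Fo Y)) (Gm (Fo X) (Fo Y) (Fm X Y f)) (\<eta> X) =
       Comp C X Y (G (Fo Y)) (\<eta> Y) f"
    proof (rule inj)
      show "arr C X (G (Fo Y)) (Comp C X (G (Fo X)) (G (Fo Y)) (Gm (Fo X) (Fo Y) (Fm X Y f)) (\<eta> X))"
        using eta[OF o(1)] Gm[OF ff] by simp
      show "arr C X (G (Fo Y)) (Comp C X Y (G (Fo Y)) (\<eta> Y) f)" using eta[OF o(2)] f by simp
      show "Fm X (G (Fo Y)) (Comp C X (G (Fo X)) (G (Fo Y)) (Gm (Fo X) (Fo Y) (Fm X Y f)) (\<eta> X))
        = Fm X (G (Fo Y)) (Comp C X Y (G (Fo Y)) (\<eta> Y) f)"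
        using eta[OF o(1)] eta[OF o(2)] Gm[OF ff] f ff
          e[OF o'(1)] e[OF o'(2)] e'[OF o'(1)] e'[OF o'(2)] ee2[OF o'(1)]
        by (simp add: F_comp K_def D.comp_assoc)
    qed
  qed
  have n2: "natural_iso D D (\<lambda>X. Fo (G X)) (\<lambda>X Y f. Fm (G X) (G Y) (Gm X Y f)) (\<lambda>X. X) (\<lambda>X Y f. f) e"
    unfolding natural_iso_def
  proof (intro conjI ballI)
    fix X assume X: "X \<in> Obj D"
    show "iso_mor D (Fo (G X)) X (e X)" by (rule D.iso_morI[OF e e' ee1 ee2]) (use X in auto)
  next
    fix X Y f assume o: "X \<in> Obj D" "Y \<in> Obj D" and "f \<in> Mor D X Y"
    then have f: "arr D X Y f" by (auto simp: arr_def)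
    show "Comp D (Fo (G X)) X Y f (e X) =
       Comp D (Fo (G X)) (Fo (G Y)) Y (e Y) (Fm (G X) (G Y) (Gm X Y f))"
      using f Gm[OF f] e[OF o(1)] D.comp_reassoc[OF ee2[OF o(2)] _ e'[OF o(2)] e[OF o(2)]]
      by (simp add: K_def)
  qed
  show ?thesis unfolding additive_equivalence_def
    using assms(1,2) F_additive Gfun n1 n2 by blast
qed

end

section \<open>Vector spaces of dimension 0 and 1\<close>

lemma has_dim_0_iff:
  assumes "Module.module k V"
  shows "has_dim k V 0 \<longleftrightarrow> carrier V = {\<zero>\<^bsub>V\<^esub>}"
proof -
  interpret module k V by fact
  have "has_dim k V 0 \<longleftrightarrow> (\<forall>v\<in>carrier V. v = \<zero>\<^bsub>V\<^esub>)"
    unfolding has_dim_def by (auto cong: conj_cong)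
  also have "\<dots> \<longleftrightarrow> carrier V = {\<zero>\<^bsub>V\<^esub>}" by auto
  finally show ?thesis .
qed

text \<open>Coordinate functions are extensional maps on the basis, and on a one-element basis such
  a map amounts to one scalar.\<close>

lemma has_dim_1_iff:
  assumes "Module.module k V"
  shows "has_dim k V 1 \<longleftrightarrow> (\<exists>b\<in>carrier V. \<forall>v\<in>carrier V. \<exists>!c. c \<in> carrier k \<and> c \<odot>\<^bsub>V\<^esub> b = v)"
proof -
  interpret module k V by fact
  have eq: "(\<exists>!c. c \<in> {b} \<rightarrow>\<^sub>E carrier k \<and> (\<Oplus>\<^bsub>V\<^esub>b\<in>{b}. c b \<odot>\<^bsub>V\<^esub> b) = v)
    \<longleftrightarrow> (\<exists>!c. c \<in> carrier k \<and> c \<odot>\<^bsub>V\<^esub> b = v)" if "b \<in> carrier V" for b v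
  proof -
    have fs: "(\<Oplus>\<^bsub>V\<^esub>b\<in>{b}. c b \<odot>\<^bsub>V\<^esub> b) = c b \<odot>\<^bsub>V\<^esub> b" if "c \<in> {b} \<rightarrow>\<^sub>E carrier k" for c
    proof -
      have "c b \<in> carrier k" using PiE_mem[OF that] by simp
      then show ?thesis using \<open>b \<in> carrier V\<close> by simp
    qed
    have "(c \<in> {b} \<rightarrow>\<^sub>E carrier k \<and> (\<Oplus>\<^bsub>V\<^esub>b\<in>{b}. c b \<odot>\<^bsub>V\<^esub> b) = v)
      \<longleftrightarrow> (\<exists>d. c = (\<lambda>x\<in>{b}. d) \<and> d \<in> carrier k \<and> d \<odot>\<^bsub>V\<^esub> b = v)" (is "?l \<longleftrightarrow> ?r") for c
    proof
      assume l: ?l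
      have c: "c \<in> {b} \<rightarrow>\<^sub>E carrier k" using l by (rule conjunct1)
      have "c = (\<lambda>x\<in>{b}. c b)"
      proof
        fix x show "c x = (\<lambda>x\<in>{b}. c b) x" by (cases "x = b") (simp_all add: PiE_arb[OF c])
      qed
      moreover have "c b \<in> carrier k" using PiE_mem[OF c] by simp
      moreover have "c b \<odot>\<^bsub>V\<^esub> b = v" by (rule trans[OF fs[OF c, symmetric] conjunct2[OF l]])
      ultimately show ?r by blast
    next
      assume ?r
      then obtain d where d: "c = (\<lambda>x\<in>{b}. d)" "d \<in> carrier k" "d \<odot>\<^bsub>V\<^esub> b = v" by blast
      have c: "c \<in> {b} \<rightarrow>\<^sub>E carrier k" using d by auto
      have "c b \<odot>\<^bsub>V\<^esub> b = v" using d by simp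
      then show ?l by (rule conjI[OF c trans[OF fs[OF c]]])
    qed
    then have "(\<exists>!c. c \<in> {b} \<rightarrow>\<^sub>E carrier k \<and> (\<Oplus>\<^bsub>V\<^esub>b\<in>{b}. c b \<odot>\<^bsub>V\<^esub> b) = v) \<longleftrightarrow>
      (\<exists>!c. \<exists>d. c = (\<lambda>x\<in>{b}. d) \<and> d \<in> carrier k \<and> d \<odot>\<^bsub>V\<^esub> b = v)" by (simp only:)
    also have "\<dots> \<longleftrightarrow> (\<exists>!c. c \<in> carrier k \<and> c \<odot>\<^bsub>V\<^esub> b = v)"
    proof -
      have i: "(\<lambda>x\<in>{b}. d) = (\<lambda>x\<in>{b}. d') \<Longrightarrow> d = d'" for d d' :: 'a
        by (drule fun_cong[of _ _ b]) simp
      show ?thesis by (rule iffI; elim ex1E exE conjE) (blast dest: i, blast)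
    qed
    finally show ?thesis .
  qed
  show ?thesis
  proof
    assume "has_dim k V 1"
    then obtain B where B: "B \<subseteq> carrier V" "card B = 1"
      "\<forall>v\<in>carrier V. \<exists>!c. c \<in> B \<rightarrow>\<^sub>E carrier k \<and> (\<Oplus>\<^bsub>V\<^esub>b\<in>B. c b \<odot>\<^bsub>V\<^esub> b) = v"
      by (auto simp: has_dim_def)
    then obtain b where b: "B = {b}" using card_1_singletonE by metis
    then have bc: "b \<in> carrier V" using B(1) by simp
    show "\<exists>b\<in>carrier V. \<forall>v\<in>carrier V. \<exists>!c. c \<in> carrier k \<and> c \<odot>\<^bsub>V\<^esub> b = v"
      using B(3) unfolding b eq[OF bc] by (rule bexI[OF _ bc])
  next
    assume "\<exists>b\<in>carrier V. \<forall>v\<in>carrier V. \<exists>!c. c \<in> carrier k \<and> c \<odot>\<^bsub>V\<^esub> b = v"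
    then obtain b where b: "b \<in> carrier V" "\<forall>v\<in>carrier V. \<exists>!c. c \<in> carrier k \<and> c \<odot>\<^bsub>V\<^esub> b = v" by blast
    show "has_dim k V 1" unfolding has_dim_def
    proof (rule exI[of _ "{b}"], intro conjI)
      show "\<forall>v\<in>carrier V. \<exists>!c. c \<in> {b} \<rightarrow>\<^sub>E carrier k \<and> (\<Oplus>\<^bsub>V\<^esub>b\<in>{b}. c b \<odot>\<^bsub>V\<^esub> b) = v"
        unfolding eq[OF b(1)] by (rule b(2))
    qed (use b(1) in simp_all)
  qed
qed

text \<open>Dimensions 0 and 1 are those that occur in \<open>pre_SMC\<close>. Here compatibility
  with scalars is enough: a bijective image of a zero space is a singleton, and in dimension 1 every
  vector is a multiple of \<open>b\<close>.\<close>

lemma has_dim_01_transport: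
  assumes V: "Module.module k V" and W: "Module.module k W"
    and bij: "bij_betw \<phi> (carrier V) (carrier W)"
    and smult: "\<And>c v. c \<in> carrier k \<Longrightarrow> v \<in> carrier V \<Longrightarrow> \<phi> (c \<odot>\<^bsub>V\<^esub> v) = c \<odot>\<^bsub>W\<^esub> \<phi> v"
    and n: "n = 0 \<or> n = 1" and d: "has_dim k V n"
  shows "has_dim k W n"
proof -
  interpret V: module k V by fact
  interpret W: module k W by fact
  from n show ?thesis
  proof
    assume "n = 0"
    then have "carrier V = {\<zero>\<^bsub>V\<^esub>}" using d has_dim_0_iff[OF V] by simp
    then have "carrier W = {\<phi> \<zero>\<^bsub>V\<^esub>}" using bij by (auto simp: bij_betw_def)
    then have "carrier W = {\<zero>\<^bsub>W\<^esub>}" using W.zero_closed by auto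
    then show ?thesis using has_dim_0_iff[OF W] \<open>n = 0\<close> by simp
  next
    assume n1: "n = 1"
    then obtain b where b: "b \<in> carrier V" "\<And>v. v\<in>carrier V \<Longrightarrow> \<exists>!c. c \<in> carrier k \<and> c \<odot>\<^bsub>V\<^esub> b = v"
      using d has_dim_1_iff[OF V] by auto
    have "\<exists>!c. c \<in> carrier k \<and> c \<odot>\<^bsub>W\<^esub> \<phi> b = w" if w: "w \<in> carrier W" for w
    proof -
      obtain v where v: "v \<in> carrier V" "w = \<phi> v" using bij w by (auto simp: bij_betw_def)
      have e: "c \<odot>\<^bsub>W\<^esub> \<phi> b = w \<longleftrightarrow> c \<odot>\<^bsub>V\<^esub> b = v" if c: "c \<in> carrier k" for c
        unfolding v(2) smult[OF c b(1), symmetric]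
        using bij v(1) V.smult_closed[OF c b(1)] by (auto simp: bij_betw_def inj_on_def)
      then have "(c \<in> carrier k \<and> c \<odot>\<^bsub>W\<^esub> \<phi> b = w) \<longleftrightarrow> (c \<in> carrier k \<and> c \<odot>\<^bsub>V\<^esub> b = v)" for c
        by blast
      then show ?thesis using b(2)[OF v(1)] by (simp only:)
    qed
    moreover have "\<phi> b \<in> carrier W" using b bij by (auto simp: bij_betw_def)
    ultimately show ?thesis using has_dim_1_iff[OF W] n1 by blast
  qed
qed

section \<open>Triangulated categories\<close>

context triangulated_category
begin

text \<open>The suspension is bijective on objects, so this is a strict inverse there, and shifts
  add up as equalities of objects rather than up to isomorphism.\<close>

abbreviation dsp :: "'o \<Rightarrow> 'o" where
  "dsp X \<equiv> inv_into (Obj T) (Susp T) X"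

lemma susp_obj [simp]: "X \<in> Obj T \<Longrightarrow> Susp T X \<in> Obj T"
  using Susp_functor by (simp add: is_functor_def)

lemma dsp_obj [simp]: "X \<in> Obj T \<Longrightarrow> dsp X \<in> Obj T"
  using Susp_bij by (metis bij_betw_def inv_into_into)

lemma susp_dsp [simp]: "X \<in> Obj T \<Longrightarrow> Susp T (dsp X) = X"
  using Susp_bij by (metis bij_betw_def f_inv_into_f)

lemma dsp_susp [simp]: "X \<in> Obj T \<Longrightarrow> dsp (Susp T X) = X"
  using Susp_bij by (metis bij_betw_def inv_into_f_f)

lemma arr_susp [simp]: "arr T X Y f \<Longrightarrow> arr T (Susp T X) (Susp T Y) (SuspMor T X Y f)"
  using Susp_functor by (simp add: is_functor_def arr_def)

lemma susp_id [simp]: "X \<in> Obj T \<Longrightarrow> SuspMor T X X (Ident T X) = Ident T (Susp T X)"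
  using Susp_functor by (simp add: is_functor_def)

lemma susp_comp: "arr T X Y f \<Longrightarrow> arr T Y Z g \<Longrightarrow>
  SuspMor T X Z (Comp T X Y Z g f)
    = Comp T (Susp T X) (Susp T Y) (Susp T Z) (SuspMor T Y Z g) (SuspMor T X Y f)"
  using Susp_functor by (simp add: is_functor_def arr_def)

lemma susp_zero [simp]:
  assumes "X \<in> Obj T" "Y \<in> Obj T"
  shows "SuspMor T X Y (zr T X Y) = zr T (Susp T X) (Susp T Y)"
proof (rule add_self_zero)
  have z: "arr T X Y (zr T X Y)" using assms by simp
  then show "arr T (Susp T X) (Susp T Y) (SuspMor T X Y (zr T X Y))" by simp
  show "SuspMor T X Y (zr T X Y) \<oplus>\<^bsub>Hom T (Susp T X) (Susp T Y)\<^esub> SuspMor T X Y (zr T X Y)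
    = SuspMor T X Y (zr T X Y)"
    unfolding Susp_add[OF arrD[OF z] arrD(3)[OF z], symmetric] using z by simp
qed

lemma susp_inj: "arr T X Y f \<Longrightarrow> arr T X Y g \<Longrightarrow> SuspMor T X Y f = SuspMor T X Y g \<Longrightarrow> f = g"
  using SuspMor_bij[of X Y] by (auto simp: arr_def bij_betw_def inj_on_def)

lemma susp_surj:
  assumes "arr T (Susp T X) (Susp T Y) h" "X \<in> Obj T" "Y \<in> Obj T"
  obtains f where "arr T X Y f" "SuspMor T X Y f = h"
proof -
  have "h \<in> SuspMor T X Y ` Mor T X Y"
    using SuspMor_bij[of X Y] assms by (auto simp: arr_def bij_betw_def)
  then show ?thesis using that assms by (auto simp: arr_def)
qed

lemma Tri_arr:
  assumes "Tri T X Y Z f g h"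
  shows "arr T X Y f" "arr T Y Z g" "arr T Z (Susp T X) h"
  using Tri_diagram[OF assms] by (auto simp: triangle_diagram_def arr_def)

lemma Tri_obj:
  assumes "Tri T X Y Z f g h" shows "X \<in> Obj T" "Y \<in> Obj T" "Z \<in> Obj T"
  using Tri_diagram[OF assms] by (auto simp: triangle_diagram_def)

lemma triangle_diagramI: "arr T X Y f \<Longrightarrow> arr T Y Z g \<Longrightarrow> arr T Z (Susp T X) h \<Longrightarrow>
    triangle_diagram T X Y Z f g h"
  by (simp add: triangle_diagram_def arr_def)

lemma Tri_rotate: "Tri T X Y Z f g h \<Longrightarrow>
    Tri T Y Z (Susp T X) g h (\<ominus>\<^bsub>Hom T (Susp T X) (Susp T Y)\<^esub> SuspMor T X Y f)"
  using TR2[OF Tri_diagram] by blast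

lemma Tri_rotate_back:
  assumes t: "Tri T X Y Z f g h"
  obtains w where "Tri T (dsp Z) X Y w f g"
    "h = \<ominus>\<^bsub>Hom T Z (Susp T X)\<^esub> SuspMor T (dsp Z) X w"
proof -
  note o = Tri_obj[OF t] note a = Tri_arr[OF t]
  have "arr T (Susp T (dsp Z)) (Susp T X) (\<ominus>\<^bsub>Hom T Z (Susp T X)\<^esub> h)" using a o by simp
  \<comment> \<open>\<open>TR2\<close> puts minus the suspended first map in third place; hence
    \<open>w\<close> is the desuspension of minus \<open>h\<close>.\<close>
  then obtain w where w: "arr T (dsp Z) X w"
      "SuspMor T (dsp Z) X w = \<ominus>\<^bsub>Hom T Z (Susp T X)\<^esub> h"
    using susp_surj o dsp_obj by metis
  have h: "h = \<ominus>\<^bsub>Hom T Z (Susp T X)\<^esub> SuspMor T (dsp Z) X w"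
    using w(2) neg_add(3)[OF a(3)] by simp
  have "triangle_diagram T (dsp Z) X Y w f g"
    using w a o by (intro triangle_diagramI) auto
  from TR2[OF this] h t o have "Tri T (dsp Z) X Y w f g" by simp
  then show ?thesis using that h by blast
qed

lemma TR3_arr:
  assumes "Tri T X Y Z f g h" "Tri T X' Y' Z' f' g' h'"
    "arr T X X' a" "arr T Y Y' b" "Comp T X Y Y' b f = Comp T X X' Y' f' a"
  obtains c where "arr T Z Z' c" "Comp T Y Z Z' c g = Comp T Y Y' Z' g' b"
    "Comp T Z (Susp T X) (Susp T X') (SuspMor T X X' a) h = Comp T Z Z' (Susp T X') h' c"
  using TR3[OF assms(1,2) arrD(3)[OF assms(3)] arrD(3)[OF assms(4)] assms(5)]
    Tri_obj[OF assms(1)] Tri_obj[OF assms(2)] by (auto simp: arr_def)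

lemma TR1_cone_arr: assumes "arr T X Y f" obtains Z g h where "Tri T X Y Z f g h"
  using TR1_cone[OF arrD[OF assms]] by blast

lemma TR1_fibre:
  assumes "arr T Y Z g" obtains X f h where "Tri T X Y Z f g h"
proof -
  obtain A u v where "Tri T Y Z A g u v" using TR1_cone_arr[OF assms] .
  then show ?thesis using Tri_rotate_back that by metis
qed

lemma exists_zero: obtains E where "zero_object T E"
proof -
  obtain X where X: "direct_sum T X []" using additive unfolding additive_category_def
    by (metis empty_subsetI list.set(1))
  then have o: "X \<in> Obj T" by (simp add: direct_sum_def)
  interpret abelian_group "Hom T X X" using o Hom_abelian by simp
  have "zero_object T X" using X o by (simp add: zero_object_iff direct_sum_def)
  then show ?thesis using that by blast
qed

lemma exists_direct_sum:
  assumes "X \<in> Obj T" "Y \<in> Obj T" obtains Z where "direct_sum T Z [X, Y]"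
  using additive assms unfolding additive_category_def
  by (metis empty_set empty_subsetI insert_subset list.simps(15))

lemma zero_susp: "zero_object T E \<Longrightarrow> zero_object T (Susp T E)"
  by (metis susp_id susp_obj susp_zero zero_object_iff)

lemma zero_dsp: assumes "zero_object T E" shows "zero_object T (dsp E)"
proof -
  have E: "E \<in> Obj T" using assms zero_objectD by blast
  then have "SuspMor T (dsp E) (dsp E) (Ident T (dsp E)) = SuspMor T (dsp E) (dsp E) (zr T (dsp E) (dsp E))"
    using assms by (simp add: zero_object_iff)
  then show ?thesis using E susp_inj[of "dsp E" "dsp E"] by (simp add: zero_object_iff)
qed

section \<open>Exactness of Hom on triangles\<close>

lemma Tri_comp_zero:
  assumes t: "Tri T X Y Z f g h" shows "Comp T X Y Z g f = zr T X Z"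
proof -
  note o = Tri_obj[OF t] note a = Tri_arr[OF t]
  obtain E where E: "zero_object T E" using exists_zero .
  \<comment> \<open>The triangle \<open>X\<close>, \<open>X\<close>, 0 is mapped to the given one;
    \<open>TR3\<close> then factors the composite through the zero object.\<close>
  obtain c where "arr T E Z c" "Comp T X E Z c (zr T X E) = Comp T X Y Z g f"
    using TR3_arr[OF TR1_Ident[OF o(1) E] t, of "Ident T X" f] a o by auto
  then show ?thesis using o(1) by simp
qed

lemma Tri_comp_zero2:
  assumes t: "Tri T X Y Z f g h" shows "Comp T Y Z (Susp T X) h g = zr T Y (Susp T X)"
  using Tri_comp_zero[OF Tri_rotate[OF t]] .

lemma Tri_comp_zero3:
  assumes t: "Tri T X Y Z f g h"
  shows "Comp T Z (Susp T X) (Susp T Y) (SuspMor T X Y f) h = zr T Z (Susp T Y)"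
  using Tri_comp_zero2[OF Tri_rotate[OF t]] Tri_arr[OF t]
  by (simp add: comp_neg_left neg_eq_zero_iff)

text \<open>\<open>TR3\<close> fills in third maps only. The triangles on \<open>A\<close>,
  \<open>A\<close>, 0 and on \<open>X\<close>, \<open>Y\<close>, \<open>Z\<close> are therefore
  rotated once, so that the suspension \<open>c\<close> of the wanted map appears in third
  position.\<close>

lemma Tri_lift:
  assumes t: "Tri T X Y Z f g h" and a: "arr T A Y a" and z: "Comp T A Y Z g a = zr T A Z"
  obtains b where "arr T A X b" "Comp T A X Y f b = a"
proof -
  note o = Tri_obj[OF t] note ar = Tri_arr[OF t]
  obtain E where E: "zero_object T E" using exists_zero .
  note oo = arrD(1)[OF a] zero_objectD[OF E]
  obtain c where c: "arr T (Susp T A) (Susp T X) c"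
    "Comp T (Susp T A) (Susp T A) (Susp T Y) (SuspMor T A Y a)
          (\<ominus>\<^bsub>Hom T (Susp T A) (Susp T A)\<^esub> SuspMor T A A (Ident T A))
      = Comp T (Susp T A) (Susp T X) (Susp T Y) (\<ominus>\<^bsub>Hom T (Susp T X) (Susp T Y)\<^esub> SuspMor T X Y f) c"
    by (rule TR3_arr[OF Tri_rotate[OF TR1_Ident[OF oo(1) E]] Tri_rotate[OF t] a, of "zr T E Z"])
      (use z oo o ar in auto)
  obtain b where b: "arr T A X b" "SuspMor T A X b = c" using susp_surj[OF c(1)] oo o by blast
  have "\<ominus>\<^bsub>Hom T (Susp T A) (Susp T Y)\<^esub> SuspMor T A Y a
    = \<ominus>\<^bsub>Hom T (Susp T A) (Susp T Y)\<^esub> SuspMor T A Y (Comp T A X Y f b)"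
    using c b a ar oo by (simp add: comp_neg_left comp_neg_right susp_comp)
  then have "SuspMor T A Y a = SuspMor T A Y (Comp T A X Y f b)"
    using neg_add(3) arr_susp[OF a] arr_susp[OF arr_comp[OF b(1) ar(1)]] by metis
  then have "a = Comp T A X Y f b" using susp_inj a b ar by (metis arr_comp)
  then show ?thesis using that b by metis
qed

lemma Tri_zero_id:
  assumes "X \<in> Obj T" "zero_object T E"
  shows "Tri T E X X (zr T E X) (Ident T X) (zr T X (Susp T E))"
proof -
  note o = zero_objectD[OF assms(2)]
  have "triangle_diagram T E X X (zr T E X) (Ident T X) (zr T X (Susp T E))"
    using assms o by (intro triangle_diagramI) auto
  from TR2[OF this] show ?thesis
    using TR1_Ident[OF assms(1) zero_susp[OF assms(2)]] assms o by (simp add: neg_zero)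
qed

lemma Tri_extend:
  assumes t: "Tri T X Y Z f g h" and a: "arr T Y A a" and z: "Comp T X Y A a f = zr T X A"
  obtains b where "arr T Z A b" "Comp T Y Z A b g = a"
proof -
  note o = Tri_obj[OF t] note ar = Tri_arr[OF t]
  obtain E where E: "zero_object T E" using exists_zero .
  note oo = arrD(2)[OF a] zero_objectD[OF E]
  obtain c where c: "arr T Z A c" "Comp T Y Z A c g = Comp T Y A A (Ident T A) a"
    by (rule TR3_arr[OF t Tri_zero_id[OF oo(1) E], of "zr T X E" a])
      (use z oo o ar a in auto)
  then show ?thesis using that a by simp
qed

lemma Tri_lift_h:
  assumes t: "Tri T X Y Z f g h" and a: "arr T A Z a"
    and z: "Comp T A Z (Susp T X) h a = zr T A (Susp T X)"
  obtains b where "arr T A Y b" "Comp T A Y Z g b = a"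
  using Tri_lift[OF Tri_rotate[OF t] a z] .

lemma Tri_extend_h:
  assumes t: "Tri T X Y Z f g h" and a: "arr T Z A a" and z: "Comp T Y Z A a g = zr T Y A"
  obtains b where "arr T (Susp T X) A b" "Comp T Z (Susp T X) A b h = a"
  using Tri_extend[OF Tri_rotate[OF t] a z] .

lemma Tri_vanish_mid_right:
  assumes t: "Tri T X Y Z f g h" and v: "Hom_vanishes T A X" "Hom_vanishes T A Z" and A: "A \<in> Obj T"
  shows "Hom_vanishes T A Y"
proof -
  note o = Tri_obj[OF t] note ar = Tri_arr[OF t]
  have "a = zr T A Y" if a: "arr T A Y a" for a
  proof -
    have "Comp T A Y Z g a = zr T A Z" using vanishesD[OF v(2)] a ar by simp
    from Tri_lift[OF t a this] obtain b where "arr T A X b" "Comp T A X Y f b = a" .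
    then show ?thesis using vanishesD[OF v(1)] ar A by (metis comp_zero_right)
  qed
  then show ?thesis using vanishes_iff o A by blast
qed

lemma Tri_vanish_mid_left:
  assumes t: "Tri T X Y Z f g h" and v: "Hom_vanishes T X A" "Hom_vanishes T Z A" and A: "A \<in> Obj T"
  shows "Hom_vanishes T Y A"
proof -
  note o = Tri_obj[OF t] note ar = Tri_arr[OF t]
  have "a = zr T Y A" if a: "arr T Y A a" for a
  proof -
    have "Comp T X Y A a f = zr T X A" using vanishesD[OF v(1)] a ar by simp
    from Tri_extend[OF t a this] obtain b where "arr T Z A b" "Comp T Y Z A b g = a" .
    then show ?thesis using vanishesD[OF v(2)] ar A by (metis comp_zero_left)
  qed
  then show ?thesis using vanishes_iff o A by blast
qed

text \<open>Lifting the identity of \<open>Y\<close> along \<open>f\<close> gives a right inverse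
  because \<open>g\<close> is zero; extending the identity of \<open>X\<close> along
  \<open>f\<close> in the triangle rotated back gives a left inverse.\<close>

lemma Tri_zero_iso:
  assumes t: "Tri T X Y Z f g h" and Z: "zero_object T Z" shows "iso_mor T X Y f"
proof -
  note o = Tri_obj[OF t] note ar = Tri_arr[OF t]
  obtain w where w: "Tri T (dsp Z) X Y w f g" using Tri_rotate_back[OF t] .
  have dz: "zero_object T (dsp Z)" using Z zero_dsp by blast
  have "Comp T Y Y Z g (Ident T Y) = zr T Y Z" using to_zero_object[OF Z ar(2)] ar by simp
  then obtain r where r: "arr T Y X r" "Comp T Y X Y f r = Ident T Y"
    using Tri_lift[OF t arr_id] o by metis
  have "Comp T (dsp Z) X X (Ident T X) w = zr T (dsp Z) X"
    using from_zero_object[OF dz Tri_arr(1)[OF w]] Tri_arr[OF w] by simp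
  then obtain l where l: "arr T Y X l" "Comp T X Y X l f = Ident T X"
    using Tri_extend[OF w arr_id] o by metis
  have "r = l" using comp_reassoc[OF l(2) r(1) ar(1) l(1)] l r by simp
  then show ?thesis using iso_morI[OF ar(1) r(1)] l r by simp
qed

section \<open>Triangles with their morphisms forgotten\<close>

definition tri :: "'o \<Rightarrow> 'o \<Rightarrow> 'o \<Rightarrow> bool" where
  "tri X Y Z \<longleftrightarrow> (\<exists>f g h. Tri T X Y Z f g h)"

lemma triI: "Tri T X Y Z f g h \<Longrightarrow> tri X Y Z" by (auto simp: tri_def)

lemma tri_obj: assumes "tri X Y Z" shows "X \<in> Obj T" "Y \<in> Obj T" "Z \<in> Obj T"
  using assms Tri_obj by (auto simp: tri_def)

lemma tri_rotate: "tri X Y Z \<Longrightarrow> tri Y Z (Susp T X)"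
  unfolding tri_def using Tri_rotate by blast

lemma tri_rotate_back: "tri X Y Z \<Longrightarrow> tri (dsp Z) X Y"
  unfolding tri_def using Tri_rotate_back by metis

text \<open>Three rotations suspend the vertices. The signs they introduce disappear once the
  morphisms are forgotten.\<close>

lemma tri_susp: "tri X Y Z \<Longrightarrow> tri (Susp T X) (Susp T Y) (Susp T Z)"
  by (blast intro: tri_rotate)

lemma tri_dsp: "tri X Y Z \<Longrightarrow> tri (dsp X) (dsp Y) (dsp Z)"
  by (blast intro: tri_rotate_back)

lemma tri_id: "X \<in> Obj T \<Longrightarrow> zero_object T E \<Longrightarrow> tri X X E"
  using TR1_Ident triI by blast

lemma tri_zero: "X \<in> Obj T \<Longrightarrow> zero_object T E \<Longrightarrow> tri E X X"
  using Tri_zero_id triI by blast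

lemma tri_zero_iso: "tri X Y Z \<Longrightarrow> zero_object T Z \<Longrightarrow> isomorphic T X Y"
  unfolding tri_def using Tri_zero_iso isomorphicI Tri_obj by metis

lemma tri_zero_iso': "tri X Y Z \<Longrightarrow> zero_object T X \<Longrightarrow> isomorphic T Y Z"
  using tri_zero_iso tri_rotate zero_susp by blast

lemma Tri_iso:
  assumes t: "Tri T X Y Z f g h"
    and a: "arr T X X' a" "arr T X' X a'" "Comp T X X' X a' a = Ident T X" "Comp T X' X X' a a' = Ident T X'"
    and b: "arr T Y Y' b" "arr T Y' Y b'" "Comp T Y Y' Y b' b = Ident T Y" "Comp T Y' Y Y' b b' = Ident T Y'"
    and c: "arr T Z Z' c" "arr T Z' Z c'" "Comp T Z Z' Z c' c = Ident T Z" "Comp T Z' Z Z' c c' = Ident T Z'"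
  shows "Tri T X' Y' Z' (Comp T X' X Y' (Comp T X Y Y' b f) a')
     (Comp T Y' Y Z' (Comp T Y Z Z' c g) b')
     (Comp T Z' Z (Susp T X') (Comp T Z (Susp T X) (Susp T X') (SuspMor T X X' a) h) c')"
proof (rule TR1_iso[OF t])
  note ar = Tri_arr[OF t]
  show "iso_mor T X X' a" "iso_mor T Y Y' b" "iso_mor T Z Z' c"
    using iso_morI a b c by blast+
  show "triangle_diagram T X' Y' Z' (Comp T X' X Y' (Comp T X Y Y' b f) a')
     (Comp T Y' Y Z' (Comp T Y Z Z' c g) b')
     (Comp T Z' Z (Susp T X') (Comp T Z (Susp T X) (Susp T X') (SuspMor T X X' a) h) c')"
    using a b c ar by (intro triangle_diagramI) auto
  show "Comp T X Y Y' b f = Comp T X X' Y' (Comp T X' X Y' (Comp T X Y Y' b f) a') a"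
    using a b ar by (simp add: comp_assoc)
  show "Comp T Y Z Z' c g = Comp T Y Y' Z' (Comp T Y' Y Z' (Comp T Y Z Z' c g) b') b"
    using b c ar by (simp add: comp_assoc)
  show "Comp T Z (Susp T X) (Susp T X') (SuspMor T X X' a) h =
    Comp T Z Z' (Susp T X') (Comp T Z' Z (Susp T X') (Comp T Z (Susp T X) (Susp T X') (SuspMor T X X' a) h) c') c"
    using a c ar by (simp add: comp_assoc)
qed

lemma tri_iso:
  assumes "tri X Y Z" "isomorphic T X X'" "isomorphic T Y Y'" "isomorphic T Z Z'"
  shows "tri X' Y' Z'"
proof -
  obtain f g h where t: "Tri T X Y Z f g h" using assms(1) by (auto simp: tri_def)
  obtain a a' where a: "arr T X X' a" "arr T X' X a'" "Comp T X X' X a' a = Ident T X" "Comp T X' X X' a a' = Ident T X'"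
    using isomorphicE[OF assms(2)] by metis
  obtain b b' where b: "arr T Y Y' b" "arr T Y' Y b'" "Comp T Y Y' Y b' b = Ident T Y" "Comp T Y' Y Y' b b' = Ident T Y'"
    using isomorphicE[OF assms(3)] by metis
  obtain c c' where c: "arr T Z Z' c" "arr T Z' Z c'" "Comp T Z Z' Z c' c = Ident T Z" "Comp T Z' Z Z' c c' = Ident T Z'"
    using isomorphicE[OF assms(4)] by metis
  show ?thesis using Tri_iso[OF t a b c] triI by blast
qed

text \<open>The cone of a composite is filtered by the cones of its factors; rebracketing of
  filtrations and comparison of cones come from this.\<close>

lemma octahedral:
  assumes "Tri T X Y A f u u'" "Tri T Y Z B g v v'" "Tri T X Z D (Comp T X Y Z g f) w w'"
  shows "tri A D B"
  using TR4[OF assms] triI by blast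

text \<open>Isomorphic objects are those joined by a triangle with zero third vertex, so
  compatibility with suspension is inherited from triangles.\<close>

lemma iso_susp: "isomorphic T X Y \<Longrightarrow> isomorphic T (Susp T X) (Susp T Y)"
  by (meson exists_zero tri_zero_iso tri_susp zero_susp tri_iso tri_id isomorphic_refl
      isomorphicD zero_objectD)

lemma iso_dsp: "isomorphic T X Y \<Longrightarrow> isomorphic T (dsp X) (dsp Y)"
  by (meson exists_zero tri_zero_iso tri_dsp zero_dsp tri_iso tri_id isomorphic_refl
      isomorphicD zero_objectD)

lemma vanish_susp_iff:
  assumes "X \<in> Obj T" "Y \<in> Obj T"
  shows "Hom_vanishes T (Susp T X) (Susp T Y) \<longleftrightarrow> Hom_vanishes T X Y"
proof -
  have *: "SuspMor T X Y f = zr T (Susp T X) (Susp T Y) \<longleftrightarrow> f = zr T X Y" if "arr T X Y f" for f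
    using that susp_inj[OF that arr_zero] assms susp_zero by metis
  show ?thesis unfolding vanishes_iff[OF assms] vanishes_iff[OF susp_obj[OF assms(1)] susp_obj[OF assms(2)]]
    using * susp_surj assms arr_susp by metis
qed

section \<open>Integer shifts\<close>

abbreviation sh :: "'o \<Rightarrow> int \<Rightarrow> 'o" where "sh X i \<equiv> shift T X i"

lemma shift_0 [simp]: "sh X 0 = X" by (simp add: shift_def)

lemma shift_nat_obj: "X \<in> Obj T \<Longrightarrow> (Susp T ^^ n) X \<in> Obj T"
  by (induction n) auto

lemma shift_neg_nat_obj: "X \<in> Obj T \<Longrightarrow> (inv_into (Obj T) (Susp T) ^^ n) X \<in> Obj T"
  by (induction n) auto

lemma shift_obj [simp]: "X \<in> Obj T \<Longrightarrow> sh X i \<in> Obj T"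
  by (simp add: shift_def shift_nat_obj shift_neg_nat_obj)

lemma susp_shift: assumes "X \<in> Obj T" shows "Susp T (sh X i) = sh X (i + 1)"
proof (cases "i \<ge> 0")
  case True
  then have "nat (i + 1) = Suc (nat i)" by simp
  then show ?thesis using True by (simp add: shift_def)
next
  case False
  then have *: "nat (-i) = Suc (nat (-(i+1)))" by simp
  show ?thesis
    using False assms * shift_neg_nat_obj[OF assms, of "nat (-(i+1))"]
    by (cases "i = -1") (auto simp: shift_def)
qed

lemma shift_add1: "X \<in> Obj T \<Longrightarrow> sh X (i + 1) = Susp T (sh X i)"
  by (simp add: susp_shift)

lemma shift_minus1: "X \<in> Obj T \<Longrightarrow> sh X (i - 1) = dsp (sh X i)"
  using susp_shift[of X "i - 1"] by (metis diff_add_cancel dsp_susp shift_obj)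

lemma shift_1 [simp]: "X \<in> Obj T \<Longrightarrow> sh X 1 = Susp T X"
  using susp_shift[of X 0] by simp

lemma shift_m1 [simp]: "X \<in> Obj T \<Longrightarrow> sh X (-1) = dsp X"
  using shift_minus1[of X 0] by simp

lemma shift_shift: assumes "X \<in> Obj T" shows "sh (sh X i) j = sh X (i + j)"
proof (induction j rule: int_induct[of _ 0])
  case (step1 j)
  then show ?case using shift_add1[of "sh X i" j] shift_add1[OF assms, of "i + j"] assms
    by (simp add: add.assoc)
next
  case (step2 j)
  then show ?case using shift_minus1[of "sh X i" j] shift_minus1[OF assms, of "i + j"] assms
    by (simp add: add_diff_eq)
qed simp

lemma iso_shift: assumes "isomorphic T X Y" shows "isomorphic T (sh X i) (sh Y i)"
proof (induction i rule: int_induct[of _ 0])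
  case (step1 j)
  then show ?case using iso_susp isomorphicD[OF assms] by (simp add: shift_add1)
next
  case (step2 j)
  then show ?case using iso_dsp isomorphicD[OF assms] by (simp add: shift_minus1)
qed (use assms in simp)

lemma tri_shift: assumes "tri X Y Z" shows "tri (sh X i) (sh Y i) (sh Z i)"
proof (induction i rule: int_induct[of _ 0])
  case (step1 j)
  then show ?case using tri_susp tri_obj[OF assms] by (simp add: shift_add1)
next
  case (step2 j)
  then show ?case using tri_dsp tri_obj[OF assms] by (simp add: shift_minus1)
qed (use assms in simp)

lemma zero_shift: assumes "zero_object T X" shows "zero_object T (sh X i)"
proof (induction i rule: int_induct[of _ 0])
  case (step1 j)
  then show ?case using zero_susp zero_objectD[OF assms] by (simp add: shift_add1)
next
  case (step2 j)
  then show ?case using zero_dsp zero_objectD[OF assms] by (simp add: shift_minus1)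
qed (use assms in simp)

lemma vanish_shift_iff:
  assumes "X \<in> Obj T" "Y \<in> Obj T"
  shows "Hom_vanishes T (sh X i) (sh Y i) \<longleftrightarrow> Hom_vanishes T X Y"
proof (induction i rule: int_induct[of _ 0])
  case (step1 j)
  then show ?case using assms by (simp add: shift_add1 vanish_susp_iff)
next
  case (step2 j)
  then show ?case using vanish_susp_iff[of "sh X (j - 1)" "sh Y (j - 1)"] assms
    by (simp add: susp_shift)
qed simp

lemma vanish_shift:
  assumes "X \<in> Obj T" "Y \<in> Obj T" "j - i = j' - i'"
  shows "Hom_vanishes T (sh X i) (sh Y j) \<longleftrightarrow> Hom_vanishes T (sh X i') (sh Y j')"
proof -
  have "Hom_vanishes T (sh X i) (sh Y j) \<longleftrightarrow> Hom_vanishes T (sh X 0) (sh Y (j - i))" for i j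
    using vanish_shift_iff[of "sh X 0" "sh Y (j - i)" i] assms by (simp add: shift_shift)
  then show ?thesis using assms(3) by metis
qed

subsection \<open>Extensions\<close>

text \<open>The extension product of Beilinson, Bernstein and Deligne. Filtrations become words in
  it, and reordering their factors becomes an inclusion between two words.\<close>

definition star :: "'o set \<Rightarrow> 'o set \<Rightarrow> 'o set" (infixr "\<star>" 70) where
  "A \<star> B = {Y. \<exists>X\<in>A. \<exists>Z\<in>B. tri X Y Z}"

lemma starI: "tri X Y Z \<Longrightarrow> X \<in> A \<Longrightarrow> Z \<in> B \<Longrightarrow> Y \<in> A \<star> B"
  by (auto simp: star_def)

lemma star_mono: "A \<subseteq> A' \<Longrightarrow> B \<subseteq> B' \<Longrightarrow> A \<star> B \<subseteq> A' \<star> B'"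
  unfolding star_def by blast

lemma star_obj: "A \<star> B \<subseteq> Obj T"
  using tri_obj by (auto simp: star_def)

lemma star_iso: "Y \<in> A \<star> B \<Longrightarrow> isomorphic T Y Y' \<Longrightarrow> Y' \<in> A \<star> B"
  unfolding star_def using tri_iso tri_obj isomorphic_refl by blast

lemma star_assoc: "(A \<star> B) \<star> D = A \<star> (B \<star> D)"
proof (intro equalityI subsetI)
  fix Y assume "Y \<in> (A \<star> B) \<star> D"
  then obtain X Z P Q where XYZ: "tri X Y Z" "Z \<in> D" and PXQ: "tri P X Q" "P \<in> A" "Q \<in> B"
    by (auto simp: star_def)
  obtain f g h where t: "Tri T X Y Z f g h" using XYZ by (auto simp: tri_def)
  obtain f' g' h' where t': "Tri T P X Q f' g' h'" using PXQ by (auto simp: tri_def)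
  obtain W u v where w: "Tri T P Y W (Comp T P X Y f f') u v"
    using TR1_cone_arr[OF arr_comp[OF Tri_arr(1)[OF t'] Tri_arr(1)[OF t]]] .
  have "tri Q W Z" by (rule octahedral[OF t' t w])
  then have "W \<in> B \<star> D" using PXQ XYZ by (blast intro: starI)
  then show "Y \<in> A \<star> (B \<star> D)" using triI[OF w] PXQ by (blast intro: starI)
next
  fix Y assume "Y \<in> A \<star> (B \<star> D)"
  then obtain P W Q Z where PYW: "tri P Y W" "P \<in> A" and QWZ: "tri Q W Z" "Q \<in> B" "Z \<in> D"
    by (auto simp: star_def)
  \<comment> \<open>Rotation yields composable maps from \<open>Y\<close> to \<open>W\<close> to
    \<open>Z\<close>; the desuspended cone of their composite is the wanted extension of
    \<open>Q\<close> by \<open>P\<close>.\<close>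
  obtain f g h where t: "Tri T Y W (Susp T P) f g h" using tri_rotate[OF PYW(1)] by (auto simp: tri_def)
  obtain f' g' h' where t': "Tri T W Z (Susp T Q) f' g' h'" using tri_rotate[OF QWZ(1)] by (auto simp: tri_def)
  obtain E u v where e: "Tri T Y Z E (Comp T Y W Z f' f) u v"
    using TR1_cone_arr[OF arr_comp[OF Tri_arr(1)[OF t] Tri_arr(1)[OF t']]] .
  have "tri (Susp T P) E (Susp T Q)" by (rule octahedral[OF t t' e])
  then have "tri P (dsp E) Q"
    using tri_dsp tri_obj[OF PYW(1)] tri_obj[OF QWZ(1)] by fastforce
  then have "dsp E \<in> A \<star> B" using PYW QWZ by (blast intro: starI)
  moreover have "tri (dsp E) Y Z" using tri_rotate_back[OF triI[OF e]] .
  ultimately show "Y \<in> (A \<star> B) \<star> D" using QWZ by (blast intro: starI)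
qed

lemma star_zero_right:
  assumes "zero_object T E" "E \<in> B" "A \<subseteq> Obj T" shows "A \<subseteq> A \<star> B"
  using assms tri_id by (auto intro: starI)

lemma star_zero_left:
  assumes "zero_object T E" "E \<in> A" "B \<subseteq> Obj T" shows "B \<subseteq> A \<star> B"
  using assms tri_zero by (auto intro: starI)

end

section \<open>Filtered objects\<close>

lemma thick_least: "thick_subcategory T P \<Longrightarrow> S \<subseteq> P \<Longrightarrow> thick T S \<subseteq> P"
  unfolding thick_def by blast

lemma thick_greatest:
  "(\<And>P. thick_subcategory T P \<Longrightarrow> S \<subseteq> P \<Longrightarrow> A \<subseteq> P) \<Longrightarrow> A \<subseteq> thick T S"
  unfolding thick_def by blast

context triangulated_category
begin

lemma tri_vanish_right:
  "tri X Y Z \<Longrightarrow> Hom_vanishes T A X \<Longrightarrow> Hom_vanishes T A Z \<Longrightarrow> A \<in> Obj T \<Longrightarrow> Hom_vanishes T A Y"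
  unfolding tri_def using Tri_vanish_mid_right by blast

lemma tri_vanish_left:
  "tri X Y Z \<Longrightarrow> Hom_vanishes T X A \<Longrightarrow> Hom_vanishes T Z A \<Longrightarrow> A \<in> Obj T \<Longrightarrow> Hom_vanishes T Y A"
  unfolding tri_def using Tri_vanish_mid_left by blast

lemma extension_closedI:
  assumes "P \<subseteq> Obj T" "\<And>X Y. X \<in> P \<Longrightarrow> isomorphic T X Y \<Longrightarrow> Y \<in> P"
    "\<And>X. zero_object T X \<Longrightarrow> X \<in> P"
    "\<And>X Y Z. tri X Y Z \<Longrightarrow> X \<in> P \<Longrightarrow> Z \<in> P \<Longrightarrow> Y \<in> P"
  shows "extension_closed T P"
  unfolding extension_closed_def iso_closed_def using assms triI by blast

lemma extension_closedD:
  assumes "extension_closed T P"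
  shows "P \<subseteq> Obj T" "\<And>X Y. X \<in> P \<Longrightarrow> isomorphic T X Y \<Longrightarrow> Y \<in> P"
    "\<And>X. zero_object T X \<Longrightarrow> X \<in> P"
    "\<And>X Y Z. tri X Y Z \<Longrightarrow> X \<in> P \<Longrightarrow> Z \<in> P \<Longrightarrow> Y \<in> P"
    "P \<star> P \<subseteq> P"
  using assms unfolding extension_closed_def iso_closed_def tri_def star_def by blast+

lemma extension_closed_Obj: "extension_closed T (Obj T)"
  by (rule extension_closedI) (auto dest: isomorphicD zero_objectD tri_obj)

lemma Filt_least: "extension_closed T P \<Longrightarrow> S \<subseteq> P \<Longrightarrow> Filt T S \<subseteq> P"
  unfolding Filt_def by blast

lemma Filt_incl: "S \<subseteq> Filt T S"
  unfolding Filt_def by blast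

lemma extension_closed_Filt:
  assumes "S \<subseteq> Obj T" shows "extension_closed T (Filt T S)"
proof -
  have I: "X \<in> Filt T S" if "\<And>P. extension_closed T P \<Longrightarrow> S \<subseteq> P \<Longrightarrow> X \<in> P" for X
    using that unfolding Filt_def by blast
  show ?thesis
  proof (rule extension_closedI)
    show "Filt T S \<subseteq> Obj T" using Filt_least[OF extension_closed_Obj assms] .
    fix X Y assume X: "X \<in> Filt T S" "isomorphic T X Y"
    show "Y \<in> Filt T S" by (rule I) (use X Filt_least extension_closedD(2) in blast)
  next
    fix X assume X: "zero_object T X"
    show "X \<in> Filt T S" by (rule I) (use X extension_closedD(3) in blast)
  next
    fix X Y Z assume X: "tri X Y Z" "X \<in> Filt T S" "Z \<in> Filt T S"
    show "Y \<in> Filt T S"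
    proof (rule I)
      fix P assume P: "extension_closed T P" "S \<subseteq> P"
      then show "Y \<in> P" using extension_closedD(4)[OF P(1) X(1)] X Filt_least[OF P] by blast
    qed
  qed
qed

lemma Filt_mono: "S \<subseteq> S' \<Longrightarrow> S' \<subseteq> Obj T \<Longrightarrow> Filt T S \<subseteq> Filt T S'"
  using Filt_least[OF extension_closed_Filt] Filt_incl by blast

text \<open>\<open>Filt\<close> is an intersection and carries no length. These stages permit
  induction on the number of factors; each new factor is added on the quotient side.\<close>

primrec filt_len :: "'o set \<Rightarrow> nat \<Rightarrow> 'o set" where
  "filt_len S 0 = {X. zero_object T X}"
| "filt_len S (Suc n) = filt_len S n \<star> S"

lemma filt_len_iso: "X \<in> filt_len S n \<Longrightarrow> isomorphic T X Y \<Longrightarrow> Y \<in> filt_len S n"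
  using zero_object_iso star_iso by (cases n) auto

lemma filt_len_obj: "filt_len S n \<subseteq> Obj T"
  using zero_objectD star_obj by (cases n) auto

lemma star_zeros:
  assumes "\<And>X Y. X \<in> A \<Longrightarrow> isomorphic T X Y \<Longrightarrow> Y \<in> A" "A \<subseteq> Obj T"
  shows "A \<star> {X. zero_object T X} = A" "{X. zero_object T X} \<star> A = A"
proof -
  obtain E where E: "zero_object T E" using exists_zero .
  show "A \<star> {X. zero_object T X} = A"
    using star_zero_right[OF E, of "{X. zero_object T X}" A] E assms(2) tri_zero_iso
    by (auto simp: star_def intro: assms(1))
  show "{X. zero_object T X} \<star> A = A"
    using star_zero_left[OF E, of "{X. zero_object T X}" A] E assms(2) tri_zero_iso' isomorphic_sym
    by (auto simp: star_def intro: assms(1))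
qed

text \<open>Associativity carries the peeled factor from the quotient side to the sub side;
  arguments that start at a bottom factor use this form.\<close>

lemma filt_len_Suc_left:
  assumes "iso_closed T S" shows "S \<star> filt_len S n = filt_len S (Suc n)"
proof (induction n)
  case 0
  have "S \<star> {X. zero_object T X} = S" "{X. zero_object T X} \<star> S = S"
    by (rule star_zeros; use assms in \<open>auto simp: iso_closed_def\<close>)+
  then show ?case by simp
next
  case (Suc n)
  then show ?case by (simp add: star_assoc[symmetric])
qed

lemma filt_len_add:
  "filt_len S m \<star> filt_len S n = filt_len S (m + n)"
proof (induction n)
  case 0
  show ?case using star_zeros(1)[of "filt_len S m"] filt_len_iso filt_len_obj by simp
next
  case (Suc n)
  then show ?case by (simp add: star_assoc[symmetric])
qed

text \<open>The union of the stages is extension-closed because lengths add, and each stage is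
  reached from \<open>S\<close> by finitely many extensions.\<close>

lemma Filt_eq_filt_len:
  assumes S: "iso_closed T S" shows "Filt T S = (\<Union>n. filt_len S n)"
proof
  have o: "S \<subseteq> Obj T" using S by (simp add: iso_closed_def)
  have "{X. zero_object T X} \<star> S = S"
    by (rule star_zeros; use S in \<open>auto simp: iso_closed_def\<close>)
  then have "filt_len S 1 = S" by simp
  then have s: "S \<subseteq> (\<Union>n. filt_len S n)" by blast
  have ext: "extension_closed T (\<Union>n. filt_len S n)"
  proof (rule extension_closedI)
    fix X Y Z assume "tri X Y Z" "X \<in> (\<Union>n. filt_len S n)" "Z \<in> (\<Union>n. filt_len S n)"
    then obtain m n where "X \<in> filt_len S m" "Z \<in> filt_len S n" by blast
    then have "Y \<in> filt_len S (m + n)"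
      using starI[OF \<open>tri X Y Z\<close>] unfolding filt_len_add[symmetric] by simp
    then show "Y \<in> (\<Union>n. filt_len S n)" by blast
  next
    fix X assume "zero_object T X"
    then have "X \<in> filt_len S 0" by simp
    then show "X \<in> (\<Union>n. filt_len S n)" by blast
  next
    fix X Y assume "X \<in> (\<Union>n. filt_len S n)" and i: "isomorphic T X Y"
    then obtain n where "X \<in> filt_len S n" by (elim UN_E)
    from filt_len_iso[OF this i] show "Y \<in> (\<Union>n. filt_len S n)" by (rule UN_I[OF UNIV_I])
  next
    show "(\<Union>n. filt_len S n) \<subseteq> Obj T" using filt_len_obj by (rule UN_least)
  qed
  show "Filt T S \<subseteq> (\<Union>n. filt_len S n)" by (rule Filt_least[OF ext s])
  have "filt_len S n \<subseteq> Filt T S" for n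
  proof (induction n)
    case (Suc n)
    have "filt_len S n \<star> S \<subseteq> Filt T S \<star> Filt T S" by (rule star_mono[OF Suc Filt_incl])
    then show ?case using extension_closedD(5)[OF extension_closed_Filt[OF o]] by simp
  qed (use extension_closedD(3)[OF extension_closed_Filt[OF o]] in auto)
  then show "(\<Union>n. filt_len S n) \<subseteq> Filt T S" by blast
qed

section \<open>Perpendicular subcategories and vanishing on filtrations\<close>

lemma extension_closed_left_perp:
  assumes A: "A \<subseteq> Obj T" shows "extension_closed T (left_perp T A)"
proof (rule extension_closedI)
  show "left_perp T A \<subseteq> Obj T" by (auto simp: left_perp_def)
  fix X assume "zero_object T X"
  then show "X \<in> left_perp T A" using A by (auto simp: left_perp_def zero_object_def)
next
  fix X Y assume "X \<in> left_perp T A" "isomorphic T X Y"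
  then show "Y \<in> left_perp T A"
    using vanishes_iso[OF _ isomorphic_refl] A isomorphicD by (auto simp: left_perp_def)
next
  fix X Y Z assume t: "tri X Y Z" and XZ: "X \<in> left_perp T A" "Z \<in> left_perp T A"
  have "Hom_vanishes T Y B" if "B \<in> A" for B
    by (rule tri_vanish_left[OF t]) (use XZ that A in \<open>auto simp: left_perp_def\<close>)
  then show "Y \<in> left_perp T A" using tri_obj[OF t] by (simp add: left_perp_def)
qed

lemma extension_closed_right_perp:
  assumes A: "A \<subseteq> Obj T" shows "extension_closed T (right_perp T A)"
proof (rule extension_closedI)
  show "right_perp T A \<subseteq> Obj T" by (auto simp: right_perp_def)
  fix X assume "zero_object T X"
  then show "X \<in> right_perp T A" using A by (auto simp: right_perp_def zero_object_def)
next
  fix X Y assume "X \<in> right_perp T A" "isomorphic T X Y"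
  then show "Y \<in> right_perp T A"
    using vanishes_iso[OF isomorphic_refl] A isomorphicD by (auto simp: right_perp_def)
next
  fix X Y Z assume t: "tri X Y Z" and XZ: "X \<in> right_perp T A" "Z \<in> right_perp T A"
  have "Hom_vanishes T B Y" if "B \<in> A" for B
    by (rule tri_vanish_right[OF t]) (use XZ that A in \<open>auto simp: right_perp_def\<close>)
  then show "Y \<in> right_perp T A" using tri_obj[OF t] by (simp add: right_perp_def)
qed

text \<open>A perpendicular is extension-closed, so it contains all objects filtered by
  \<open>S\<close> once it contains \<open>S\<close>.\<close>

lemma Filt_vanish_left:
  assumes "S \<subseteq> Obj T" "A \<in> Obj T" "\<And>X. X \<in> S \<Longrightarrow> Hom_vanishes T X A" "X \<in> Filt T S"
  shows "Hom_vanishes T X A"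
proof -
  have "Filt T S \<subseteq> left_perp T {A}"
    by (rule Filt_least[OF extension_closed_left_perp]) (use assms in \<open>auto simp: left_perp_def\<close>)
  then show ?thesis using assms(4) by (auto simp: left_perp_def)
qed

lemma Filt_vanish_right:
  assumes "S \<subseteq> Obj T" "A \<in> Obj T" "\<And>X. X \<in> S \<Longrightarrow> Hom_vanishes T A X" "X \<in> Filt T S"
  shows "Hom_vanishes T A X"
proof -
  have "Filt T S \<subseteq> right_perp T {A}"
    by (rule Filt_least[OF extension_closed_right_perp]) (use assms in \<open>auto simp: right_perp_def\<close>)
  then show ?thesis using assms(4) by (auto simp: right_perp_def)
qed

lemma shifts_obj: "S \<subseteq> Obj T \<Longrightarrow> shifts T S I \<subseteq> Obj T"
  by (auto simp: shifts_def)

lemma shifts_0 [simp]: "shifts T S {0} = S"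
  by (auto simp: shifts_def)

lemma shiftsI: "X \<in> S \<Longrightarrow> i \<in> I \<Longrightarrow> sh X i \<in> shifts T S I"
  by (auto simp: shifts_def)

lemma right_perp_shifts_iff:
  "X \<in> right_perp T (shifts T S I) \<longleftrightarrow> X \<in> Obj T \<and> (\<forall>A\<in>S. \<forall>i\<in>I. Hom_vanishes T (sh A i) X)"
  by (auto simp: right_perp_def shifts_def)

lemma left_perp_shifts_iff:
  "X \<in> left_perp T (shifts T S I) \<longleftrightarrow> X \<in> Obj T \<and> (\<forall>A\<in>S. \<forall>i\<in>I. Hom_vanishes T X (sh A i))"
  by (auto simp: left_perp_def shifts_def)

lemma right_perp_shift:
  assumes "S \<subseteq> Obj T" "X \<in> right_perp T (shifts T S I)" "\<And>j. j \<in> J \<Longrightarrow> j - n \<in> I"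
  shows "sh X n \<in> right_perp T (shifts T S J)"
  unfolding right_perp_shifts_iff
proof (intro conjI ballI)
  have X: "X \<in> Obj T" using assms(2) by (simp add: right_perp_def)
  then show "sh X n \<in> Obj T" by simp
  fix A i assume a: "A \<in> S" "i \<in> J"
  then have "Hom_vanishes T (sh A (i - n)) (sh X 0)" using assms by (auto simp: right_perp_shifts_iff)
  then show "Hom_vanishes T (sh A i) (sh X n)"
    using vanish_shift[of A X 0 "i - n" n i] a X assms(1) by auto
qed

lemma left_perp_shift:
  assumes "S \<subseteq> Obj T" "X \<in> left_perp T (shifts T S I)" "\<And>j. j \<in> J \<Longrightarrow> j - n \<in> I"
  shows "sh X n \<in> left_perp T (shifts T S J)"
  unfolding left_perp_shifts_iff
proof (intro conjI ballI)
  have X: "X \<in> Obj T" using assms(2) by (simp add: left_perp_def)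
  then show "sh X n \<in> Obj T" by simp
  fix A i assume a: "A \<in> S" "i \<in> J"
  then have "Hom_vanishes T (sh X 0) (sh A (i - n))" using assms by (auto simp: left_perp_shifts_iff)
  then show "Hom_vanishes T (sh X n) (sh A i)"
    using vanish_shift[of X A "i - n" 0 i n] a X assms(1) by auto
qed

lemma Filt_shift:
  assumes S: "S \<subseteq> Obj T" and X: "X \<in> Filt T (shifts T S I)" and J: "\<And>i. i \<in> I \<Longrightarrow> i + n \<in> J"
  shows "sh X n \<in> Filt T (shifts T S J)"
proof -
  note e = extension_closed_Filt[OF shifts_obj[OF S], of J]
  \<comment> \<open>The objects whose \<open>n\<close>-th shift lands in the target are closed under
    extensions, so only generators have to be tested.\<close>
  have "extension_closed T {X \<in> Obj T. sh X n \<in> Filt T (shifts T S J)}"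
  proof (rule extension_closedI)
    fix X Y Z assume "tri X Y Z" "X \<in> {X \<in> Obj T. sh X n \<in> Filt T (shifts T S J)}"
      "Z \<in> {X \<in> Obj T. sh X n \<in> Filt T (shifts T S J)}"
    then show "Y \<in> {X \<in> Obj T. sh X n \<in> Filt T (shifts T S J)}"
      using extension_closedD(4)[OF e tri_shift] tri_obj by auto
  qed (use extension_closedD(2,3)[OF e] iso_shift zero_shift isomorphicD zero_objectD in auto)
  moreover have "shifts T S I \<subseteq> {X \<in> Obj T. sh X n \<in> Filt T (shifts T S J)}"
  proof
    fix Y assume "Y \<in> shifts T S I"
    then obtain A i where A: "Y = sh A i" "A \<in> S" "i \<in> I" by (auto simp: shifts_def)
    then have "A \<in> Obj T" using S by blast
    then show "Y \<in> {X \<in> Obj T. sh X n \<in> Filt T (shifts T S J)}"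
      using subsetD[OF Filt_incl shiftsI[OF A(2) J[OF A(3)]]] A(1) by (simp add: shift_shift)
  qed
  ultimately have "Filt T (shifts T S I) \<subseteq> {X \<in> Obj T. sh X n \<in> Filt T (shifts T S J)}"
    by (rule Filt_least)
  then show ?thesis using X by blast
qed

lemma Filt_vanish:
  assumes S: "S \<subseteq> Obj T" and X: "X \<in> Filt T (shifts T S I)" and Y: "Y \<in> Filt T (shifts T S J)"
    and v: "\<And>A B i j. A \<in> S \<Longrightarrow> B \<in> S \<Longrightarrow> i \<in> I \<Longrightarrow> j \<in> J \<Longrightarrow> Hom_vanishes T (sh A i) (sh B j)"
  shows "Hom_vanishes T X Y"
proof (rule Filt_vanish_left[OF shifts_obj[OF S] _ _ X])
  show "Y \<in> Obj T" using extension_closedD(1)[OF extension_closed_Filt[OF shifts_obj[OF S]]] Y by blast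
  fix A assume A: "A \<in> shifts T S I"
  show "Hom_vanishes T A Y"
    by (rule Filt_vanish_right[OF shifts_obj[OF S] _ _ Y])
      (use A v S in \<open>auto simp: shifts_def\<close>)
qed

section \<open>Thick subcategories\<close>

lemma thick_subcategoryD:
  assumes "thick_subcategory T P"
  shows "P \<subseteq> Obj T" "\<And>X Y. X \<in> P \<Longrightarrow> isomorphic T X Y \<Longrightarrow> Y \<in> P"
    "\<And>X. zero_object T X \<Longrightarrow> X \<in> P" "\<And>X. X \<in> Obj T \<Longrightarrow> X \<in> P \<longleftrightarrow> Susp T X \<in> P"
    "\<And>X Y Z. tri X Y Z \<Longrightarrow> X \<in> P \<Longrightarrow> Y \<in> P \<Longrightarrow> Z \<in> P"
    "\<And>X Y Z. direct_sum T X [Y, Z] \<Longrightarrow> X \<in> P \<Longrightarrow> Y \<in> P"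
  using assms unfolding thick_subcategory_def iso_closed_def tri_def by blast+

text \<open>The definition closes under cones; the other two vertices are reached by rotating and
  then undoing the suspension.\<close>

lemma thick_subcategory_tri:
  assumes P: "thick_subcategory T P" and t: "tri X Y Z"
  shows "X \<in> P \<Longrightarrow> Z \<in> P \<Longrightarrow> Y \<in> P" "Y \<in> P \<Longrightarrow> Z \<in> P \<Longrightarrow> X \<in> P"
proof -
  note D = thick_subcategoryD[OF P] note o = tri_obj[OF t]
  note r = tri_rotate[OF t]
  show "X \<in> P" if "Y \<in> P" "Z \<in> P" using D(4) D(5)[OF r that] o by blast
  show "Y \<in> P" if "X \<in> P" "Z \<in> P"
    using D(4)[OF o(1)] D(4)[OF o(2)] D(5)[OF tri_rotate[OF r]] that by blast
qed

lemma thick_subcategory_shift: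
  assumes P: "thick_subcategory T P" and X: "X \<in> P" shows "sh X i \<in> P"
proof (induction i rule: int_induct[of _ 0])
  case (step1 j)
  then show ?case using thick_subcategoryD(1,4)[OF P] X by (auto simp: shift_add1)
next
  case (step2 j)
  then show ?case using thick_subcategoryD(4)[OF P, of "sh X (j - 1)"] thick_subcategoryD(1)[OF P] X
    by (auto simp: susp_shift)
qed (use X in simp)

lemma extension_closed_thick:
  assumes P: "thick_subcategory T P" shows "extension_closed T P"
  by (rule extension_closedI)
    (fact thick_subcategoryD(1)[OF P] thick_subcategoryD(2)[OF P] thick_subcategoryD(3)[OF P]
      thick_subcategory_tri(1)[OF P])+

lemma thick_subcategory_Obj: "thick_subcategory T (Obj T)"
  unfolding thick_subcategory_def iso_closed_def
  using isomorphicD zero_objectD Tri_obj by (auto simp: direct_sum_def)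

lemma thick_incl: "S \<subseteq> thick T S"
  unfolding thick_def by blast

lemma thick_subcategory_thick:
  assumes "S \<subseteq> Obj T" shows "thick_subcategory T (thick T S)"
proof -
  have o: "thick T S \<subseteq> Obj T" using thick_least[OF thick_subcategory_Obj assms] .
  have I: "X \<in> thick T S" if "\<And>P. thick_subcategory T P \<Longrightarrow> S \<subseteq> P \<Longrightarrow> X \<in> P" for X
    using that unfolding thick_def by blast
  have D: "X \<in> P" if "X \<in> thick T S" "thick_subcategory T P" "S \<subseteq> P" for X P
    using that unfolding thick_def by blast
  show ?thesis
    unfolding thick_subcategory_def iso_closed_def
  proof (intro conjI allI impI ballI)
    show "thick T S \<subseteq> Obj T" by (rule o)
  next
    fix X Y assume "X \<in> thick T S" "isomorphic T X Y"
    then show "Y \<in> thick T S" by (metis I D thick_subcategoryD(2))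
  next
    fix X assume "zero_object T X"
    then show "X \<in> thick T S" by (metis I thick_subcategoryD(3))
  next
    fix X assume X: "X \<in> Obj T"
    show "X \<in> thick T S \<longleftrightarrow> Susp T X \<in> thick T S"
    proof
      assume "X \<in> thick T S"
      then show "Susp T X \<in> thick T S" using X by (metis I D thick_subcategoryD(4))
    next
      assume "Susp T X \<in> thick T S"
      then show "X \<in> thick T S" using X by (metis I D thick_subcategoryD(4))
    qed
  next
    fix X Y Z f g h assume "Tri T X Y Z f g h" "X \<in> thick T S" "Y \<in> thick T S"
    then show "Z \<in> thick T S" by (metis I D thick_subcategoryD(5) triI)
  next
    fix X Y Z assume "direct_sum T X [Y, Z]" "X \<in> thick T S"
    then show "Y \<in> thick T S" by (metis I D thick_subcategoryD(6))
  qed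
qed

end

section \<open>The heart generated by a pre-simple-minded collection\<close>

context linear_category
begin

text \<open>\<open>f\<close> is a nonzero scalar multiple of an isomorphism \<open>p\<close>, hence
  invertible; this is the source of Schur's lemma for \<open>R\<close>.\<close>

lemma one_dim_iso:
  assumes dim: "has_dim k (Hom C X Y) 1" and iso: "isomorphic C X Y"
    and f: "arr C X Y f" "f \<noteq> zr C X Y"
  shows "iso_mor C X Y f"
proof -
  note o = arrD(1,2)[OF f(1)]
  interpret k: field k by (rule field_k)
  interpret M: module k "Hom C X Y" using Hom_module o by blast
  obtain p q where p: "arr C X Y p" "arr C Y X q" "Comp C X Y X q p = Ident C X"
    "Comp C Y X Y p q = Ident C Y" using isomorphicE[OF iso] by metis
  obtain b where b: "b \<in> carrier (Hom C X Y)"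
    "\<forall>v\<in>carrier (Hom C X Y). \<exists>!c. c \<in> carrier k \<and> c \<odot>\<^bsub>Hom C X Y\<^esub> b = v"
    using dim has_dim_1_iff[OF M.module_axioms] by blast
  have pc: "p \<in> carrier (Hom C X Y)" "f \<in> carrier (Hom C X Y)"
    using p f by (auto simp: arr_def Mor_def)
  obtain c where c: "c \<in> carrier k" "c \<odot>\<^bsub>Hom C X Y\<^esub> b = p" using b(2) pc(1) by blast
  obtain d where d: "d \<in> carrier k" "d \<odot>\<^bsub>Hom C X Y\<^esub> b = f" using b(2) pc(2) by blast
  have "p \<noteq> zr C X Y"
  proof
    assume "p = zr C X Y"
    then have "Ident C X = zr C X X" using p o by simp
    then have "f = zr C X Y" using comp_id_right[OF f(1)] f(1) o by simp
    then show False using f by simp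
  qed
  then have "c \<noteq> \<zero>\<^bsub>k\<^esub>" using c b(1) M.smult_l_null by metis
  then have cu: "c \<in> Units k" using c(1) k.field_Units by simp
  \<comment> \<open>The ratio of the coordinates of \<open>f\<close> and \<open>p\<close> with
    respect to \<open>b\<close>, so that \<open>f\<close> is \<open>e\<close> times
    \<open>p\<close>.\<close>
  define e where "e = d \<otimes>\<^bsub>k\<^esub> inv\<^bsub>k\<^esub> c"
  have ec: "e \<in> carrier k" using d cu by (simp add: e_def)
  have "b = inv\<^bsub>k\<^esub> c \<odot>\<^bsub>Hom C X Y\<^esub> p"
    using c(2) M.smult_assoc1[of "inv\<^bsub>k\<^esub> c" c b] cu b(1) c(1) by (simp add: k.Units_l_inv)
  then have fe: "f = e \<odot>\<^bsub>Hom C X Y\<^esub> p"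
    using d cu pc by (simp add: e_def M.smult_assoc1)
  then have "e \<noteq> \<zero>\<^bsub>k\<^esub>" using f(2) pc(1) by auto
  then have eu: "e \<in> Units k" using ec k.field_Units by simp
  define g where "g = inv\<^bsub>k\<^esub> e \<odot>\<^bsub>Hom C Y X\<^esub> q"
  have g: "arr C Y X g" using p eu by (simp add: g_def)
  have mX: "Comp C X Y X g f = inv\<^bsub>k\<^esub> e \<odot>\<^bsub>Hom C X X\<^esub> (e \<odot>\<^bsub>Hom C X X\<^esub> Comp C X Y X q p)"
  proof -
    have "Comp C X Y X g f = inv\<^bsub>k\<^esub> e \<odot>\<^bsub>Hom C X X\<^esub> Comp C X Y X q f"
      unfolding g_def using p eu o f(1) by (intro Comp_smult_left) (auto simp: arr_def)
    also have "Comp C X Y X q f = e \<odot>\<^bsub>Hom C X X\<^esub> Comp C X Y X q p"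
      unfolding fe using p ec o by (intro Comp_smult_right) (auto simp: arr_def)
    finally show ?thesis .
  qed
  have mY: "Comp C Y X Y f g = e \<odot>\<^bsub>Hom C Y Y\<^esub> (inv\<^bsub>k\<^esub> e \<odot>\<^bsub>Hom C Y Y\<^esub> Comp C Y X Y p q)"
  proof -
    have "Comp C Y X Y f g = e \<odot>\<^bsub>Hom C Y Y\<^esub> Comp C Y X Y p g"
      unfolding fe using p ec o g by (intro Comp_smult_left) (auto simp: arr_def)
    also have "Comp C Y X Y p g = inv\<^bsub>k\<^esub> e \<odot>\<^bsub>Hom C Y Y\<^esub> Comp C Y X Y p q"
      unfolding g_def using p eu o by (intro Comp_smult_right) (auto simp: arr_def)
    finally show ?thesis .
  qed
  have id1: "u \<odot>\<^bsub>Hom C A A\<^esub> (v \<odot>\<^bsub>Hom C A A\<^esub> Ident C A) = Ident C A"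
    if "u \<otimes>\<^bsub>k\<^esub> v = \<one>\<^bsub>k\<^esub>" "u \<in> carrier k" "v \<in> carrier k" "A \<in> Obj C" for u v A
  proof -
    interpret A: module k "Hom C A A" using Hom_module that by blast
    have "Ident C A \<in> carrier (Hom C A A)" using that Ident_closed by (auto simp: Mor_def)
    then show ?thesis using that by (simp add: A.smult_assoc1[symmetric])
  qed
  show ?thesis
  proof (rule iso_morI[OF f(1) g])
    show "Comp C X Y X g f = Ident C X"
      unfolding mX p(3) by (rule id1) (use eu ec o in \<open>auto simp: k.Units_l_inv\<close>)
    show "Comp C Y X Y f g = Ident C Y"
      unfolding mY p(4) by (rule id1) (use eu ec o in \<open>auto simp: k.Units_r_inv\<close>)
  qed
qed

lemma one_dim_not_vanish:
  assumes dim: "has_dim k (Hom C X Y) 1" and o: "X \<in> Obj C" "Y \<in> Obj C"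
  shows "\<not> Hom_vanishes C X Y"
proof
  assume v: "Hom_vanishes C X Y"
  interpret k: field k by (rule field_k)
  interpret M: module k "Hom C X Y" using Hom_module o by blast
  have c: "carrier (Hom C X Y) = {\<zero>\<^bsub>Hom C X Y\<^esub>}" using v by (simp add: Hom_vanishes_def Mor_def)
  obtain b where b: "b \<in> carrier (Hom C X Y)"
    "\<forall>v\<in>carrier (Hom C X Y). \<exists>!c. c \<in> carrier k \<and> c \<odot>\<^bsub>Hom C X Y\<^esub> b = v"
    using dim has_dim_1_iff[OF M.module_axioms] by blast
  have "\<zero>\<^bsub>k\<^esub> \<odot>\<^bsub>Hom C X Y\<^esub> b = \<zero>\<^bsub>Hom C X Y\<^esub>" "\<one>\<^bsub>k\<^esub> \<odot>\<^bsub>Hom C X Y\<^esub> b = \<zero>\<^bsub>Hom C X Y\<^esub>"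
    using b(1) c by auto
  then have "\<zero>\<^bsub>k\<^esub> = \<one>\<^bsub>k\<^esub>" using b(2) c k.zero_closed k.one_closed by blast
  then show False using k.zero_not_one by blast
qed

end

locale pre_simple_minded = triangulated_category k T
  for k :: "('k, 'r) ring_scheme" and T :: "('o, 'k, 'm, 'z) tricat_scheme" +
  fixes R :: "'o set"
  assumes pre_SMC: "pre_SMC k T R"
begin

lemma R_iso_closed: "iso_closed T R"
  using pre_SMC by (simp add: pre_SMC_def)

lemma R_obj: "R \<subseteq> Obj T"
  using R_iso_closed by (simp add: iso_closed_def)

lemma R_objD: "A \<in> R \<Longrightarrow> A \<in> Obj T"
  using R_obj by blast

lemma R_vanish_neg: "A \<in> R \<Longrightarrow> B \<in> R \<Longrightarrow> i < 0 \<Longrightarrow> Hom_vanishes T A (sh B i)"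
  using pre_SMC by (simp add: pre_SMC_def)

lemma R_vanish_shift:
  assumes "A \<in> R" "B \<in> R" "j < i" shows "Hom_vanishes T (sh A i) (sh B j)"
  using vanish_shift[of A B j i "j - i" 0] R_vanish_neg[of A B "j - i"] assms R_objD by simp

lemma R_vanish_noniso:
  assumes "A \<in> R" "B \<in> R" "\<not> isomorphic T A B" shows "Hom_vanishes T A B"
proof -
  have "has_dim k (Hom T A B) (if isomorphic T A B then 1 else 0)"
    using pre_SMC assms(1,2) unfolding pre_SMC_def by blast
  then have "has_dim k (Hom T A B) 0" using assms(3) by simp
  then show ?thesis
    using has_dim_0_iff[OF Hom_module[OF R_objD R_objD]] assms by (simp add: Hom_vanishes_def Mor_def)
qed

lemma R_dim:
  assumes "A \<in> R" "B \<in> R" "isomorphic T A B" shows "has_dim k (Hom T A B) 1"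
proof -
  have "has_dim k (Hom T A B) (if isomorphic T A B then 1 else 0)"
    using pre_SMC assms(1,2) unfolding pre_SMC_def by blast
  then show ?thesis using assms(3) by simp
qed

lemma R_schur:
  assumes "A \<in> R" "B \<in> R" "arr T A B f" "f \<noteq> zr T A B" shows "iso_mor T A B f"
  using one_dim_iso[OF R_dim] R_vanish_noniso vanishesD assms by blast

lemma R_not_vanish: "A \<in> R \<Longrightarrow> \<not> Hom_vanishes T A A"
  using one_dim_not_vanish[OF R_dim] R_objD by simp

abbreviation heart :: "'o set" where "heart \<equiv> Filt T R"

lemma heart_ext: "extension_closed T heart"
  by (rule extension_closed_Filt[OF R_obj])

lemma heart_obj: "M \<in> heart \<Longrightarrow> M \<in> Obj T"
  using extension_closedD(1)[OF heart_ext] by blast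

lemma heart_len: "heart = (\<Union>n. filt_len R n)"
  by (rule Filt_eq_filt_len[OF R_iso_closed])

lemma heart_vanish_left: "A \<in> Obj T \<Longrightarrow> (\<And>X. X \<in> R \<Longrightarrow> Hom_vanishes T X A) \<Longrightarrow> X \<in> heart \<Longrightarrow>
    Hom_vanishes T X A"
  by (rule Filt_vanish_left[OF R_obj])

lemma heart_vanish_right: "A \<in> Obj T \<Longrightarrow> (\<And>X. X \<in> R \<Longrightarrow> Hom_vanishes T A X) \<Longrightarrow> X \<in> heart \<Longrightarrow>
    Hom_vanishes T A X"
  by (rule Filt_vanish_right[OF R_obj])

lemma right_approximation_iff:
  assumes "X \<in> Obj T"
  shows "right_approximation T heart X M f \<longleftrightarrow> M \<in> heart \<and> arr T M X f \<and>
    (\<forall>B g. B \<in> heart \<longrightarrow> arr T B X g \<longrightarrow> (\<exists>h. arr T B M h \<and> g = Comp T B M X f h))"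
  unfolding right_approximation_def arr_def using assms heart_obj by blast

lemma left_approximation_iff:
  assumes "X \<in> Obj T"
  shows "left_approximation T heart X M f \<longleftrightarrow> M \<in> heart \<and> arr T X M f \<and>
    (\<forall>B g. B \<in> heart \<longrightarrow> arr T X B g \<longrightarrow> (\<exists>h. arr T M B h \<and> g = Comp T X M B h f))"
  unfolding left_approximation_def arr_def using assms heart_obj by blast

section \<open>Length in the heart\<close>

lemma Tri_iso_zero:
  assumes t: "Tri T X Y Z f g h" and f: "iso_mor T X Y f" shows "zero_object T Z"
proof -
  note o = Tri_obj[OF t] note ar = Tri_arr[OF t]
  obtain f' where f': "arr T Y X f'" "Comp T X Y X f' f = Ident T X" "Comp T Y X Y f f' = Ident T Y"
    using iso_morE[OF f o(1,2)] by metis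
  have "g = Comp T Y X Z (Comp T X Y Z g f) f'" using ar f' by (simp add: comp_assoc)
  then have g: "g = zr T Y Z" using Tri_comp_zero[OF t] f' o by simp
  have sf: "Comp T (Susp T X) (Susp T Y) (Susp T X) (SuspMor T Y X f') (SuspMor T X Y f) = Ident T (Susp T X)"
    using f' ar o by (simp add: susp_comp[symmetric])
  have "h = Comp T Z (Susp T Y) (Susp T X) (SuspMor T Y X f')
      (Comp T Z (Susp T X) (Susp T Y) (SuspMor T X Y f) h)"
    using comp_reassoc[OF sf ar(3)] f' ar by simp
  then have h: "h = zr T Z (Susp T X)" using Tri_comp_zero3[OF t] f' o by simp
  \<comment> \<open>As \<open>h\<close> is zero, the identity of \<open>Z\<close> lifts through
    \<open>g\<close>; as \<open>g\<close> is zero, that identity vanishes.\<close>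
  obtain b where b: "arr T Z Y b" "Comp T Z Y Z g b = Ident T Z"
    using Tri_lift_h[OF t arr_id[OF o(3)]] h o by auto
  then show ?thesis using g o by (auto simp: zero_object_iff)
qed

text \<open>The map is compared with the top factor \<open>B\<close> of \<open>M\<close>. If it
  reaches \<open>B\<close>, Schur's lemma makes it an isomorphism onto \<open>B\<close>, and
  \<open>W\<close> is isomorphic to the rest \<open>M'\<close>. Otherwise it factors through
  \<open>M'\<close>, induction applies there, and \<open>B\<close> is put back on top.\<close>

lemma simple_sub_cone:
  assumes "A \<in> R" "M \<in> filt_len R (Suc n)" "Tri T A M W a u v" "a \<noteq> zr T A M"
  shows "W \<in> filt_len R n"
proof -
  \<comment> \<open>The induction hypothesis is a premise here, so that the same case distinction
    serves the step and also the base case, where that premise is vacuous.\<close>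
  have main: "W \<in> filt_len R n" if M: "M \<in> filt_len R (Suc n)" and t: "Tri T A M W a u v"
    and nz: "a \<noteq> zr T A M"
    and IH: "\<And>M' W' a' u' v' m. n = Suc m \<Longrightarrow> M' \<in> filt_len R n \<Longrightarrow> Tri T A M' W' a' u' v' \<Longrightarrow>
      a' \<noteq> zr T A M' \<Longrightarrow> W' \<in> filt_len R m" for M W a u v n
  proof -
    note o = Tri_obj[OF t] note ar = Tri_arr[OF t]
    obtain M' B m p d where M': "M' \<in> filt_len R n" "B \<in> R" "Tri T M' M B m p d"
      using M by (auto simp: star_def tri_def)
    note o' = Tri_obj[OF M'(3)] note ar' = Tri_arr[OF M'(3)]
    show ?thesis
    proof (cases "Comp T A M B p a = zr T A B")
      case False
      then have iso: "iso_mor T A B (Comp T A M B p a)"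
        using R_schur[OF assms(1) M'(2)] ar ar' by simp
      obtain E w w' where e: "Tri T A B E (Comp T A M B p a) w w'"
        using TR1_cone_arr[OF arr_comp[OF ar(1) ar'(2)]] .
      have "tri W E (Susp T M')" by (rule octahedral[OF t Tri_rotate[OF M'(3)] e])
      then have "tri M' W E" using tri_rotate_back o' by fastforce
      then have "isomorphic T M' W" using tri_zero_iso Tri_iso_zero[OF e iso] by blast
      then show ?thesis using filt_len_iso M'(1) by blast
    next
      case True
      obtain a' where a': "arr T A M' a'" "Comp T A M' M m a' = a"
        using Tri_lift[OF M'(3) ar(1) True] .
      have nz': "a' \<noteq> zr T A M'" using a' nz ar' o by auto
      obtain W' u' v' where t': "Tri T A M' W' a' u' v'" using TR1_cone_arr[OF a'(1)] .
      show ?thesis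
      proof (cases n)
        case 0
        then show ?thesis using M'(1) to_zero_object[OF _ a'(1)] nz' by simp
      next
        case (Suc n')
        have "W' \<in> filt_len R n'" by (rule IH[OF Suc M'(1) t' nz'])
        moreover have "tri W' W B" by (rule octahedral[OF t' M'(3)]) (use t a' in simp)
        ultimately show ?thesis using Suc M'(2) by (auto intro: starI)
      qed
    qed
  qed
  show ?thesis using assms(2-4)
  proof (induction n arbitrary: M W a u v)
    case 0
    show ?case by (rule main[OF 0]) simp
  next
    case (Suc n)
    show ?case by (rule main[OF Suc.prems]) (use Suc.IH in simp)
  qed
qed

text \<open>The dual argument from below: \<open>M\<close> is peeled at a bottom factor
  \<open>B\<close>, and the map to \<open>A\<close> is either an isomorphism on \<open>B\<close> or
  factors through the quotient \<open>M'\<close>.\<close>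

lemma simple_quotient_fibre:
  assumes "A \<in> R" "M \<in> filt_len R (Suc n)" "Tri T K M A u a v" "a \<noteq> zr T M A"
  shows "K \<in> filt_len R n"
proof -
  have main: "K \<in> filt_len R n" if M: "M \<in> filt_len R (Suc n)" and t: "Tri T K M A u a v"
    and nz: "a \<noteq> zr T M A"
    and IH: "\<And>M' K' a' u' v' m. n = Suc m \<Longrightarrow> M' \<in> filt_len R n \<Longrightarrow> Tri T K' M' A u' a' v' \<Longrightarrow>
      a' \<noteq> zr T M' A \<Longrightarrow> K' \<in> filt_len R m" for M K a u v n
  proof -
    note o = Tri_obj[OF t] note ar = Tri_arr[OF t]
    have "M \<in> R \<star> filt_len R n" using M filt_len_Suc_left[OF R_iso_closed] by simp
    then obtain B M' m p d where M': "M' \<in> filt_len R n" "B \<in> R" "Tri T B M M' m p d"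
      by (auto simp: star_def tri_def)
    note o' = Tri_obj[OF M'(3)] note ar' = Tri_arr[OF M'(3)]
    show ?thesis
    proof (cases "Comp T B M A a m = zr T B A")
      case False
      then have iso: "iso_mor T B A (Comp T B M A a m)"
        using R_schur[OF M'(2) assms(1)] ar ar' by simp
      obtain E w w' where e: "Tri T B A E (Comp T B M A a m) w w'"
        using TR1_cone_arr[OF arr_comp[OF ar'(1) ar(2)]] .
      have "tri M' E (Susp T K)" by (rule octahedral[OF M'(3) Tri_rotate[OF t] e])
      then have "tri K M' E" using tri_rotate_back o by fastforce
      then have "isomorphic T K M'" using tri_zero_iso Tri_iso_zero[OF e iso] by blast
      then show ?thesis using filt_len_iso M'(1) isomorphic_sym by blast
    next
      case True
      obtain a' where a': "arr T M' A a'" "Comp T M M' A a' p = a"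
        using Tri_extend[OF M'(3) ar(2) True] .
      have nz': "a' \<noteq> zr T M' A" using a' nz ar' o by auto
      obtain K' u' v' where t': "Tri T K' M' A u' a' v'" using TR1_fibre[OF a'(1)] .
      show ?thesis
      proof (cases n)
        case 0
        then show ?thesis using M'(1) from_zero_object[OF _ a'(1)] nz' by simp
      next
        case (Suc n')
        have K': "K' \<in> filt_len R n'" by (rule IH[OF Suc M'(1) t' nz'])
        \<comment> \<open>Rotated once, the three triangles present the suspended fibres of
          \<open>p\<close>, of \<open>a\<close> and of \<open>a'\<close> as cones, to which the
          octahedral axiom applies.\<close>
        have "tri (Susp T B) (Susp T K) (Susp T K')"
          by (rule octahedral[OF Tri_rotate[OF M'(3)] Tri_rotate[OF t']])
            (use Tri_rotate[OF t] a' in simp)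
        from tri_dsp[OF this] have "tri B K K'" using o o' Tri_obj[OF t'] by simp
        then have "K \<in> R \<star> filt_len R n'" using K' M'(2) by (auto intro: starI)
        then show ?thesis using Suc filt_len_Suc_left[OF R_iso_closed] by simp
      qed
    qed
  qed
  show ?thesis using assms(2-4)
  proof (induction n arbitrary: M K a u v)
    case 0
    show ?case by (rule main[OF 0]) simp
  next
    case (Suc n)
    show ?case by (rule main[OF Suc.prems]) (use Suc.IH in simp)
  qed
qed

text \<open>Among all right approximations by objects of the heart, one whose source has minimal length is
  monic on the heart.  For \<open>x : A \<rightarrow> X'\<close> into its cone, pulling back yields an
  extension \<open>E\<close> of \<open>A\<close> by \<open>M\<close>; the map \<open>E \<rightarrow> X\<close> factors through \<open>f\<close>, and monicity splits \<open>E\<close>.\<close>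

lemma right_approximation_cone:
  assumes X: "X \<in> right_perp T (shifts T R {0<..})"
    and ap: "\<exists>M f. right_approximation T heart X M f"
  shows "\<exists>M\<in>heart. \<exists>X'\<in>right_perp T (shifts T R {0..}). tri M X X'"
proof -
  have XO: "X \<in> Obj T" using X by (simp add: right_perp_shifts_iff)
  have Xv: "Hom_vanishes T (sh A i) X" if "A \<in> R" "i > 0" for A i
    using X that by (simp add: right_perp_shifts_iff)
  define n where "n = (LEAST n. \<exists>M f. M \<in> filt_len R n \<and> right_approximation T heart X M f)"
  have "\<exists>n M f. M \<in> filt_len R n \<and> right_approximation T heart X M f"
    using ap unfolding right_approximation_iff[OF XO] by (metis heart_len UN_E)
  then have "\<exists>M f. M \<in> filt_len R n \<and> right_approximation T heart X M f"
    unfolding n_def by (rule LeastI_ex)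
  then obtain M f where Mn: "M \<in> filt_len R n" and M: "M \<in> heart"
    and f: "arr T M X f" and fac: "\<And>B g. B \<in> heart \<Longrightarrow> arr T B X g \<Longrightarrow>
      \<exists>h. arr T B M h \<and> g = Comp T B M X f h"
    unfolding right_approximation_iff[OF XO] by blast
  have min: "n \<le> m" if "N \<in> filt_len R m" "arr T N X g"
    "\<And>B g'. B \<in> heart \<Longrightarrow> arr T B X g' \<Longrightarrow> \<exists>h. arr T B N h \<and> g' = Comp T B N X g h" for m N g
    unfolding n_def
  proof (rule Least_le)
    have "N \<in> heart" using that(1) unfolding heart_len by blast
    then have "right_approximation T heart X N g"
      unfolding right_approximation_iff[OF XO] using that(2,3) by blast
    then show "\<exists>M f. M \<in> filt_len R m \<and> right_approximation T heart X M f" using that(1) by blast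
  qed
  note MO = heart_obj[OF M]
  \<comment> \<open>A nonzero map from a member of \<open>R\<close> that \<open>f\<close> kills
    could be divided out of \<open>M\<close>: \<open>f\<close> would factor through the shorter
    \<open>W\<close>, which would again carry an approximation.\<close>
  have mono: "a = zr T A M" if A: "A \<in> R" and a: "arr T A M a" and z: "Comp T A M X f a = zr T A X" for A a
  proof (rule ccontr)
    assume nz: "a \<noteq> zr T A M"
    obtain W u v where t: "Tri T A M W a u v" using TR1_cone_arr[OF a] .
    note tar = Tri_arr[OF t]
    obtain m where m: "n = Suc m"
      using Mn nz to_zero_object[OF _ a] by (cases n) auto
    have W: "W \<in> filt_len R m" using simple_sub_cone[OF A _ t nz] Mn m by simp
    obtain g where g: "arr T W X g" "Comp T M W X g u = f" using Tri_extend[OF t f z] .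
    have "n \<le> m"
    proof (rule min[OF W g(1)])
      fix B g' assume "B \<in> heart" "arr T B X g'"
      then obtain h where h: "arr T B M h" "g' = Comp T B M X f h" using fac by blast
      then have "g' = Comp T B W X g (Comp T B M W u h)" using comp_reassoc[OF g(2) h(1) tar(2) g(1)] by simp
      then show "\<exists>h. arr T B W h \<and> g' = Comp T B W X g h" using h tar by (metis arr_comp)
    qed
    then show False using m by simp
  qed
  obtain X' g h where t: "Tri T M X X' f g h" using TR1_cone_arr[OF f] .
  note o = Tri_obj[OF t] note ar = Tri_arr[OF t]
  obtain w where tw: "Tri T (dsp X') M X w f g" using Tri_rotate_back[OF t] .
  note arw = Tri_arr[OF tw]
  \<comment> \<open>A map to the desuspended cone dies in \<open>M\<close> because \<open>f\<close>
    is monic on \<open>R\<close>; so it comes from \<open>dsp X\<close>, which receives no map from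
    \<open>A\<close>.\<close>
  have c2: "Hom_vanishes T A (dsp X')" if A: "A \<in> R" for A
  proof -
    note AO = R_objD[OF A]
    have "x = zr T A (dsp X')" if x: "arr T A (dsp X') x" for x
    proof -
      have "Comp T A M X f (Comp T A (dsp X') M w x) = zr T A X"
        using comp_reassoc[OF Tri_comp_zero[OF tw] x arw(1) arw(2)] x o by simp
      then have z: "Comp T A (dsp X') M w x = zr T A M" using mono[OF A] x arw by simp
      obtain r where r: "Tri T (dsp X) (dsp X') M r w f" using Tri_rotate_back[OF tw] .
      obtain y where y: "arr T A (dsp X) y" "Comp T A (dsp X) (dsp X') r y = x"
        using Tri_lift[OF r x z] .
      have "Hom_vanishes T A (dsp X)"
        using vanish_shift[OF AO XO, of 0 1 "-1" 0] Xv[OF A, of 1] AO XO by simp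
      then show ?thesis using y vanishesD Tri_arr(1)[OF r] AO comp_zero_right by metis
    qed
    then show ?thesis using vanishes_iff AO o by simp
  qed
  \<comment> \<open>Monicity passes from \<open>R\<close> to the whole heart: a killed
    \<open>b\<close> comes from a map to \<open>dsp X'\<close>, and the vanishing of such maps
    passes to filtrations.\<close>
  have c3: "b = zr T B M" if B: "B \<in> heart" and b: "arr T B M b" and z: "Comp T B M X f b = zr T B X" for B b
  proof -
    have "Hom_vanishes T B (dsp X')" by (rule heart_vanish_left[OF _ c2 B]) (use o in simp)
    moreover obtain y where "arr T B (dsp X') y" "Comp T B (dsp X') M w y = b"
      using Tri_lift[OF tw b z] .
    ultimately show ?thesis using vanishesD arw heart_obj[OF B] comp_zero_right by metis
  qed
  have c4: "Hom_vanishes T A X'" if A: "A \<in> R" for A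
  proof -
    note AO = R_objD[OF A]
    have "x = zr T A X'" if x: "arr T A X' x" for x
    proof -
      let ?d = "Comp T A X' (Susp T M) h x"
      have d: "arr T A (Susp T M) ?d" using x ar by simp
      obtain E i e where s: "Tri T M E A i e ?d"
      proof -
        obtain W u v where "Tri T A (Susp T M) W ?d u v" using TR1_cone_arr[OF d] .
        from Tri_rotate_back[OF this] obtain e' where
          e': "Tri T (dsp W) A (Susp T M) e' ?d u" by metis
        from Tri_rotate_back[OF this] obtain i' where "Tri T M (dsp W) A i' e' ?d" using MO by auto
        then show ?thesis using that by blast
      qed
      note sar = Tri_arr[OF s] note so = Tri_obj[OF s]
      have E: "E \<in> heart" using extension_closedD(4)[OF heart_ext triI[OF s] M] A Filt_incl by blast
      \<comment> \<open>After two rotations \<open>TR3\<close> completes \<open>x\<close> and the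
        identity of \<open>Susp T M\<close> to a map of triangles; desuspending \<open>c\<close>
        gives a map \<open>y\<close> from \<open>E\<close> to \<open>X\<close> that extends
        \<open>f\<close>.\<close>
      obtain c where c: "arr T (Susp T E) (Susp T X) c"
        "Comp T (Susp T M) (Susp T E) (Susp T X) c (\<ominus>\<^bsub>Hom T (Susp T M) (Susp T E)\<^esub> SuspMor T M E i)
        = Comp T (Susp T M) (Susp T M) (Susp T X) (\<ominus>\<^bsub>Hom T (Susp T M) (Susp T X)\<^esub> SuspMor T M X f) (Ident T (Susp T M))"
        by (rule TR3_arr[OF Tri_rotate[OF Tri_rotate[OF s]] Tri_rotate[OF Tri_rotate[OF t]] x arr_id])
          (use MO d ar x in auto)
      obtain y where y: "arr T E X y" "SuspMor T E X y = c" using susp_surj[OF c(1) so(2) XO] .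
      have "\<ominus>\<^bsub>Hom T (Susp T M) (Susp T X)\<^esub> SuspMor T M X (Comp T M E X y i)
        = \<ominus>\<^bsub>Hom T (Susp T M) (Susp T X)\<^esub> SuspMor T M X f"
        using c y sar f by (simp add: comp_neg_right susp_comp)
      then have "SuspMor T M X (Comp T M E X y i) = SuspMor T M X f"
        using neg_add(3) arr_susp[OF f] arr_susp[OF arr_comp[OF sar(1) y(1)]] by metis
      then have yi: "Comp T M E X y i = f" using susp_inj y sar f by (metis arr_comp)
      obtain r where r: "arr T E M r" "y = Comp T E M X f r" using fac[OF E y(1)] by blast
      have ri: "arr T M M (Comp T M E M r i)" using r sar by simp
      have "Comp T M M X f (Comp T M E M r i \<ominus>\<^bsub>Hom T M M\<^esub> Ident T M) = zr T M X"
        using yi r f sar MO by (simp add: comp_minus_right comp_assoc minus_zero_iff)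
      then have "Comp T M E M r i \<ominus>\<^bsub>Hom T M M\<^esub> Ident T M = zr T M M"
        by (rule c3[OF M arr_minus[OF ri arr_id[OF MO]]])
      then have split: "Comp T M E M r i = Ident T M" using minus_zero_iff[OF ri arr_id[OF MO]] by simp
      have "?d = Comp T A (Susp T M) (Susp T M) (SuspMor T M M (Comp T M E M r i)) ?d"
        using d MO by (simp add: split)
      also have "\<dots> = Comp T A (Susp T E) (Susp T M) (SuspMor T E M r)
          (Comp T A (Susp T M) (Susp T E) (SuspMor T M E i) ?d)"
        unfolding susp_comp[OF sar(1) r(1)] using r sar d by (intro comp_assoc) auto
      also have "\<dots> = zr T A (Susp T M)" using Tri_comp_zero3[OF s] r AO by simp
      \<comment> \<open>With \<open>?d\<close> zero, \<open>x\<close> lifts to \<open>X\<close> and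
        from there through \<open>f\<close>; but \<open>g\<close> after \<open>f\<close> is
        zero.\<close>
      finally obtain x' where x': "arr T A X x'" "Comp T A X X' g x' = x" using Tri_lift_h[OF t x] by metis
      have "A \<in> heart" using A Filt_incl by blast
      then obtain z where z: "arr T A M z" "x' = Comp T A M X f z" using fac x'(1) by blast
      then have "x = Comp T A M X' (Comp T M X X' g f) z" using x' comp_assoc[OF z(1) ar(1,2)] by simp
      then show ?thesis using Tri_comp_zero[OF t] z o by simp
    qed
    then show ?thesis using vanishes_iff AO o by simp
  qed
  \<comment> \<open>Shift 0 is \<open>c4\<close>, shift 1 is \<open>c2\<close> suspended; from shift
    2 on, both \<open>X\<close> and \<open>Susp T M\<close> receive no map.\<close>
  have "Hom_vanishes T (sh A i) X'" if A: "A \<in> R" and i: "i \<ge> 0" for A i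
  proof -
    note AO = R_objD[OF A]
    consider "i = 0" | "i = 1" | "i \<ge> 2" using i by linarith
    then show ?thesis
    proof cases
      case 1 then show ?thesis using c4[OF A] by simp
    next
      case 2
      then show ?thesis using c2[OF A] vanish_shift[OF AO o(3), of 0 1 "-1" 0] AO o by simp
    next
      case 3
      have "Hom_vanishes T (sh A (i - 1)) B" if "B \<in> R" for B
        using R_vanish_shift[OF A that, of 0 "i - 1"] 3 by simp
      then have "Hom_vanishes T (sh A (i - 1)) (sh M 0)"
        using heart_vanish_right[OF shift_obj[OF AO] _ M] by simp
      then have "Hom_vanishes T (sh A i) (Susp T M)"
        using vanish_shift[OF AO MO, of 0 "i - 1" 1 i] MO by simp
      moreover have "Hom_vanishes T (sh A i) X" using Xv[OF A] 3 by simp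
      ultimately show ?thesis using tri_vanish_right[OF tri_rotate[OF triI[OF t]]] AO by simp
    qed
  qed
  then have "X' \<in> right_perp T (shifts T R {0..})" using o by (simp add: right_perp_shifts_iff)
  then show ?thesis using triI[OF t] M by blast
qed

text \<open>Dual to \<open>right_approximation_cone\<close>: a left approximation of minimal length
  is epic with respect to maps into \<open>R\<close>, and a map \<open>x\<close> from the fibre
  \<open>K\<close> to \<open>A\<close> is shown to vanish by pushing out along it and splitting the
  resulting extension of \<open>M\<close> by \<open>A\<close>.\<close>

lemma left_approximation_fibre:
  assumes X: "X \<in> left_perp T (shifts T R {..<0})"
    and ap: "\<exists>M f. left_approximation T heart X M f"
  shows "\<exists>M\<in>heart. \<exists>K\<in>left_perp T (shifts T R {..0}). tri K X M"
proof -
  have XO: "X \<in> Obj T" using X by (simp add: left_perp_shifts_iff)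
  have Xv: "Hom_vanishes T X (sh A i)" if "A \<in> R" "i < 0" for A i
    using X that by (simp add: left_perp_shifts_iff)
  define n where "n = (LEAST n. \<exists>M f. M \<in> filt_len R n \<and> left_approximation T heart X M f)"
  have "\<exists>n M f. M \<in> filt_len R n \<and> left_approximation T heart X M f"
    using ap unfolding left_approximation_iff[OF XO] by (metis heart_len UN_E)
  then have "\<exists>M f. M \<in> filt_len R n \<and> left_approximation T heart X M f"
    unfolding n_def by (rule LeastI_ex)
  then obtain M f where Mn: "M \<in> filt_len R n" and M: "M \<in> heart"
    and f: "arr T X M f" and fac: "\<And>B g. B \<in> heart \<Longrightarrow> arr T X B g \<Longrightarrow>
      \<exists>h. arr T M B h \<and> g = Comp T X M B h f"
    unfolding left_approximation_iff[OF XO] by blast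
  have min: "n \<le> m" if "N \<in> filt_len R m" "arr T X N g"
    "\<And>B g'. B \<in> heart \<Longrightarrow> arr T X B g' \<Longrightarrow> \<exists>h. arr T N B h \<and> g' = Comp T X N B h g" for m N g
    unfolding n_def
  proof (rule Least_le)
    have "N \<in> heart" using that(1) unfolding heart_len by blast
    then have "left_approximation T heart X N g"
      unfolding left_approximation_iff[OF XO] using that(2,3) by blast
    then show "\<exists>M f. M \<in> filt_len R m \<and> left_approximation T heart X M f" using that(1) by blast
  qed
  note MO = heart_obj[OF M]
  have epi: "a = zr T M A" if A: "A \<in> R" and a: "arr T M A a" and z: "Comp T X M A a f = zr T X A" for A a
  proof (rule ccontr)
    assume nz: "a \<noteq> zr T M A"
    obtain W u v where t: "Tri T W M A u a v" using TR1_fibre[OF a] .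
    note tar = Tri_arr[OF t]
    obtain m where m: "n = Suc m"
      using Mn nz from_zero_object[OF _ a] by (cases n) auto
    have W: "W \<in> filt_len R m" using simple_quotient_fibre[OF A _ t nz] Mn m by simp
    obtain g where g: "arr T X W g" "Comp T X W M u g = f" using Tri_lift[OF t f z] .
    have "n \<le> m"
    proof (rule min[OF W g(1)])
      fix B g' assume "B \<in> heart" "arr T X B g'"
      then obtain h where h: "arr T M B h" "g' = Comp T X M B h f" using fac by blast
      then have "g' = Comp T X W B (Comp T W M B h u) g" using comp_assoc[OF g(1) tar(1) h(1)] g(2) by simp
      then show "\<exists>h. arr T W B h \<and> g' = Comp T X W B h g" using h tar by (metis arr_comp)
    qed
    then show False using m by simp
  qed
  obtain K u w where t: "Tri T K X M u f w" using TR1_fibre[OF f] .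
  note o = Tri_obj[OF t] note ar = Tri_arr[OF t]
  \<comment> \<open>Composed with \<open>w\<close> such a map is zero because \<open>f\<close> is
    epic, so it extends over \<open>Susp T X\<close>, which has no map to \<open>A\<close>.\<close>
  have c2: "Hom_vanishes T (Susp T K) A" if A: "A \<in> R" for A
  proof -
    note AO = R_objD[OF A]
    have "x = zr T (Susp T K) A" if x: "arr T (Susp T K) A x" for x
    proof -
      have "Comp T X M A (Comp T M (Susp T K) A x w) f = zr T X A"
        using comp_assoc[OF ar(2,3) x] Tri_comp_zero2[OF t] x o by simp
      then have z: "Comp T M (Susp T K) A x w = zr T M A" using epi[OF A] x ar by simp
      obtain y where y: "arr T (Susp T X) A y"
        "Comp T (Susp T K) (Susp T X) A y (\<ominus>\<^bsub>Hom T (Susp T K) (Susp T X)\<^esub> SuspMor T K X u) = x"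
        using Tri_extend_h[OF Tri_rotate[OF t] x z] .
      have "Hom_vanishes T (Susp T X) A"
        using vanish_shift[OF XO AO, of 0 1 "-1" 0] Xv[OF A, of "-1"] AO XO by simp
      then have "y = zr T (Susp T X) A" using y vanishesD by blast
      then show ?thesis using y(2) ar(1) AO comp_zero_left[OF AO arr_neg[OF arr_susp[OF ar(1)]]] by simp
    qed
    then show ?thesis using vanishes_iff AO o by simp
  qed
  have c3: "b = zr T M B" if B: "B \<in> heart" and b: "arr T M B b" and z: "Comp T X M B b f = zr T X B" for B b
  proof -
    have v: "Hom_vanishes T (Susp T K) B" by (rule heart_vanish_right[OF _ c2 B]) (use o in simp)
    obtain y where "arr T (Susp T K) B y" "Comp T M (Susp T K) B y w = b"
      using Tri_extend_h[OF t b z] .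
    then show ?thesis using vanishesD[OF v] comp_zero_left[OF heart_obj[OF B] ar(3)] by simp
  qed
  have c4: "Hom_vanishes T K A" if A: "A \<in> R" for A
  proof -
    note AO = R_objD[OF A]
    have "x = zr T K A" if x: "arr T K A x" for x
    proof -
      obtain z where s: "Tri T (dsp M) K X z u f" using Tri_rotate_back[OF t] by metis
      note sar = Tri_arr[OF s]
      let ?d = "Comp T (dsp M) K A x z"
      have d: "arr T (dsp M) A ?d" using x sar by simp
      obtain E i e where q: "Tri T (dsp M) A E ?d i e" using TR1_cone_arr[OF d] .
      note qar = Tri_arr[OF q] note qo = Tri_obj[OF q]
      have e: "arr T E M e" using qar(3) MO by simp
      have "tri A E M" using triI[OF q, THEN tri_rotate] MO by simp
      then have E: "E \<in> heart" using extension_closedD(4)[OF heart_ext _ _ M] A Filt_incl by blast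
      \<comment> \<open>\<open>c\<close> lifts \<open>f\<close> along \<open>e\<close>. It factors
        through \<open>f\<close> as well, and \<open>f\<close> is epic on the heart, so the factor
        \<open>r\<close> is a section of \<open>e\<close>.\<close>
      obtain c where c: "arr T X E c" "Comp T K X E c u = Comp T K A E i x"
        "Comp T X M M (Ident T M) f = Comp T X E M e c"
        using TR3_arr[OF s q arr_id[OF qo(1)] x] d MO qo by auto
      obtain r where r: "arr T M E r" "c = Comp T X M E r f" using fac[OF E c(1)] by blast
      have er: "arr T M M (Comp T M E M e r)" using r e by simp
      have "Comp T X M M (Comp T M E M e r \<ominus>\<^bsub>Hom T M M\<^esub> Ident T M) f = zr T X M"
        using c(3) r f e MO by (simp add: comp_minus_left comp_assoc minus_zero_iff)
      then have "Comp T M E M e r \<ominus>\<^bsub>Hom T M M\<^esub> Ident T M = zr T M M"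
        by (rule c3[OF M arr_minus[OF er arr_id[OF MO]]])
      then have split: "Comp T M E M e r = Ident T M" using minus_zero_iff[OF er arr_id[OF MO]] by simp
      have sd: "arr T M (Susp T A) (SuspMor T (dsp M) A ?d)" using arr_susp[OF d] MO by simp
      have "SuspMor T (dsp M) A ?d = Comp T M M (Susp T A) (SuspMor T (dsp M) A ?d) (Comp T M E M e r)"
        using sd by (simp add: split)
      also have "\<dots> = Comp T M E (Susp T A) (Comp T E M (Susp T A) (SuspMor T (dsp M) A ?d) e) r"
        by (rule comp_assoc[OF r(1) e sd, symmetric])
      also have "Comp T E M (Susp T A) (SuspMor T (dsp M) A ?d) e = zr T E (Susp T A)"
        using Tri_comp_zero3[OF q] MO by simp
      also have "Comp T M E (Susp T A) (zr T E (Susp T A)) r = zr T M (Susp T A)"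
        using r AO by simp
      finally have "SuspMor T (dsp M) A ?d = SuspMor T (dsp M) A (zr T (dsp M) A)"
        using MO AO by simp
      then have "?d = zr T (dsp M) A" using susp_inj d MO AO arr_zero dsp_obj by metis
      then obtain x' where x': "arr T X A x'" "Comp T K X A x' u = x" using Tri_extend[OF s x] by metis
      have "A \<in> heart" using A Filt_incl by blast
      then obtain p where p: "arr T M A p" "x' = Comp T X M A p f" using fac x'(1) by blast
      then have "x = Comp T K M A p (Comp T K X M f u)" using x' comp_assoc[OF ar(1,2) p(1)] by simp
      then show ?thesis using Tri_comp_zero[OF t] p o by simp
    qed
    then show ?thesis using vanishes_iff AO o by simp
  qed
  have "Hom_vanishes T K (sh A i)" if A: "A \<in> R" and i: "i \<le> 0" for A i
  proof -
    note AO = R_objD[OF A]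
    consider "i = 0" | "i = -1" | "i \<le> -2" using i by linarith
    then show ?thesis
    proof cases
      case 1 then show ?thesis using c4[OF A] by simp
    next
      case 2
      then show ?thesis using c2[OF A] vanish_shift[OF o(1) AO, of 0 1 "-1" 0] AO o by simp
    next
      case 3
      have "Hom_vanishes T B (sh A (i + 1))" if "B \<in> R" for B
        using R_vanish_shift[OF that A, of "i + 1" 0] 3 by simp
      then have "Hom_vanishes T (sh M 0) (sh A (i + 1))"
        using heart_vanish_left[OF shift_obj[OF AO] _ M] by simp
      then have "Hom_vanishes T (dsp M) (sh A i)"
        using vanish_shift[OF MO AO, of "i + 1" 0 i "-1"] MO by simp
      moreover have "Hom_vanishes T X (sh A i)" using Xv[OF A] 3 by simp
      ultimately show ?thesis using tri_vanish_left[OF tri_rotate_back[OF triI[OF t]]] AO by simp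
    qed
  qed
  then have "K \<in> left_perp T (shifts T R {..0})" using o by (simp add: left_perp_shifts_iff)
  then show ?thesis using triI[OF t] M by blast
qed

section \<open>Objects filtered by prescribed shifts of \<open>R\<close>\<close>

abbreviation FR :: "int set \<Rightarrow> 'o set" where "FR I \<equiv> Filt T (shifts T R I)"

lemma FR_ext: "extension_closed T (FR I)"
  by (rule extension_closed_Filt[OF shifts_obj[OF R_obj]])

lemma FR_obj: "X \<in> FR I \<Longrightarrow> X \<in> Obj T"
  using extension_closedD(1)[OF FR_ext] by blast

lemma FR_mono: "I \<subseteq> J \<Longrightarrow> FR I \<subseteq> FR J"
  by (rule Filt_mono[OF _ shifts_obj[OF R_obj]]) (auto simp: shifts_def)

lemma FR_shift: "X \<in> FR I \<Longrightarrow> (\<And>i. i \<in> I \<Longrightarrow> i + n \<in> J) \<Longrightarrow> sh X n \<in> FR J"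
  by (rule Filt_shift[OF R_obj])

lemma FR_vanish: "X \<in> FR I \<Longrightarrow> Y \<in> FR J \<Longrightarrow> (\<And>i j. i \<in> I \<Longrightarrow> j \<in> J \<Longrightarrow> j < i) \<Longrightarrow> Hom_vanishes T X Y"
  using Filt_vanish[OF R_obj, of X I Y J] R_vanish_shift by blast

lemma FR_star: "FR I \<star> FR I \<subseteq> FR I"
  by (rule extension_closedD(5)[OF FR_ext])

lemma FR_iso: "X \<in> FR I \<Longrightarrow> isomorphic T X Y \<Longrightarrow> Y \<in> FR I"
  by (rule extension_closedD(2)[OF FR_ext])

lemma FR_zero: "zero_object T X \<Longrightarrow> X \<in> FR I"
  by (rule extension_closedD(3)[OF FR_ext])

lemma FR_gen: "A \<in> R \<Longrightarrow> i \<in> I \<Longrightarrow> sh A i \<in> FR I"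
  using Filt_incl shiftsI by blast

lemma FR_least: "extension_closed T P \<Longrightarrow> (\<And>A i. A \<in> R \<Longrightarrow> i \<in> I \<Longrightarrow> sh A i \<in> P) \<Longrightarrow> FR I \<subseteq> P"
  by (rule Filt_least) (auto simp: shifts_def)

lemma FR_vanish_perp_right:
  assumes "X \<in> FR I" "Y \<in> right_perp T (shifts T R I)" shows "Hom_vanishes T X Y"
  by (rule Filt_vanish_left[OF shifts_obj[OF R_obj] _ _ assms(1)])
    (use assms(2) in \<open>auto simp: right_perp_def\<close>)

lemma FR_vanish_perp_left:
  assumes "X \<in> FR I" "Y \<in> left_perp T (shifts T R I)" shows "Hom_vanishes T Y X"
  by (rule Filt_vanish_right[OF shifts_obj[OF R_obj] _ _ assms(1)])
    (use assms(2) in \<open>auto simp: left_perp_def\<close>)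

text \<open>In terms of the abelian structure of the heart, \<open>E\<close> is an extension of the cokernel of \<open>A \<rightarrow> B\<close> by
  the suspended kernel.  Along a filtration of \<open>A\<close>, simple subobjects killed by the map go to the
  kernel and the others are cancelled against \<open>B\<close>, so that abelianness need not be established.\<close>

lemma cone_of_heart_map:
  assumes "A \<in> filt_len R n" "B \<in> heart" "tri A B E"
  shows "E \<in> FR {1} \<star> heart"
  using assms
proof (induction n arbitrary: A B E)
  case 0
  then have "isomorphic T B E" using tri_zero_iso' by simp
  then have E: "E \<in> heart" using 0(2) extension_closedD(2)[OF heart_ext] by blast
  obtain E0 where E0: "zero_object T E0" using exists_zero .
  show ?case using tri_zero[OF heart_obj[OF E] E0] FR_zero[OF E0] E by (rule starI)
next
  case (Suc n)
  obtain \<phi> u v where t: "Tri T A B E \<phi> u v" using Suc.prems by (auto simp: tri_def)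
  note ar = Tri_arr[OF t] note o = Tri_obj[OF t]
  have "A \<in> R \<star> filt_len R n" using Suc.prems(1) filt_len_Suc_left[OF R_iso_closed] by simp
  then obtain A0 A1 a p d where A: "A0 \<in> R" "A1 \<in> filt_len R n" "Tri T A0 A A1 a p d"
    by (auto simp: star_def tri_def)
  note ar' = Tri_arr[OF A(3)] note o' = Tri_obj[OF A(3)]
  show ?case
  proof (cases "Comp T A0 A B \<phi> a = zr T A0 B")
    case True
    obtain \<phi>' where p': "arr T A1 B \<phi>'" "Comp T A A1 B \<phi>' p = \<phi>"
      using Tri_extend[OF A(3) ar(1) True] .
    obtain E' u' v' where t': "Tri T A1 B E' \<phi>' u' v'" using TR1_cone_arr[OF p'(1)] .
    have E': "E' \<in> FR {1} \<star> heart" by (rule Suc.IH[OF A(2) Suc.prems(2) triI[OF t']])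
    have "tri (Susp T A0) E E'"
      by (rule octahedral[OF Tri_rotate[OF A(3)] t']) (use t p' in simp)
    moreover have "Susp T A0 \<in> FR {1}" using FR_gen[OF A(1), of 1 "{1}"] o' by simp
    ultimately have "E \<in> FR {1} \<star> FR {1} \<star> heart" using E' by (rule starI)
    then show ?thesis unfolding star_assoc[symmetric] using star_mono[OF FR_star subset_refl] by blast
  next
    case False
    obtain B1 w w' where e: "Tri T A0 B B1 (Comp T A0 A B \<phi> a) w w'"
      using TR1_cone_arr[OF arr_comp[OF ar'(1) ar(1)]] .
    \<comment> \<open>The pair \<open>A\<close>, \<open>B\<close> is replaced by \<open>A1\<close>,
      \<open>B1\<close> with the same cone \<open>E\<close>; the induction runs on the length of the
      first entry.\<close>
    have t1: "tri A1 B1 E" by (rule octahedral[OF A(3) t e])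
    obtain m where m: "B \<in> filt_len R m" using Suc.prems(2) heart_len by auto
    then obtain m' where "m = Suc m'"
      using False to_zero_object[OF _ arr_comp[OF ar'(1) ar(1)]] by (cases m) auto
    then have "B1 \<in> filt_len R m'" using simple_sub_cone[OF A(1) _ e False] m by simp
    then have "B1 \<in> heart" unfolding heart_len by blast
    then show ?thesis by (rule Suc.IH[OF A(2) _ t1])
  qed
qed

text \<open>Shifted by \<open>-i\<close> and rotated, \<open>Y\<close> becomes the cone of a map
  between two objects of the heart, and \<open>cone_of_heart_map\<close> filters it in the opposite
  order.\<close>

lemma swap_adjacent: "FR {i} \<star> FR {i + 1} \<subseteq> FR {i + 1} \<star> FR {i}"
proof
  fix Y assume "Y \<in> FR {i} \<star> FR {i + 1}"
  then obtain B A where BA: "B \<in> FR {i}" "A \<in> FR {i + 1}" "tri B Y A" by (auto simp: star_def)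
  note o = tri_obj[OF BA(3)]
  have B': "sh B (-i) \<in> heart" using FR_shift[OF BA(1), of "-i" "{0}"] by simp
  have "sh A (-i - 1) \<in> heart" using FR_shift[OF BA(2), of "-i - 1" "{0}"] by simp
  then obtain n where A': "sh A (-i - 1) \<in> filt_len R n" using heart_len by auto
  have "tri (sh A (-i - 1)) (sh B (-i)) (sh Y (-i))"
    using tri_rotate_back[OF tri_shift[OF BA(3), of "-i"]] o by (simp add: shift_minus1)
  from cone_of_heart_map[OF A' B' this] obtain P Q where PQ: "P \<in> FR {1}" "Q \<in> heart"
    "tri P (sh Y (-i)) Q" by (auto simp: star_def)
  have "sh P i \<in> FR {i + 1}" using FR_shift[OF PQ(1), of i "{i + 1}"] by simp
  moreover have "sh Q i \<in> FR {i}" using FR_shift[of Q "{0}" i "{i}"] PQ(2) by simp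
  moreover have "tri (sh P i) Y (sh Q i)" using tri_shift[OF PQ(3), of i] o by (simp add: shift_shift)
  ultimately show "Y \<in> FR {i + 1} \<star> FR {i}" by (blast intro: starI)
qed

text \<open>A zero map factors through a zero object; the octahedral axiom for this factorization
  exhibits the cone as an extension in the order reverse to the usual one.\<close>

lemma tri_zero_map:
  assumes "tri X Y Z" "Hom_vanishes T X Y" shows "tri (Susp T X) Z Y"
proof -
  obtain f g h where t: "Tri T X Y Z f g h" using assms(1) by (auto simp: tri_def)
  note o = Tri_obj[OF t]
  obtain E0 where E0: "zero_object T E0" using exists_zero .
  have "f = Comp T X E0 Y (zr T E0 Y) (zr T X E0)"
    using vanishesD[OF assms(2) Tri_arr(1)[OF t]] o zero_objectD[OF E0] by simp
  then show ?thesis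
    using octahedral[OF Tri_rotate[OF TR1_Ident[OF o(1) E0]] Tri_zero_id[OF o(2) E0]] t by simp
qed

text \<open>With a gap of at least 2 the gluing map from \<open>dsp A\<close> to \<open>B\<close>
  still goes from a higher to a lower shift, so it is zero.\<close>

lemma swap_distant:
  assumes "i + 1 < j" shows "FR {i} \<star> FR {j} \<subseteq> FR {j} \<star> FR {i}"
proof
  fix Y assume "Y \<in> FR {i} \<star> FR {j}"
  then obtain B A where BA: "B \<in> FR {i}" "A \<in> FR {j}" "tri B Y A" by (auto simp: star_def)
  note o = tri_obj[OF BA(3)]
  have "dsp A \<in> FR {j - 1}" using FR_shift[OF BA(2), of "-1" "{j - 1}"] o by simp
  then have "Hom_vanishes T (dsp A) B" by (rule FR_vanish[OF _ BA(1)]) (use assms in auto)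
  from tri_zero_map[OF tri_rotate_back[OF BA(3)] this] show "Y \<in> FR {j} \<star> FR {i}"
    using BA o by (auto intro: starI)
qed

lemma swap: "i < j \<Longrightarrow> FR {i} \<star> FR {j} \<subseteq> FR {j} \<star> FR {i}"
  using swap_adjacent[of i] swap_distant[of i j] by (cases "j = i + 1") auto

lemma star_UN_left: "Y \<in> A \<star> B \<longleftrightarrow> (\<exists>X\<in>A. Y \<in> {X} \<star> B)"
  by (auto simp: star_def)

lemma star_UN_right: "Y \<in> A \<star> B \<longleftrightarrow> (\<exists>X\<in>B. Y \<in> A \<star> {X})"
  by (auto simp: star_def)

lemma star_singleton_iso:
  assumes i: "isomorphic T Y X" shows "{Y} \<star> A \<subseteq> {X} \<star> A" "A \<star> {Y} \<subseteq> A \<star> {X}"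
proof -
  have "tri X V Z" if "tri Y V Z" for V Z
    using tri_iso[OF that i] tri_obj[OF that] isomorphic_refl by blast
  then show "{Y} \<star> A \<subseteq> {X} \<star> A" unfolding star_def by blast
  have "tri Z V X" if "tri Z V Y" for V Z
    using tri_iso[OF that _ _ i] tri_obj[OF that] isomorphic_refl by blast
  then show "A \<star> {Y} \<subseteq> A \<star> {X}" unfolding star_def by blast
qed

text \<open>The exchange is done one left factor at a time: the objects \<open>X\<close> that can be
  moved past \<open>FR {j}\<close> form an extension-closed class.\<close>

lemma swap_below:
  assumes j: "n < j" shows "FR {..n} \<star> FR {j} \<subseteq> FR {j} \<star> FR {..n}"
proof -
  let ?Q = "FR {..n}" and ?h = "FR {j}"
  let ?P = "{X \<in> Obj T. {X} \<star> ?h \<subseteq> ?h \<star> ?Q}"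
  obtain E0 where E0: "zero_object T E0" using exists_zero .
  have "extension_closed T ?P"
  proof (rule extension_closedI)
    fix X Y assume X: "X \<in> ?P" "isomorphic T X Y"
    have "{Y} \<star> ?h \<subseteq> {X} \<star> ?h"
      by (rule star_singleton_iso(1)[OF isomorphic_sym[OF X(2)]])
    then show "Y \<in> ?P" using X isomorphicD by auto
  next
    fix X assume X: "zero_object T X"
    have "{X} \<star> ?h \<subseteq> ?h"
    proof
      fix Y assume "Y \<in> {X} \<star> ?h"
      then obtain Z where Z: "Z \<in> ?h" "tri X Y Z" by (auto simp: star_def)
      show "Y \<in> ?h" by (rule FR_iso[OF Z(1) isomorphic_sym[OF tri_zero_iso'[OF Z(2) X]]])
    qed
    also have "?h \<subseteq> ?h \<star> ?Q" by (rule star_zero_right[OF E0 FR_zero[OF E0]]) (use FR_obj in blast)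
    finally show "X \<in> ?P" using zero_objectD[OF X] by simp
  next
    fix X Y Z assume t: "tri X Y Z" and X: "X \<in> ?P" and Z: "Z \<in> ?P"
    have "{Y} \<star> ?h \<subseteq> ({X} \<star> {Z}) \<star> ?h" by (rule star_mono) (use t in \<open>auto intro: starI\<close>)
    also have "\<dots> = {X} \<star> ({Z} \<star> ?h)" by (rule star_assoc)
    also have "\<dots> \<subseteq> {X} \<star> (?h \<star> ?Q)" by (rule star_mono) (use Z in auto)
    also have "\<dots> = ({X} \<star> ?h) \<star> ?Q" by (rule star_assoc[symmetric])
    also have "\<dots> \<subseteq> (?h \<star> ?Q) \<star> ?Q" by (rule star_mono) (use X in auto)
    also have "\<dots> = ?h \<star> (?Q \<star> ?Q)" by (rule star_assoc)
    also have "\<dots> \<subseteq> ?h \<star> ?Q" by (rule star_mono[OF subset_refl FR_star])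
    finally show "Y \<in> ?P" using tri_obj[OF t] by simp
  qed auto
  moreover have "sh A i \<in> ?P" if "A \<in> R" "i \<in> {..n}" for A i
  proof -
    have "{sh A i} \<star> ?h \<subseteq> FR {i} \<star> ?h" by (rule star_mono) (use FR_gen[OF that(1), of i "{i}"] in auto)
    also have "\<dots> \<subseteq> ?h \<star> FR {i}" by (rule swap) (use that j in auto)
    also have "\<dots> \<subseteq> ?h \<star> ?Q" by (rule star_mono[OF subset_refl FR_mono]) (use that in auto)
    finally show ?thesis using R_objD[OF that(1)] by simp
  qed
  ultimately have P: "?Q \<subseteq> ?P" by (rule FR_least)
  show ?thesis
  proof
    fix Y assume "Y \<in> ?Q \<star> ?h"
    then obtain X where "X \<in> ?Q" "Y \<in> {X} \<star> ?h" using star_UN_left by blast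
    then show "Y \<in> ?h \<star> ?Q" using P by blast
  qed
qed

text \<open>The same argument in the other variable, with \<open>swap_below\<close> for a single
  shift on the right.\<close>

lemma swap_all: "FR {..n} \<star> FR {n<..} \<subseteq> FR {n<..} \<star> FR {..n}"
proof -
  let ?Q = "FR {..n}" and ?h = "FR {n<..}"
  let ?P = "{X \<in> Obj T. ?Q \<star> {X} \<subseteq> ?h \<star> ?Q}"
  obtain E0 where E0: "zero_object T E0" using exists_zero .
  have "extension_closed T ?P"
  proof (rule extension_closedI)
    fix X Y assume X: "X \<in> ?P" "isomorphic T X Y"
    have "?Q \<star> {Y} \<subseteq> ?Q \<star> {X}"
      by (rule star_singleton_iso(2)[OF isomorphic_sym[OF X(2)]])
    then show "Y \<in> ?P" using X isomorphicD by auto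
  next
    fix X assume X: "zero_object T X"
    have "?Q \<star> {X} \<subseteq> ?Q"
    proof
      fix Y assume "Y \<in> ?Q \<star> {X}"
      then obtain Z where Z: "Z \<in> ?Q" "tri Z Y X" by (auto simp: star_def)
      show "Y \<in> ?Q" by (rule FR_iso[OF Z(1) tri_zero_iso[OF Z(2) X]])
    qed
    also have "?Q \<subseteq> ?h \<star> ?Q" by (rule star_zero_left[OF E0 FR_zero[OF E0]]) (use FR_obj in blast)
    finally show "X \<in> ?P" using zero_objectD[OF X] by simp
  next
    fix X Y Z assume t: "tri X Y Z" and X: "X \<in> ?P" and Z: "Z \<in> ?P"
    have "?Q \<star> {Y} \<subseteq> ?Q \<star> ({X} \<star> {Z})" by (rule star_mono) (use t in \<open>auto intro: starI\<close>)
    also have "\<dots> = (?Q \<star> {X}) \<star> {Z}" by (rule star_assoc[symmetric])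
    also have "\<dots> \<subseteq> (?h \<star> ?Q) \<star> {Z}" by (rule star_mono) (use X in auto)
    also have "\<dots> = ?h \<star> (?Q \<star> {Z})" by (rule star_assoc)
    also have "\<dots> \<subseteq> ?h \<star> (?h \<star> ?Q)" by (rule star_mono) (use Z in auto)
    also have "\<dots> = (?h \<star> ?h) \<star> ?Q" by (rule star_assoc[symmetric])
    also have "\<dots> \<subseteq> ?h \<star> ?Q" by (rule star_mono[OF FR_star subset_refl])
    finally show "Y \<in> ?P" using tri_obj[OF t] by simp
  qed auto
  moreover have "sh A i \<in> ?P" if "A \<in> R" "i \<in> {n<..}" for A i
  proof -
    have "?Q \<star> {sh A i} \<subseteq> ?Q \<star> FR {i}" by (rule star_mono) (use FR_gen[OF that(1), of i "{i}"] in auto)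
    also have "\<dots> \<subseteq> FR {i} \<star> ?Q" by (rule swap_below) (use that in auto)
    also have "\<dots> \<subseteq> ?h \<star> ?Q" by (rule star_mono[OF FR_mono subset_refl]) (use that in auto)
    finally show ?thesis using R_objD[OF that(1)] by simp
  qed
  ultimately have P: "?h \<subseteq> ?P" by (rule FR_least)
  show ?thesis
  proof
    fix Y assume "Y \<in> ?Q \<star> ?h"
    then obtain X where "X \<in> ?h" "Y \<in> ?Q \<star> {X}" using star_UN_right by blast
    then show "Y \<in> ?h \<star> ?Q" using P by blast
  qed
qed

text \<open>In a product of two sorted words only the middle pair is out of order, and
  \<open>swap_all\<close> exchanges it; hence the sorted objects are closed under
  extensions.\<close>

lemma FR_UNIV_split: "FR UNIV \<subseteq> FR {n<..} \<star> FR {..n}"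
proof (rule FR_least)
  let ?Q = "FR {..n}" and ?h = "FR {n<..}"
  obtain E0 where E0: "zero_object T E0" using exists_zero .
  have h: "?h \<subseteq> ?h \<star> ?Q" by (rule star_zero_right[OF E0 FR_zero[OF E0]]) (use FR_obj in blast)
  have Q: "?Q \<subseteq> ?h \<star> ?Q" by (rule star_zero_left[OF E0 FR_zero[OF E0]]) (use FR_obj in blast)
  show "extension_closed T (?h \<star> ?Q)"
  proof (rule extension_closedI)
    fix X Y Z assume "tri X Y Z" "X \<in> ?h \<star> ?Q" "Z \<in> ?h \<star> ?Q"
    then have "Y \<in> (?h \<star> ?Q) \<star> (?h \<star> ?Q)" by (rule starI)
    also have "(?h \<star> ?Q) \<star> (?h \<star> ?Q) = ?h \<star> (?Q \<star> ?h) \<star> ?Q" by (simp only: star_assoc)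
    also have "\<dots> \<subseteq> ?h \<star> (?h \<star> ?Q) \<star> ?Q" by (intro star_mono swap_all subset_refl)
    also have "\<dots> = (?h \<star> ?h) \<star> (?Q \<star> ?Q)" by (simp only: star_assoc)
    also have "\<dots> \<subseteq> ?h \<star> ?Q" by (intro star_mono FR_star)
    finally show "Y \<in> ?h \<star> ?Q" .
  next
    fix X assume "zero_object T X"
    then show "X \<in> ?h \<star> ?Q" using h FR_zero by blast
  qed (use star_obj star_iso in blast)+
  fix A i assume A: "A \<in> R"
  show "sh A i \<in> ?h \<star> ?Q"
  proof (cases "i \<le> n")
    case True then show ?thesis using Q FR_gen[OF A, of i "{..n}"] by auto
  next
    case False then show ?thesis using h FR_gen[OF A, of i "{n<..}"] by auto
  qed
qed

text \<open>A lower bound for the shifts survives extensions as a minimum. It supplies the level at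
  which direct summands get truncated.\<close>

lemma FR_UNIV_bounded: "X \<in> FR UNIV \<Longrightarrow> \<exists>a. X \<in> FR {a..}"
proof -
  have "FR UNIV \<subseteq> {X. \<exists>a. X \<in> FR {a..}}"
  proof (rule FR_least)
    show "extension_closed T {X. \<exists>a. X \<in> FR {a..}}"
    proof (rule extension_closedI)
      fix X Y Z assume t: "tri X Y Z" and "X \<in> {X. \<exists>a. X \<in> FR {a..}}" "Z \<in> {X. \<exists>a. X \<in> FR {a..}}"
      then obtain a b where "X \<in> FR {a..}" "Z \<in> FR {b..}" by blast
      then have "X \<in> FR {min a b..}" "Z \<in> FR {min a b..}"
        using FR_mono[of "{a..}" "{min a b..}"] FR_mono[of "{b..}" "{min a b..}"] by auto
      then show "Y \<in> {X. \<exists>a. X \<in> FR {a..}}" using extension_closedD(4)[OF FR_ext t] by blast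
    qed (use FR_obj FR_iso FR_zero in blast)+
    fix A i assume "A \<in> R"
    then show "sh A i \<in> {X. \<exists>a. X \<in> FR {a..}}" using FR_gen[of A i "{i..}"] by auto
  qed
  then show "X \<in> FR UNIV \<Longrightarrow> \<exists>a. X \<in> FR {a..}" by blast
qed

lemma FR_thick: "FR I \<subseteq> thick T R"
proof (rule FR_least)
  note t = thick_subcategory_thick[OF R_obj]
  show "extension_closed T (thick T R)" by (rule extension_closed_thick[OF t])
  show "sh A i \<in> thick T R" if "A \<in> R" for A i
    using thick_subcategory_shift[OF t] thick_incl that by blast
qed

end

locale simple_minded_reduction = pre_simple_minded k T R
  for k :: "('k, 'r) ring_scheme" and T :: "('o, 'k, 'm, 'z) tricat_scheme" and R :: "'o set" +
  assumes R1_contra: "contravariantly_finite T (Filt T R) (right_perp T (shifts T R {0<..}))"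
    and R1_co: "covariantly_finite T (Filt T R) (left_perp T (shifts T R {..<0}))"
    and R2: "\<forall>X\<in>Obj T. \<exists>n. \<forall>i\<le>n. \<forall>A\<in>Filt T R.
      Hom_vanishes T X (shift T A i) \<and> Hom_vanishes T A (shift T X i)"
begin

section \<open>Truncation of arbitrary objects\<close>

lemma truncate_right_step:
  assumes X: "X \<in> right_perp T (shifts T R {N + 1..})"
  shows "X \<in> FR {N} \<star> right_perp T (shifts T R {N..})"
proof -
  have XO: "X \<in> Obj T" using X by (simp add: right_perp_def)
  have X': "sh X (-N) \<in> right_perp T (shifts T R {0<..})"
    by (rule right_perp_shift[OF R_obj X]) auto
  then have "\<exists>M f. right_approximation T heart (sh X (-N)) M f"
    using R1_contra unfolding contravariantly_finite_def by blast
  from right_approximation_cone[OF X' this] obtain M Y where MY: "M \<in> heart"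
    "Y \<in> right_perp T (shifts T R {0..})" "tri M (sh X (-N)) Y" by blast
  have "sh M N \<in> FR {N}" using FR_shift[of M "{0}" N "{N}"] MY(1) by simp
  moreover have "sh Y N \<in> right_perp T (shifts T R {N..})"
    by (rule right_perp_shift[OF R_obj MY(2)]) auto
  moreover have "tri (sh M N) X (sh Y N)" using tri_shift[OF MY(3), of N] XO by (simp add: shift_shift)
  ultimately show ?thesis by (blast intro: starI)
qed

lemma truncate_left_step:
  assumes X: "X \<in> left_perp T (shifts T R {..<N})"
  shows "X \<in> left_perp T (shifts T R {..N}) \<star> FR {N}"
proof -
  have XO: "X \<in> Obj T" using X by (simp add: left_perp_def)
  have X': "sh X (-N) \<in> left_perp T (shifts T R {..<0})"
    by (rule left_perp_shift[OF R_obj X]) auto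
  then have "\<exists>M f. left_approximation T heart (sh X (-N)) M f"
    using R1_co unfolding covariantly_finite_def by blast
  from left_approximation_fibre[OF X' this] obtain M Y where MY: "M \<in> heart"
    "Y \<in> left_perp T (shifts T R {..0})" "tri Y (sh X (-N)) M" by blast
  have "sh M N \<in> FR {N}" using FR_shift[of M "{0}" N "{N}"] MY(1) by simp
  moreover have "sh Y N \<in> left_perp T (shifts T R {..N})"
    by (rule left_perp_shift[OF R_obj MY(2)]) auto
  moreover have "tri (sh Y N) X (sh M N)" using tri_shift[OF MY(3), of N] XO by (simp add: shift_shift)
  ultimately show ?thesis by (blast intro: starI)
qed

lemma perp_obj: "right_perp T A \<subseteq> Obj T" "left_perp T A \<subseteq> Obj T"
  by (auto simp: right_perp_def left_perp_def)

text \<open>Each step removes the maps from one more shift of \<open>R\<close>, descending from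
  \<open>N + 1\<close> to \<open>N\<close>; (R2) provides a level at which to start.\<close>

lemma truncate_right:
  assumes XO: "X \<in> Obj T" shows "X \<in> FR {m..} \<star> right_perp T (shifts T R {m..})"
proof -
  let ?p = "\<lambda>N. right_perp T (shifts T R {N..})"
  obtain E0 where E0: "zero_object T E0" using exists_zero .
  have *: "?p N \<subseteq> FR {m..} \<star> ?p m" if "m \<le> N" for N
    using that
  proof (induction N rule: int_ge_induct)
    case base
    show ?case by (rule star_zero_left[OF E0 FR_zero[OF E0] perp_obj(1)])
  next
    case (step N)
    have "?p (N + 1) \<subseteq> FR {N} \<star> ?p N" using truncate_right_step by blast
    also have "\<dots> \<subseteq> FR {m..} \<star> FR {m..} \<star> ?p m"
      by (rule star_mono[OF FR_mono step.IH]) (use step.hyps in auto)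
    also have "\<dots> = (FR {m..} \<star> FR {m..}) \<star> ?p m" by (rule star_assoc[symmetric])
    also have "\<dots> \<subseteq> FR {m..} \<star> ?p m" by (rule star_mono[OF FR_star subset_refl])
    finally show ?case .
  qed
  obtain n where n: "\<And>i A. i \<le> n \<Longrightarrow> A \<in> heart \<Longrightarrow> Hom_vanishes T A (sh X i)" using R2 XO by blast
  \<comment> \<open>Maps from \<open>sh A i\<close> to \<open>X\<close> correspond to maps from
    \<open>A\<close> to \<open>sh X (-i)\<close>, so the bound \<open>n\<close> of (R2) enters with
    the opposite sign.\<close>
  have "Hom_vanishes T (sh A i) X" if "A \<in> R" "i \<ge> -n" for A i
    using n[of "-i" A] that subsetD[OF Filt_incl, of A R] vanish_shift[of A X 0 i "-i" 0] R_objD XO by simp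
  then have "X \<in> ?p (max m (-n))" using XO by (simp add: right_perp_shifts_iff)
  then show ?thesis using *[of "max m (-n)"] by auto
qed

text \<open>Here the truncation climbs, from a sufficiently negative shift up to
  \<open>m\<close>.\<close>

lemma truncate_left:
  assumes XO: "X \<in> Obj T" shows "X \<in> left_perp T (shifts T R {..m}) \<star> FR {..m}"
proof -
  let ?p = "\<lambda>N. left_perp T (shifts T R {..N})"
  obtain E0 where E0: "zero_object T E0" using exists_zero .
  have *: "?p N \<subseteq> ?p m \<star> FR {..m}" if "N \<le> m" for N
    using that
  proof (induction N rule: int_le_induct)
    case base
    show ?case by (rule star_zero_right[OF E0 FR_zero[OF E0] perp_obj(2)])
  next
    case (step N)
    have "{..<N} = {..N - 1}" by auto
    then have "?p (N - 1) \<subseteq> ?p N \<star> FR {N}" using truncate_left_step[of _ N] by auto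
    also have "\<dots> \<subseteq> (?p m \<star> FR {..m}) \<star> FR {..m}"
      by (rule star_mono[OF step.IH FR_mono]) (use step.hyps in auto)
    also have "\<dots> = ?p m \<star> FR {..m} \<star> FR {..m}" by (rule star_assoc)
    also have "\<dots> \<subseteq> ?p m \<star> FR {..m}" by (rule star_mono[OF subset_refl FR_star])
    finally show ?case .
  qed
  obtain n where n: "\<And>i A. i \<le> n \<Longrightarrow> A \<in> heart \<Longrightarrow> Hom_vanishes T X (sh A i)" using R2 XO by blast
  have "Hom_vanishes T X (sh A i)" if "A \<in> R" "i \<le> n" for A i
    using n[of i A] that subsetD[OF Filt_incl, of A R] by simp
  then have "X \<in> ?p (min m n)" using XO by (simp add: left_perp_shifts_iff)
  then show ?thesis using *[of "min m n"] by auto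
qed

text \<open>\<open>Y\<close> is truncated at a lower bound \<open>a\<close> for \<open>X\<close>.
  The map from \<open>X\<close> to the remainder \<open>Y2\<close> vanishes, hence so does
  \<open>q\<close>. Then the identity of \<open>Y2\<close> factors through \<open>Susp T Y1\<close>,
  which has no nonzero map to \<open>Y2\<close>, so \<open>Y2\<close> is zero.\<close>

lemma FR_UNIV_summand:
  assumes X: "X \<in> FR UNIV" and i: "arr T Y X i" and p: "arr T X Y p"
    and pi: "Comp T Y X Y p i = Ident T Y"
  shows "Y \<in> FR UNIV"
proof -
  obtain a where a: "X \<in> FR {a..}" using FR_UNIV_bounded[OF X] by blast
  note YO = arrD(1)[OF i]
  obtain Y1 Y2 f q h where Y: "Y1 \<in> FR {a..}" "Y2 \<in> right_perp T (shifts T R {a..})" "Tri T Y1 Y Y2 f q h"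
    using truncate_right[OF YO, of a] by (auto simp: star_def tri_def)
  note ar = Tri_arr[OF Y(3)] note o = Tri_obj[OF Y(3)]
  have "Comp T X Y Y2 q p = zr T X Y2"
    by (rule vanishesD[OF FR_vanish_perp_right[OF a Y(2)] arr_comp[OF p ar(2)]])
  then have "q = zr T Y Y2"
    using comp_assoc[OF i p ar(2)] pi ar(2) i o by simp
  then have "Comp T Y Y2 Y2 (Ident T Y2) q = zr T Y Y2" using ar o by simp
  then obtain c where c: "arr T (Susp T Y1) Y2 c" "Comp T Y2 (Susp T Y1) Y2 c h = Ident T Y2"
    using Tri_extend_h[OF Y(3) arr_id[OF o(3)]] by metis
  have "Susp T Y1 \<in> FR {a..}" using FR_shift[OF Y(1), of 1 "{a..}"] o by simp
  then have "c = zr T (Susp T Y1) Y2" using vanishesD[OF FR_vanish_perp_right[OF _ Y(2)] c(1)] by blast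
  then have "zero_object T Y2" using c ar o by (simp add: zero_object_iff)
  then have "isomorphic T Y1 Y" using tri_zero_iso triI[OF Y(3)] by blast
  then have "Y \<in> FR {a..}" using FR_iso Y(1) by blast
  then show ?thesis using FR_mono[of "{a..}" UNIV] by blast
qed

lemma thick_eq_FR: "thick T R = FR UNIV"
proof
  show "FR UNIV \<subseteq> thick T R" by (rule FR_thick)
  show "thick T R \<subseteq> FR UNIV"
  proof (rule thick_least)
    show "R \<subseteq> FR UNIV" using FR_gen[of _ 0 UNIV] by auto
    show "thick_subcategory T (FR UNIV)"
      unfolding thick_subcategory_def iso_closed_def
    proof (intro conjI allI impI ballI)
      show "FR UNIV \<subseteq> Obj T" using FR_obj by blast
      fix X assume X: "X \<in> Obj T"
      show "X \<in> FR UNIV \<longleftrightarrow> Susp T X \<in> FR UNIV"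
        using FR_shift[of X UNIV 1 UNIV] FR_shift[of "Susp T X" UNIV "-1" UNIV] X by auto
    next
      fix X Y Z f g h assume t: "Tri T X Y Z f g h" "X \<in> FR UNIV" "Y \<in> FR UNIV"
      have "Susp T X \<in> FR UNIV" using FR_shift[OF t(2), of 1 UNIV] Tri_obj[OF t(1)] by simp
      then show "Z \<in> FR UNIV" using extension_closedD(4)[OF FR_ext tri_rotate[OF triI[OF t(1)]] t(3)] by simp
    next
      fix X Y Z assume "direct_sum T X [Y, Z]" and X: "X \<in> FR UNIV"
      then obtain i p where "arr T Y X i" "arr T X Y p" "Comp T Y X Y p i = Ident T Y"
        unfolding direct_sum_pair_iff by blast
      then show "Y \<in> FR UNIV" by (rule FR_UNIV_summand[OF X])
    qed (use FR_iso FR_zero in blast)+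
  qed
qed

lemma thick_split: "thick T R \<subseteq> FR {n<..} \<star> FR {..n}"
  unfolding thick_eq_FR by (rule FR_UNIV_split)

end

section \<open>The Verdier quotient as a linear category\<close>

text \<open>Operations in the quotient are unions of classes. Showing every contributing class equal
  to one fixed class is precisely their well-definedness.\<close>

lemma Union_eq_single:
  assumes "a \<in> A" "\<And>b. b \<in> A \<Longrightarrow> b = c" shows "\<Union>A = c"
  using assms by blast

locale verdier = triangulated_category k T
  for k :: "('k, 'r) ring_scheme" and T :: "('o, 'k, 'm, 'z) tricat_scheme" +
  fixes N :: "'o set"
  assumes thick_N: "thick_subcategory T N"
begin

abbreviation U where "U \<equiv> verdier_quotient T N"

lemma U_simps [simp]:
  "Obj U = Obj T" "Hom U = quotient_Hom T N" "Comp U = quotient_Comp T N"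
  "Susp U = Susp T" "SuspMor U = quotient_SuspMor T N" "Tri U = quotient_Tri T N"
  "Ident U X = roof_class T N X X (X, Ident T X, Ident T X)"
  by (simp_all add: verdier_quotient_def quotient_cat_def lincat.defs tricat.defs)

section \<open>Denominators and the calculus of fractions\<close>

definition denom :: "'o \<Rightarrow> 'o \<Rightarrow> 'm \<Rightarrow> bool" where
  "denom V W t \<longleftrightarrow> arr T V W t \<and> cone_in T N V W t"

lemma denom_arr: "denom V W t \<Longrightarrow> arr T V W t" by (simp add: denom_def)

lemma sigI: "Tri T V W Z t g h \<Longrightarrow> Z \<in> N \<Longrightarrow> denom V W t"
  using Tri_arr by (auto simp: denom_def cone_in_def)

lemma sigE:
  assumes "denom V W t" obtains Z g h where "Tri T V W Z t g h" "Z \<in> N"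
  using assms by (auto simp: denom_def cone_in_def)

text \<open>Two cones of one map are isomorphic, by the octahedral axiom for its composite with the
  identity, so the choice of cone does not matter.\<close>

lemma denom_cone:
  assumes "denom V W t" "Tri T V W Z t g h" shows "Z \<in> N"
proof -
  obtain Z' g' h' where Z': "Tri T V W Z' t g' h'" "Z' \<in> N" using sigE[OF assms(1)] .
  note o = Tri_obj[OF assms(2)] note ar = Tri_arr[OF assms(2)]
  obtain E where E: "zero_object T E" using exists_zero .
  have "tri Z' Z E"
    by (rule octahedral[OF Z'(1) TR1_Ident[OF o(2) E]]) (use assms(2) ar in simp)
  then have "isomorphic T Z' Z" using tri_zero_iso E by blast
  then show ?thesis using thick_subcategoryD(2)[OF thick_N] Z'(2) by blast
qed

lemma denom_id: assumes "X \<in> Obj T" shows "denom X X (Ident T X)"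
proof -
  obtain E where E: "zero_object T E" using exists_zero .
  show ?thesis using sigI[OF TR1_Ident[OF assms E]] thick_subcategoryD(3)[OF thick_N E] by blast
qed

text \<open>The three cones form a triangle by the octahedral axiom. With the cone of
  \<open>s\<close> in \<open>N\<close>, the other two lie in \<open>N\<close> together or not at
  all.\<close>

lemma denom_three:
  assumes t: "arr T V W t" and s: "denom W X s"
  shows "denom V X (Comp T V W X s t) \<longleftrightarrow> denom V W t"
proof -
  obtain B v v' where B: "Tri T W X B s v v'" "B \<in> N" using sigE[OF s] .
  obtain A u u' where A: "Tri T V W A t u u'" using TR1_cone_arr[OF t] .
  obtain D w w' where D: "Tri T V X D (Comp T V W X s t) w w'"
    using TR1_cone_arr[OF arr_comp[OF t denom_arr[OF s]]] .
  have o: "tri A D B" by (rule octahedral[OF A B(1) D])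
  have "D \<in> N \<longleftrightarrow> A \<in> N" using thick_subcategory_tri[OF thick_N o] B(2) by blast
  then show ?thesis using sigI A D denom_cone by blast
qed

lemma denom_comp: "denom V W t \<Longrightarrow> denom W X s \<Longrightarrow> denom V X (Comp T V W X s t)"
  using denom_three denom_arr by blast

lemma denom_cancel: "arr T V W t \<Longrightarrow> denom W X s \<Longrightarrow> denom V X (Comp T V W X s t) \<Longrightarrow> denom V W t"
  using denom_three by blast

lemma N_dsp: "Z \<in> N \<Longrightarrow> dsp Z \<in> N"
  using thick_subcategoryD(1)[OF thick_N] thick_subcategoryD(4)[OF thick_N, of "dsp Z"] by auto

text \<open>\<open>P\<close> is the fibre of the map from \<open>W\<close> to the cone
  \<open>Z\<close> of \<open>t\<close>. Its map to \<open>W\<close> also has cone \<open>Z\<close>,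
  and its composite to \<open>Y\<close> dies in \<open>Z\<close>, so it lifts along
  \<open>t\<close>.\<close>

lemma ore:
  assumes f: "arr T W Y f" and t: "denom V Y t"
  obtains P t' f' where "denom P W t'" "arr T P V f'" "Comp T P W Y f t' = Comp T P V Y t f'"
proof -
  obtain Z q h where Z: "Tri T V Y Z t q h" "Z \<in> N" using sigE[OF t] .
  note ar = Tri_arr[OF Z(1)]
  obtain P t' d where P: "Tri T P W Z t' (Comp T W Y Z q f) d"
    using TR1_fibre[OF arr_comp[OF f ar(2)]] .
  note par = Tri_arr[OF P]
  have "Comp T P Y Z q (Comp T P W Y f t') = zr T P Z"
    using Tri_comp_zero[OF P] comp_assoc[OF par(1) f ar(2)] by simp
  from Tri_lift[OF Z(1) arr_comp[OF par(1) f] this] obtain f' where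
    f': "arr T P V f'" "Comp T P V Y t f' = Comp T P W Y f t'" .
  show ?thesis by (rule that[OF sigI[OF P Z(2)] f'(1) f'(2)[symmetric]])
qed

text \<open>The difference of \<open>a\<close> and \<open>b\<close> factors through
  \<open>dsp Z\<close> by a map \<open>c\<close>; the fibre of \<open>c\<close> annihilates it and
  has its cone \<open>dsp Z\<close> in \<open>N\<close>.\<close>

lemma equalize:
  assumes a: "arr T W X a" "arr T W X b" and s: "denom X Y s" and e: "Comp T W X Y s a = Comp T W X Y s b"
  obtains P t where "denom P W t" "Comp T P W X a t = Comp T P W X b t"
proof -
  obtain Z g h where Z: "Tri T X Y Z s g h" "Z \<in> N" using sigE[OF s] .
  obtain w where w: "Tri T (dsp Z) X Y w s g" using Tri_rotate_back[OF Z(1)] .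
  note war = Tri_arr[OF w]
  let ?d = "a \<ominus>\<^bsub>Hom T W X\<^esub> b"
  have d: "arr T W X ?d" using a by simp
  have "Comp T W X Y s ?d = zr T W Y"
    using e a war by (simp add: comp_minus_right minus_zero_iff)
  from Tri_lift[OF w d this] obtain c where c: "arr T W (dsp Z) c" "Comp T W (dsp Z) X w c = ?d" .
  obtain P t d where P: "Tri T P W (dsp Z) t c d" using TR1_fibre[OF c(1)] .
  note par = Tri_arr[OF P]
  have "Comp T P W X ?d t = Comp T P (dsp Z) X w (Comp T P W (dsp Z) c t)"
    using c war par comp_assoc[OF par(1) c(1) war(1)] by simp
  then have "Comp T P W X ?d t = zr T P X" using Tri_comp_zero[OF P] war par by (simp add: arrD)
  then have "Comp T P W X a t = Comp T P W X b t"
    using a par by (simp add: comp_minus_left minus_zero_iff)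
  then show ?thesis using that sigI[OF P N_dsp[OF Z(2)]] by blast
qed

section \<open>Roofs and their equivalence\<close>

definition roof :: "'o \<Rightarrow> 'o \<Rightarrow> 'o \<Rightarrow> 'm \<Rightarrow> 'm \<Rightarrow> bool" where
  "roof X Y W s f \<longleftrightarrow> denom W X s \<and> arr T W Y f"

abbreviation cls :: "'o \<Rightarrow> 'o \<Rightarrow> 'o \<Rightarrow> 'm \<Rightarrow> 'm \<Rightarrow> ('o \<times> 'm \<times> 'm) set" where
  "cls X Y W s f \<equiv> roof_class T N X Y (W, s, f)"

lemma roofD: assumes "roof X Y W s f"
  shows "denom W X s" "arr T W X s" "arr T W Y f" "X \<in> Obj T" "Y \<in> Obj T" "W \<in> Obj T"
  using assms unfolding roof_def denom_def arr_def by blast+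

lemma roofs_iff: "X \<in> Obj T \<Longrightarrow> Y \<in> Obj T \<Longrightarrow> (W, s, f) \<in> roofs T N X Y \<longleftrightarrow> roof X Y W s f"
  by (auto simp: roofs_def roof_def denom_def arr_def)

text \<open>The definition constrains the composite from \<open>V\<close> to \<open>X\<close>;
  two-out-of-three turns this into the condition that both legs are denominators.\<close>

lemma rel_iff:
  assumes "X \<in> Obj T" "Y \<in> Obj T"
  shows "((W, s, f), (W', s', f')) \<in> roof_rel T N X Y \<longleftrightarrow> roof X Y W s f \<and> roof X Y W' s' f' \<and>
    (\<exists>V a b. denom V W a \<and> denom V W' b \<and> Comp T V W X s a = Comp T V W' X s' b \<and>
      Comp T V W Y f a = Comp T V W' Y f' b)" (is "?l \<longleftrightarrow> ?r")
proof
  assume ?l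
  then have roof: "roof X Y W s f" "roof X Y W' s' f'" using roofs_iff[OF assms] by (auto simp: roof_rel_def)
  from \<open>?l\<close> obtain V a b where V: "V \<in> Obj T" "a \<in> Mor T V W" "b \<in> Mor T V W'"
    "Comp T V W X s a = Comp T V W' X s' b" "cone_in T N V X (Comp T V W X s a)"
    "Comp T V W Y f a = Comp T V W' Y f' b" by (auto simp: roof_rel_def)
  have ab: "arr T V W a" "arr T V W' b" using V roofD(6)[OF roof(1)] roofD(6)[OF roof(2)] by (auto intro: arrI)
  have "denom V X (Comp T V W X s a)" using V(5) ab roofD(2)[OF roof(1)] by (simp add: denom_def)
  then have "denom V W a" "denom V W' b" using denom_cancel ab roofD(1)[OF roof(1)] roofD(1)[OF roof(2)] V(4) by metis+
  then show ?r using roof V by blast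
next
  assume r: ?r
  then obtain V a b where V: "denom V W a" "denom V W' b" "Comp T V W X s a = Comp T V W' X s' b"
      "Comp T V W Y f a = Comp T V W' Y f' b" by blast
  have "cone_in T N V X (Comp T V W X s a)" using denom_comp[OF V(1)] r roofD(1) by (auto simp: denom_def)
  then show ?l unfolding roof_rel_def
    using V arrD[OF denom_arr[OF V(1)]] arrD[OF denom_arr[OF V(2)]] r roofs_iff[OF assms] by blast
qed

lemma rel_equiv:
  assumes o: "X \<in> Obj T" "Y \<in> Obj T" shows "equiv (roofs T N X Y) (roof_rel T N X Y)"
proof (rule equivI)
  show "roof_rel T N X Y \<subseteq> roofs T N X Y \<times> roofs T N X Y" by (auto simp: roof_rel_def)
  show "refl_on (roofs T N X Y) (roof_rel T N X Y)"
  proof (rule refl_onI)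
    fix r assume r: "r \<in> roofs T N X Y"
    obtain W s f where [simp]: "r = (W, s, f)" by (cases r)
    have roof: "roof X Y W s f" using r roofs_iff[OF o] by simp
    then show "(r, r) \<in> roof_rel T N X Y" using denom_id[OF roofD(6)[OF roof]] by (auto simp: rel_iff[OF o])
  qed
  show "sym (roof_rel T N X Y)"
  proof (rule symI)
    fix r r' assume r: "(r, r') \<in> roof_rel T N X Y"
    obtain W s f W' s' f' where [simp]: "r = (W, s, f)" "r' = (W', s', f')" by (cases r, cases r')
    show "(r', r) \<in> roof_rel T N X Y" using r rel_iff[OF o] by simp metis
  qed
  show "trans (roof_rel T N X Y)"
  proof (rule transI)
    fix r1 r2 r3 assume r: "(r1, r2) \<in> roof_rel T N X Y" "(r2, r3) \<in> roof_rel T N X Y"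
    obtain W1 s1 f1 W2 s2 f2 W3 s3 f3 where [simp]: "r1 = (W1, s1, f1)" "r2 = (W2, s2, f2)" "r3 = (W3, s3, f3)"
      by (cases r1, cases r2, cases r3)
    from r(1) obtain V a b where 1: "roof X Y W1 s1 f1" "roof X Y W2 s2 f2" "denom V W1 a" "denom V W2 b"
      "Comp T V W1 X s1 a = Comp T V W2 X s2 b" "Comp T V W1 Y f1 a = Comp T V W2 Y f2 b"
      by (auto simp: rel_iff[OF o])
    from r(2) obtain V' c d where 2: "roof X Y W3 s3 f3" "denom V' W2 c" "denom V' W3 d"
      "Comp T V' W2 X s2 c = Comp T V' W3 X s3 d" "Comp T V' W2 Y f2 c = Comp T V' W3 Y f3 d"
      by (auto simp: rel_iff[OF o])
    \<comment> \<open>The two comparisons meet over \<open>W2\<close>. An Ore square joins them, and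
      two-out-of-three makes its second leg a denominator as well.\<close>
    obtain Q x y where Q: "denom Q V x" "arr T Q V' y" "Comp T Q V W2 b x = Comp T Q V' W2 c y"
      using ore[OF denom_arr[OF 1(4)] 2(2)] .
    have y: "denom Q V' y" using denom_cancel[OF Q(2) 2(2)] denom_comp[OF Q(1) 1(4)] Q(3) by simp
    note A = roofD(2)[OF 1(1)] roofD(2)[OF 1(2)] roofD(2)[OF 2(1)] roofD(3)[OF 1(1)] roofD(3)[OF 1(2)] roofD(3)[OF 2(1)]
      denom_arr[OF 1(3)] denom_arr[OF 1(4)] denom_arr[OF 2(2)] denom_arr[OF 2(3)] denom_arr[OF Q(1)] Q(2)
    have "Comp T Q W1 X s1 (Comp T Q V W1 a x) = Comp T Q W3 X s3 (Comp T Q V' W3 d y)"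
      using comp_reassoc[OF 1(5) A(11) A(7) A(1)] comp_reassoc[OF 2(4) A(12) A(9) A(2)] A Q(3)
      by (simp add: comp_assoc)
    moreover have "Comp T Q W1 Y f1 (Comp T Q V W1 a x) = Comp T Q W3 Y f3 (Comp T Q V' W3 d y)"
      using comp_reassoc[OF 1(6) A(11) A(7) A(4)] comp_reassoc[OF 2(5) A(12) A(9) A(5)] A Q(3)
      by (simp add: comp_assoc)
    ultimately show "(r1, r3) \<in> roof_rel T N X Y"
      using 1 2 denom_comp[OF Q(1) 1(3)] denom_comp[OF y 2(3)] by (auto simp: rel_iff[OF o])
  qed
qed

lemma cls_eq_iff:
  assumes r: "roof X Y W s f" and r': "roof X Y W' s' f'"
  shows "cls X Y W s f = cls X Y W' s' f' \<longleftrightarrow>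
    (\<exists>V a b. denom V W a \<and> denom V W' b \<and> Comp T V W X s a = Comp T V W' X s' b \<and>
      Comp T V W Y f a = Comp T V W' Y f' b)"
proof -
  note o = roofD(4,5)[OF r]
  have "cls X Y W s f = cls X Y W' s' f' \<longleftrightarrow> ((W, s, f), (W', s', f')) \<in> roof_rel T N X Y"
    using eq_equiv_class_iff[OF rel_equiv[OF o], of "(W, s, f)" "(W', s', f')"] roofs_iff[OF o] r r' by simp
  then show ?thesis using rel_iff[OF o] r r' by simp
qed

lemma mem_cls_iff:
  assumes r': "roof X Y W' s' f'"
  shows "(W, s, f) \<in> cls X Y W' s' f' \<longleftrightarrow> roof X Y W s f \<and> cls X Y W s f = cls X Y W' s' f'"
proof -
  note o = roofD(4,5)[OF r']
  have "(W, s, f) \<in> cls X Y W' s' f' \<longleftrightarrow> ((W', s', f'), (W, s, f)) \<in> roof_rel T N X Y" by simp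
  also have "\<dots> \<longleftrightarrow> roof X Y W s f \<and> cls X Y W' s' f' = cls X Y W s f"
    using eq_equiv_class_iff[OF rel_equiv[OF o], of "(W', s', f')" "(W, s, f)"] roofs_iff[OF o] r'
      rel_iff[OF o] by auto
  finally show ?thesis by auto
qed

lemma roof_refine: "roof X Y W s f \<Longrightarrow> denom V W t \<Longrightarrow> roof X Y V (Comp T V W X s t) (Comp T V W Y f t)"
  using denom_comp denom_arr by (auto simp: roof_def)

lemma cls_refine:
  assumes r: "roof X Y W s f" and t: "denom V W t"
  shows "cls X Y V (Comp T V W X s t) (Comp T V W Y f t) = cls X Y W s f"
  unfolding cls_eq_iff[OF roof_refine[OF r t] r]
  using t denom_id[OF arrD(1)[OF denom_arr[OF t]]] denom_arr[OF t] roofD(2,3)[OF r]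
  by (intro exI[of _ V] exI[of _ "Ident T V"] exI[of _ t]) auto

text \<open>The legs \<open>a\<close> and \<open>b\<close> of a comparison may differ, but they
  agree after the common denominator \<open>s\<close>, so \<open>equalize\<close> merges them into
  one.\<close>

lemma cls_eq_common:
  assumes r: "roof X Y W s f" and r': "roof X Y W s f'"
  shows "cls X Y W s f = cls X Y W s f' \<longleftrightarrow> (\<exists>V t. denom V W t \<and> Comp T V W Y f t = Comp T V W Y f' t)"
    (is "?l \<longleftrightarrow> ?r")
proof
  assume ?l
  then obtain V a b where V: "denom V W a" "denom V W b" "Comp T V W X s a = Comp T V W X s b"
      "Comp T V W Y f a = Comp T V W Y f' b" unfolding cls_eq_iff[OF r r'] by blast
  note ar = denom_arr[OF V(1)] denom_arr[OF V(2)]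
  obtain P t where P: "denom P V t" "Comp T P V W a t = Comp T P V W b t"
    using equalize[OF ar roofD(1)[OF r] V(3)] .
  have "Comp T P W Y f (Comp T P V W a t) = Comp T P W Y f' (Comp T P V W a t)"
    using comp_reassoc[OF V(4) denom_arr[OF P(1)] ar(1) roofD(3)[OF r]]
      comp_assoc[OF denom_arr[OF P(1)] ar(2) roofD(3)[OF r']] P(2) by simp
  then show ?r using denom_comp[OF P(1) V(1)] by blast
next
  assume ?r
  then obtain V t where "denom V W t" "Comp T V W Y f t = Comp T V W Y f' t" by blast
  then show ?l unfolding cls_eq_iff[OF r r'] by blast
qed

lemma common_refinement:
  assumes s: "denom W X s" and s': "denom W' X s'"
  obtains V a b where "denom V W a" "denom V W' b" "Comp T V W X s a = Comp T V W' X s' b"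
proof -
  obtain V a b where V: "denom V W a" "arr T V W' b" "Comp T V W X s a = Comp T V W' X s' b"
    using ore[OF denom_arr[OF s] s'] .
  have "denom V W' b" using denom_cancel[OF V(2) s'] denom_comp[OF V(1) s] V(3) by simp
  then show ?thesis using that V by blast
qed

section \<open>Operations on classes of roofs\<close>

lemma Mor_U: "Mor U X Y = roofs T N X Y // roof_rel T N X Y"
  by (simp add: Mor_def quotient_Hom_def)

lemma cls_arr: "roof X Y W s f \<Longrightarrow> arr U X Y (cls X Y W s f)"
  using roofD(4,5) roofs_iff by (auto simp: arr_def Mor_U intro!: quotientI)

lemma arr_U_cases:
  assumes "arr U X Y \<alpha>" obtains W s f where "roof X Y W s f" "\<alpha> = cls X Y W s f"
proof -
  have o: "X \<in> Obj T" "Y \<in> Obj T" and "\<alpha> \<in> roofs T N X Y // roof_rel T N X Y"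
    using assms by (auto simp: arr_def Mor_U)
  then obtain r where "r \<in> roofs T N X Y" "\<alpha> = roof_class T N X Y r" by (auto elim: quotientE)
  then show ?thesis using that roofs_iff[OF o] by (cases r) auto
qed

lemma arr_U_cases2:
  assumes a: "arr U X Y \<alpha>" and b: "arr U X Y' \<beta>"
  obtains W s f g where "roof X Y W s f" "\<alpha> = cls X Y W s f" "roof X Y' W s g" "\<beta> = cls X Y' W s g"
proof -
  obtain V t f where V: "roof X Y V t f" "\<alpha> = cls X Y V t f" using arr_U_cases[OF a] .
  obtain V' t' g where V': "roof X Y' V' t' g" "\<beta> = cls X Y' V' t' g" using arr_U_cases[OF b] .
  obtain W x y where W: "denom W V x" "denom W V' y" "Comp T W V X t x = Comp T W V' X t' y"
    using common_refinement[OF roofD(1)[OF V(1)] roofD(1)[OF V'(1)]] .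
  show ?thesis
    by (rule that[of W "Comp T W V X t x" "Comp T W V Y f x" "Comp T W V' Y' g y"])
      (use roof_refine[OF V(1) W(1)] roof_refine[OF V'(1) W(2)] cls_refine[OF V(1) W(1)]
        cls_refine[OF V'(1) W(2)] V V' W in simp_all)
qed

lemma arr_U_cases3:
  assumes a: "arr U X Y \<alpha>" and b: "arr U X Y \<beta>" and c: "arr U X Y \<gamma>"
  obtains W s f g h where "roof X Y W s f" "\<alpha> = cls X Y W s f" "roof X Y W s g" "\<beta> = cls X Y W s g"
    "roof X Y W s h" "\<gamma> = cls X Y W s h"
proof -
  obtain V t f g where V: "roof X Y V t f" "\<alpha> = cls X Y V t f" "roof X Y V t g" "\<beta> = cls X Y V t g"
    using arr_U_cases2[OF a b] .
  obtain V' t' h where V': "roof X Y V' t' h" "\<gamma> = cls X Y V' t' h" using arr_U_cases[OF c] .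
  obtain W x y where W: "denom W V x" "denom W V' y" "Comp T W V X t x = Comp T W V' X t' y"
    using common_refinement[OF roofD(1)[OF V(1)] roofD(1)[OF V'(1)]] .
  show ?thesis
    by (rule that[of W "Comp T W V X t x" "Comp T W V Y f x" "Comp T W V Y g x" "Comp T W V' Y h y"])
      (use roof_refine[OF V(1) W(1)] roof_refine[OF V(3) W(1)] roof_refine[OF V'(1) W(2)] cls_refine[OF V(1) W(1)]
        cls_refine[OF V(3) W(1)] cls_refine[OF V'(1) W(2)] V V' W in simp_all)
qed

lemma cls_add:
  assumes r: "roof X Y W s f" and r': "roof X Y W s f'"
  shows "cls X Y W s f \<oplus>\<^bsub>Hom U X Y\<^esub> cls X Y W s f' = cls X Y W s (f \<oplus>\<^bsub>Hom T W Y\<^esub> f')"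
proof -
  let ?A = "{roof_class T N X Y (V, t, g \<oplus>\<^bsub>Hom T V Y\<^esub> g') | V t g g'.
                    (V, t, g) \<in> cls X Y W s f \<and> (V, t, g') \<in> cls X Y W s f'}"
  have "\<Union>?A = cls X Y W s (f \<oplus>\<^bsub>Hom T W Y\<^esub> f')"
  proof (rule Union_eq_single)
    show "cls X Y W s (f \<oplus>\<^bsub>Hom T W Y\<^esub> f') \<in> ?A" using mem_cls_iff r r' by blast
    fix \<gamma> assume "\<gamma> \<in> ?A"
    then obtain V t g g' where g: "\<gamma> = cls X Y V t (g \<oplus>\<^bsub>Hom T V Y\<^esub> g')"
      and m: "(V, t, g) \<in> cls X Y W s f" "(V, t, g') \<in> cls X Y W s f'" by blast
    have q: "roof X Y V t g" "cls X Y V t g = cls X Y W s f" using m(1) unfolding mem_cls_iff[OF r] by auto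
    have q': "roof X Y V t g'" "cls X Y V t g' = cls X Y W s f'" using m(2) unfolding mem_cls_iff[OF r'] by auto
    obtain P a b where P: "denom P V a" "denom P W b" "Comp T P V X t a = Comp T P W X s b"
      using common_refinement[OF roofD(1)[OF q(1)] roofD(1)[OF r]] .
    have eq: "\<exists>Q x. denom Q P x \<and> Comp T Q P Y (Comp T P V Y g a) x = Comp T Q P Y (Comp T P W Y f b) x"
      if q: "roof X Y V t g" "cls X Y V t g = cls X Y W s f" and r: "roof X Y W s f" for g f
      using cls_eq_common[OF roof_refine[OF q(1) P(1)], of "Comp T P W Y f b"] roof_refine[OF r P(2)]
        cls_refine[OF q(1) P(1)] cls_refine[OF r P(2)] P(3) q(2) by simp
    obtain Q1 x1 where Q1: "denom Q1 P x1" "Comp T Q1 P Y (Comp T P V Y g a) x1 = Comp T Q1 P Y (Comp T P W Y f b) x1"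
      using eq[OF q r] by blast
    obtain Q2 x2 where Q2: "denom Q2 P x2" "Comp T Q2 P Y (Comp T P V Y g' a) x2 = Comp T Q2 P Y (Comp T P W Y f' b) x2"
      using eq[OF q' r'] by blast
    \<comment> \<open>The two summands are compared over different refinements \<open>Q1\<close> and
      \<open>Q2\<close>; their sum can only be compared over a common one.\<close>
    obtain Q y1 y2 where Q: "denom Q Q1 y1" "denom Q Q2 y2" "Comp T Q Q1 P x1 y1 = Comp T Q Q2 P x2 y2"
      using common_refinement[OF Q1(1) Q2(1)] .
    note ar = denom_arr[OF P(1)] denom_arr[OF P(2)] denom_arr[OF Q1(1)] denom_arr[OF Q2(1)] denom_arr[OF Q(1)] denom_arr[OF Q(2)]
      roofD(2,3)[OF r] roofD(3)[OF r'] roofD(2,3)[OF q(1)] roofD(3)[OF q'(1)]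
    define x where "x = Comp T Q Q1 P x1 y1"
    have x: "denom Q P x" unfolding x_def by (rule denom_comp[OF Q(1) Q1(1)])
    note xa = denom_arr[OF x]
    have e1: "Comp T Q P Y (Comp T P V Y g a) x = Comp T Q P Y (Comp T P W Y f b) x"
      unfolding x_def using comp_reassoc[OF Q1(2) ar(5,3)] ar by (simp add: comp_assoc)
    have e2: "Comp T Q P Y (Comp T P V Y g' a) x = Comp T Q P Y (Comp T P W Y f' b) x"
      unfolding x_def Q(3) using comp_reassoc[OF Q2(2) ar(6,4)] ar by (simp add: comp_assoc)
    have e1': "Comp T Q V Y g (Comp T Q P V a x) = Comp T Q W Y f (Comp T Q P W b x)"
      using e1 ar xa by (simp add: comp_assoc)
    have e2': "Comp T Q V Y g' (Comp T Q P V a x) = Comp T Q W Y f' (Comp T Q P W b x)"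
      using e2 ar xa by (simp add: comp_assoc)
    have e3: "Comp T Q V X t (Comp T Q P V a x) = Comp T Q W X s (Comp T Q P W b x)"
      using comp_reassoc[OF P(3) xa] ar xa by (simp add: comp_assoc)
    have sa: "denom Q V (Comp T Q P V a x)" "denom Q W (Comp T Q P W b x)" using denom_comp x P by blast+
    have gg: "roof X Y V t (g \<oplus>\<^bsub>Hom T V Y\<^esub> g')" "roof X Y W s (f \<oplus>\<^bsub>Hom T W Y\<^esub> f')"
      using q q' r r' by (simp_all add: roof_def)
    show "\<gamma> = cls X Y W s (f \<oplus>\<^bsub>Hom T W Y\<^esub> f')"
      unfolding g cls_eq_iff[OF gg]
      by (intro exI[of _ Q] exI[of _ "Comp T Q P V a x"] exI[of _ "Comp T Q P W b x"] conjI sa e3)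
        (use sa[THEN denom_arr] ar e1' e2' in \<open>simp add: comp_add_left\<close>)
  qed
  then show ?thesis by (simp add: quotient_Hom_def)
qed

lemma cls_smult:
  assumes c: "c \<in> carrier k" and r: "roof X Y W s f"
  shows "c \<odot>\<^bsub>Hom U X Y\<^esub> cls X Y W s f = cls X Y W s (c \<odot>\<^bsub>Hom T W Y\<^esub> f)"
proof -
  let ?A = "{roof_class T N X Y (V, t, c \<odot>\<^bsub>Hom T V Y\<^esub> g) | V t g. (V, t, g) \<in> cls X Y W s f}"
  have rs: "roof X Y V t (c \<odot>\<^bsub>Hom T V Y\<^esub> g)" if "roof X Y V t g" for V t g
    using that c by (simp add: roof_def)
  have sm: "Comp T P V Y (c \<odot>\<^bsub>Hom T V Y\<^esub> g) a = c \<odot>\<^bsub>Hom T P Y\<^esub> Comp T P V Y g a"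
    if "arr T P V a" "arr T V Y g" for P V a g
    using that c by (intro Comp_smult_left) (auto simp: arr_def)
  have "\<Union>?A = cls X Y W s (c \<odot>\<^bsub>Hom T W Y\<^esub> f)"
  proof (rule Union_eq_single)
    show "cls X Y W s (c \<odot>\<^bsub>Hom T W Y\<^esub> f) \<in> ?A" using mem_cls_iff r by blast
    fix \<gamma> assume "\<gamma> \<in> ?A"
    then obtain V t g where g: "\<gamma> = cls X Y V t (c \<odot>\<^bsub>Hom T V Y\<^esub> g)"
      and m: "(V, t, g) \<in> cls X Y W s f" by blast
    have q: "roof X Y V t g" "cls X Y V t g = cls X Y W s f" using m unfolding mem_cls_iff[OF r] by auto
    obtain P a b where P: "denom P V a" "denom P W b" "Comp T P V X t a = Comp T P W X s b"
      "Comp T P V Y g a = Comp T P W Y f b" using q(2) unfolding cls_eq_iff[OF q(1) r] by blast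
    show "\<gamma> = cls X Y W s (c \<odot>\<^bsub>Hom T W Y\<^esub> f)"
      unfolding g cls_eq_iff[OF rs[OF q(1)] rs[OF r]]
      using P sm[OF denom_arr[OF P(1)] roofD(3)[OF q(1)]] sm[OF denom_arr[OF P(2)] roofD(3)[OF r]] by metis
  qed
  then show ?thesis by (simp add: quotient_Hom_def)
qed

text \<open>By the Ore condition every composable pair of classes has representatives of this shape
  (\<open>factor_reps\<close>), so this rule computes all composites.\<close>

lemma cls_comp:
  assumes r: "roof Y Z V t g" and P: "denom P X \<sigma>" and p: "arr T P V p"
  shows "Comp U X Y Z (cls Y Z V t g) (cls X Y P \<sigma> (Comp T P V Y t p)) = cls X Z P \<sigma> (Comp T P V Z g p)"
proof -
  note tar = roofD(2,3)[OF r]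
  have rp: "roof X Y P \<sigma> (Comp T P V Y t p)" using P p tar by (simp add: roof_def)
  have res: "roof X Z P \<sigma> (Comp T P V Z g p)" using P p tar by (simp add: roof_def)
  let ?A = "{roof_class T N X Z (P', Comp T P' W X s t', Comp T P' V' Z g' f') | W s f V' t1 g' P' t' f'.
        (W, s, f) \<in> cls X Y P \<sigma> (Comp T P V Y t p) \<and> (V', t1, g') \<in> cls Y Z V t g \<and>
        P' \<in> Obj T \<and> t' \<in> Mor T P' W \<and> cone_in T N P' W t' \<and> f' \<in> Mor T P' V' \<and>
        Comp T P' W Y f t' = Comp T P' V' Y t1 f'}"
  have "\<Union>?A = cls X Z P \<sigma> (Comp T P V Z g p)"
  proof (rule Union_eq_single)
    have "(P, \<sigma>, Comp T P V Y t p) \<in> cls X Y P \<sigma> (Comp T P V Y t p)" using mem_cls_iff[OF rp] rp by blast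
    moreover have "(V, t, g) \<in> cls Y Z V t g" using mem_cls_iff[OF r] r by blast
    moreover have "P \<in> Obj T" "Ident T P \<in> Mor T P P" "cone_in T N P P (Ident T P)" "p \<in> Mor T P V"
      using arrD[OF p] denom_id[of P] Ident_closed by (auto simp: denom_def)
    moreover have "Comp T P P Y (Comp T P V Y t p) (Ident T P) = Comp T P V Y t p" using p tar by simp
    moreover have "cls X Z P \<sigma> (Comp T P V Z g p) = cls X Z P (Comp T P P X \<sigma> (Ident T P)) (Comp T P V Z g p)"
      using denom_arr[OF P] by simp
    ultimately show "cls X Z P \<sigma> (Comp T P V Z g p) \<in> ?A" by blast
  next
    fix \<gamma> assume "\<gamma> \<in> ?A"
    then obtain W s f V' t1 g' P' u f' where g: "\<gamma> = cls X Z P' (Comp T P' W X s u) (Comp T P' V' Z g' f')"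
      and m: "(W, s, f) \<in> cls X Y P \<sigma> (Comp T P V Y t p)" "(V', t1, g') \<in> cls Y Z V t g"
      and h: "P' \<in> Obj T" "u \<in> Mor T P' W" "cone_in T N P' W u" "f' \<in> Mor T P' V'"
        "Comp T P' W Y f u = Comp T P' V' Y t1 f'" by blast
    have w: "roof X Y W s f" "cls X Y W s f = cls X Y P \<sigma> (Comp T P V Y t p)"
      using m(1) unfolding mem_cls_iff[OF rp] by auto
    have v: "roof Y Z V' t1 g'" "cls Y Z V' t1 g' = cls Y Z V t g"
      using m(2) unfolding mem_cls_iff[OF r] by auto
    have u: "denom P' W u" using h(1-3) roofD(6)[OF w(1)] by (simp add: denom_def arr_def)
    have f': "arr T P' V' f'" using h roofD(6)[OF v(1)] by (simp add: arr_def)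
    \<comment> \<open>\<open>A\<close> compares the two representatives of the second factor,
      \<open>B\<close> those of the first. \<open>Q\<close> and \<open>Q2\<close> bring both
      comparisons over one object; there the two maps to \<open>V\<close> agree only after
      \<open>t\<close>, and \<open>Q3\<close> equalizes them.\<close>
    obtain A a b where A: "denom A V' a" "denom A V b" "Comp T A V' Y t1 a = Comp T A V Y t b"
      "Comp T A V' Z g' a = Comp T A V Z g b" using v(2) unfolding cls_eq_iff[OF v(1) r] by blast
    obtain B c d where B: "denom B W c" "denom B P d" "Comp T B W X s c = Comp T B P X \<sigma> d"
      "Comp T B W Y f c = Comp T B P Y (Comp T P V Y t p) d" using w(2) unfolding cls_eq_iff[OF w(1) rp] by blast
    obtain Q x y where Q: "denom Q P' x" "denom Q B y" "Comp T Q P' W u x = Comp T Q B W c y"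
      using common_refinement[OF u B(1)] .
    have fx: "arr T Q V' (Comp T Q P' V' f' x)" using f' denom_arr[OF Q(1)] by simp
    obtain Q2 z q where Q2: "denom Q2 Q z" "arr T Q2 A q"
      "Comp T Q2 Q V' (Comp T Q P' V' f' x) z = Comp T Q2 A V' a q"
      using ore[OF fx A(1)] .
    note ar = denom_arr[OF A(1)] denom_arr[OF A(2)] denom_arr[OF B(1)] denom_arr[OF B(2)] denom_arr[OF Q(1)]
      denom_arr[OF Q(2)] denom_arr[OF Q2(1)] denom_arr[OF u] denom_arr[OF P] roofD(2,3)[OF w(1)] roofD(2,3)[OF v(1)]
      tar p f' Q2(2)
    define Y' where "Y' = Comp T Q2 Q P (Comp T Q B P d y) z"
    define X' where "X' = Comp T Q2 Q P' x z"
    have Y': "denom Q2 P Y'" unfolding Y'_def by (intro denom_comp Q2(1) Q(2) B(2))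
    have X': "denom Q2 P' X'" unfolding X'_def by (intro denom_comp Q2(1) Q(1))
    note XY = denom_arr[OF Y'] denom_arr[OF X']
    have ux: "Comp T Q2 P' W u X' = Comp T Q2 B W c (Comp T Q2 Q B y z)"
      unfolding X'_def using comp_reassoc[OF Q(3) ar(7)] ar by (simp add: comp_assoc)
    have yd: "Comp T Q2 B P d (Comp T Q2 Q B y z) = Y'" unfolding Y'_def using ar by (simp add: comp_assoc)
    have yz: "arr T Q2 B (Comp T Q2 Q B y z)" using ar by simp
    have fq: "Comp T Q2 P' V' f' X' = Comp T Q2 A V' a q"
      unfolding X'_def using Q2(3) ar by (simp add: comp_assoc)
    have sX: "Comp T Q2 W X s (Comp T Q2 P' W u X') = Comp T Q2 P X \<sigma> Y'"
      unfolding ux using comp_reassoc[OF B(3) yz ar(3) ar(10)] comp_assoc[OF yz ar(4,9)] yd by simp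
    have "Comp T Q2 V Y t (Comp T Q2 P V p Y') = Comp T Q2 W Y f (Comp T Q2 P' W u X')"
      unfolding ux using comp_reassoc[OF B(4) yz ar(3,11)] ar yz yd[symmetric] by (simp add: comp_assoc)
    also have "\<dots> = Comp T Q2 V' Y t1 (Comp T Q2 P' V' f' X')"
      using comp_reassoc[OF h(5) XY(2) ar(8,11)] ar XY by (simp add: comp_assoc)
    also have "\<dots> = Comp T Q2 V Y t (Comp T Q2 A V b q)"
      unfolding fq using comp_reassoc[OF A(3) Q2(2) ar(1,12)] ar by (simp add: comp_assoc)
    finally have "Comp T Q2 V Y t (Comp T Q2 P V p Y') = Comp T Q2 V Y t (Comp T Q2 A V b q)" .
    from equalize[OF _ _ roofD(1)[OF r] this] obtain Q3 e where Q3: "denom Q3 Q2 e"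
      "Comp T Q3 Q2 V (Comp T Q2 P V p Y') e = Comp T Q3 Q2 V (Comp T Q2 A V b q) e"
      using ar XY by auto
    note ea = denom_arr[OF Q3(1)]
    have rg: "roof X Z P' (Comp T P' W X s u) (Comp T P' V' Z g' f')"
      using u w ar roofD(1)[OF w(1)] denom_comp by (simp add: roof_def)
    have e1: "Comp T Q3 P' X (Comp T P' W X s u) (Comp T Q3 Q2 P' X' e)
      = Comp T Q3 P X \<sigma> (Comp T Q3 Q2 P Y' e)"
    proof -
      have "Comp T Q3 P' X (Comp T P' W X s u) (Comp T Q3 Q2 P' X' e)
        = Comp T Q3 Q2 X (Comp T Q2 W X s (Comp T Q2 P' W u X')) e"
        using ar XY ea by (simp add: comp_assoc)
      then show ?thesis unfolding sX using ar XY ea by (simp add: comp_assoc)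
    qed
    have e2: "Comp T Q3 P' Z (Comp T P' V' Z g' f') (Comp T Q3 Q2 P' X' e)
      = Comp T Q3 P Z (Comp T P V Z g p) (Comp T Q3 Q2 P Y' e)"
    proof -
      have "Comp T Q3 P' Z (Comp T P' V' Z g' f') (Comp T Q3 Q2 P' X' e)
        = Comp T Q3 Q2 Z (Comp T Q2 V' Z g' (Comp T Q2 P' V' f' X')) e"
        using ar XY ea by (simp add: comp_assoc)
      also have "\<dots> = Comp T Q3 V Z g (Comp T Q3 Q2 V (Comp T Q2 A V b q) e)"
        unfolding fq using comp_reassoc[OF A(4) Q2(2) ar(1,13)] ar ea by (simp add: comp_assoc)
      also have "\<dots> = Comp T Q3 P Z (Comp T P V Z g p) (Comp T Q3 Q2 P Y' e)"
        unfolding Q3(2)[symmetric] using ar XY ea by (simp add: comp_assoc)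
      finally show ?thesis .
    qed
    show "\<gamma> = cls X Z P \<sigma> (Comp T P V Z g p)"
      unfolding g cls_eq_iff[OF rg res]
      using e1 e2 denom_comp[OF Q3(1) X'] denom_comp[OF Q3(1) Y'] by blast
  qed
  then show ?thesis by (simp add: quotient_Comp_def)
qed

lemma factor_reps:
  assumes a: "arr U X Y \<alpha>" and r: "roof Y Z V t g"
  obtains P \<sigma> p where "denom P X \<sigma>" "arr T P V p" "\<alpha> = cls X Y P \<sigma> (Comp T P V Y t p)"
proof -
  obtain W s f where W: "roof X Y W s f" "\<alpha> = cls X Y W s f" using arr_U_cases[OF a] .
  obtain P x p where P: "denom P W x" "arr T P V p" "Comp T P W Y f x = Comp T P V Y t p"
    using ore[OF roofD(3)[OF W(1)] roofD(1)[OF r]] .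
  show ?thesis
    by (rule that[OF denom_comp[OF P(1) roofD(1)[OF W(1)]] P(2)]) (use cls_refine[OF W(1) P(1)] P(3) W(2) in simp)
qed

text \<open>For additivity in the inner argument both summands must factor through the same
  \<open>V\<close> over one common denominator.\<close>

lemma factor_reps2:
  assumes a: "arr U X Y \<alpha>" "arr U X Y \<alpha>'" and r: "roof Y Z V t g"
  obtains P \<sigma> p p' where "denom P X \<sigma>" "arr T P V p" "\<alpha> = cls X Y P \<sigma> (Comp T P V Y t p)"
    "arr T P V p'" "\<alpha>' = cls X Y P \<sigma> (Comp T P V Y t p')"
proof -
  obtain P \<sigma> p where P: "denom P X \<sigma>" "arr T P V p" "\<alpha> = cls X Y P \<sigma> (Comp T P V Y t p)"
    using factor_reps[OF a(1) r] .
  obtain P' \<sigma>' p' where P': "denom P' X \<sigma>'" "arr T P' V p'" "\<alpha>' = cls X Y P' \<sigma>' (Comp T P' V Y t p')"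
    using factor_reps[OF a(2) r] .
  obtain Q x y where Q: "denom Q P x" "denom Q P' y" "Comp T Q P X \<sigma> x = Comp T Q P' X \<sigma>' y"
    using common_refinement[OF P(1) P'(1)] .
  have rr: "roof X Y P \<sigma> (Comp T P V Y t p)" "roof X Y P' \<sigma>' (Comp T P' V Y t p')"
    using P P' roofD(2)[OF r] by (auto simp: roof_def)
  show ?thesis
  proof (rule that)
    show "denom Q X (Comp T Q P X \<sigma> x)" by (rule denom_comp[OF Q(1) P(1)])
    show "arr T Q V (Comp T Q P V p x)" "arr T Q V (Comp T Q P' V p' y)" using P P' Q denom_arr by auto
    show "\<alpha> = cls X Y Q (Comp T Q P X \<sigma> x) (Comp T Q V Y t (Comp T Q P V p x))"
      using cls_refine[OF rr(1) Q(1)] P comp_assoc[OF denom_arr[OF Q(1)] P(2) roofD(2)[OF r]] by simp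
    show "\<alpha>' = cls X Y Q (Comp T Q P X \<sigma> x) (Comp T Q V Y t (Comp T Q P' V p' y))"
      using cls_refine[OF rr(2) Q(2)] P' comp_assoc[OF denom_arr[OF Q(2)] P'(2) roofD(2)[OF r]] Q(3) by simp
  qed
qed

lemma cls_comp_arr:
  assumes a: "arr U X Y \<alpha>" and b: "arr U Y Z \<beta>"
  obtains V t g P \<sigma> p where "roof Y Z V t g" "\<beta> = cls Y Z V t g" "denom P X \<sigma>" "arr T P V p"
    "\<alpha> = cls X Y P \<sigma> (Comp T P V Y t p)" "Comp U X Y Z \<beta> \<alpha> = cls X Z P \<sigma> (Comp T P V Z g p)"
    "roof X Z P \<sigma> (Comp T P V Z g p)"
proof -
  obtain V t g where V: "roof Y Z V t g" "\<beta> = cls Y Z V t g" using arr_U_cases[OF b] .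
  obtain P \<sigma> p where P: "denom P X \<sigma>" "arr T P V p" "\<alpha> = cls X Y P \<sigma> (Comp T P V Y t p)"
    using factor_reps[OF a V(1)] .
  show ?thesis
    by (rule that[OF V P]) (use cls_comp[OF V(1) P(1,2)] V P roofD(3)[OF V(1)] in \<open>auto simp: roof_def\<close>)
qed

lemma U_comp_closed:
  assumes "arr U X Y \<alpha>" "arr U Y Z \<beta>" shows "arr U X Z (Comp U X Y Z \<beta> \<alpha>)"
  by (rule cls_comp_arr[OF assms]) (simp only: cls_arr)

text \<open>Representatives are chosen from the last morphism backwards, each factoring through the
  denominator of the next. Both bracketings then evaluate to the same roof.\<close>

lemma U_assoc:
  assumes a: "arr U W X \<alpha>" and b: "arr U X Y \<beta>" and c: "arr U Y Z \<gamma>"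
  shows "Comp U W X Z (Comp U X Y Z \<gamma> \<beta>) \<alpha> = Comp U W Y Z \<gamma> (Comp U W X Y \<beta> \<alpha>)"
proof -
  obtain A u h V t q where A: "roof Y Z A u h" "\<gamma> = cls Y Z A u h" "denom V X t" "arr T V A q"
    "\<beta> = cls X Y V t (Comp T V A Y u q)" "Comp U X Y Z \<gamma> \<beta> = cls X Z V t (Comp T V A Z h q)"
    "roof X Z V t (Comp T V A Z h q)"
    using cls_comp_arr[OF b c] .
  note uh = roofD(2,3)[OF A(1)]
  have rb: "roof X Y V t (Comp T V A Y u q)" using A uh by (simp add: roof_def)
  obtain P \<sigma> p where P: "denom P W \<sigma>" "arr T P V p" "\<alpha> = cls W X P \<sigma> (Comp T P V X t p)"
    using factor_reps[OF a rb] .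
  have 1: "Comp U W X Z (Comp U X Y Z \<gamma> \<beta>) \<alpha> = cls W Z P \<sigma> (Comp T P V Z (Comp T V A Z h q) p)"
    unfolding A(6) P(3) by (rule cls_comp[OF A(7) P(1,2)])
  have 2: "Comp U W X Y \<beta> \<alpha> = cls W Y P \<sigma> (Comp T P A Y u (Comp T P V A q p))"
    unfolding A(5) P(3) cls_comp[OF rb P(1,2)] using comp_assoc[OF P(2) A(4) uh(1)] by simp
  have 3: "Comp U W Y Z \<gamma> (Comp U W X Y \<beta> \<alpha>) = cls W Z P \<sigma> (Comp T P A Z h (Comp T P V A q p))"
    unfolding 2 A(2) by (rule cls_comp[OF A(1) P(1) arr_comp[OF P(2) A(4)]])
  show ?thesis unfolding 1 3 using comp_assoc[OF P(2) A(4) uh(2)] by simp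
qed

text \<open>The zero class is defined over the identity; this moves it to whatever denominator the
  other summand has.\<close>

lemma cls_zero:
  assumes s: "denom W X s" and Y: "Y \<in> Obj T"
  shows "cls X Y W s (zr T W Y) = \<zero>\<^bsub>Hom U X Y\<^esub>"
proof -
  note o = arrD(1,2)[OF denom_arr[OF s]]
  have r: "roof X Y X (Ident T X) (zr T X Y)" using denom_id o Y by (simp add: roof_def)
  have "cls X Y W s (zr T W Y) = cls X Y X (Ident T X) (zr T X Y)"
    using cls_refine[OF r s] denom_arr[OF s] Y by simp
  then show ?thesis by (simp add: quotient_Hom_def)
qed

section \<open>The linear structure of the quotient\<close>

lemma U_abelian: assumes o: "X \<in> Obj T" "Y \<in> Obj T" shows "abelian_group (Hom U X Y)"
proof -
  have ar: "arr U X Y x" if "x \<in> carrier (Hom U X Y)" for x using that o by (simp add: arr_def Mor_def)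
  have ab: "abelian_group (Hom T W Y)" if "roof X Y W s f" for W s f
    using Hom_abelian roofD[OF that] by blast
  have roofa: "roof X Y W s (f \<oplus>\<^bsub>Hom T W Y\<^esub> g)" if "roof X Y W s f" "roof X Y W s g" for W s f g
    using that by (simp add: roof_def)
  have c: "f \<in> carrier (Hom T W Y)" if "roof X Y W s f" for W s f
    using roofD(3)[OF that] by (simp add: arr_def Mor_def)
  have roofz: "roof X Y X (Ident T X) (zr T X Y)" using o denom_id by (simp add: roof_def)
  show ?thesis
  proof (rule abelian_groupI)
    show "\<zero>\<^bsub>Hom U X Y\<^esub> \<in> carrier (Hom U X Y)"
      using cls_arr[OF roofz] cls_zero[OF denom_id[OF o(1)] o(2)] by (simp add: arr_def Mor_def)
    fix x y assume x: "x \<in> carrier (Hom U X Y)" and y: "y \<in> carrier (Hom U X Y)"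
    obtain W s f g where W: "roof X Y W s f" "x = cls X Y W s f" "roof X Y W s g" "y = cls X Y W s g"
      using arr_U_cases2[OF ar[OF x] ar[OF y]] .
    interpret A: abelian_group "Hom T W Y" by (rule ab[OF W(1)])
    show "x \<oplus>\<^bsub>Hom U X Y\<^esub> y \<in> carrier (Hom U X Y)"
      unfolding W(2,4) cls_add[OF W(1,3)] using cls_arr[OF roofa[OF W(1,3)]] by (simp add: arr_def Mor_def)
    show "x \<oplus>\<^bsub>Hom U X Y\<^esub> y = y \<oplus>\<^bsub>Hom U X Y\<^esub> x"
      unfolding W(2,4) cls_add[OF W(1,3)] cls_add[OF W(3,1)] using A.a_comm[OF c[OF W(1)] c[OF W(3)]] by simp
  next
    fix x y z assume "x \<in> carrier (Hom U X Y)" "y \<in> carrier (Hom U X Y)" "z \<in> carrier (Hom U X Y)"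
    note xyz = this[THEN ar]
    obtain W s f g h where W: "roof X Y W s f" "x = cls X Y W s f" "roof X Y W s g" "y = cls X Y W s g"
      "roof X Y W s h" "z = cls X Y W s h" using arr_U_cases3[OF xyz] .
    interpret A: abelian_group "Hom T W Y" by (rule ab[OF W(1)])
    show "x \<oplus>\<^bsub>Hom U X Y\<^esub> y \<oplus>\<^bsub>Hom U X Y\<^esub> z = x \<oplus>\<^bsub>Hom U X Y\<^esub> (y \<oplus>\<^bsub>Hom U X Y\<^esub> z)"
      unfolding W(2,4,6) cls_add[OF W(1,3)] cls_add[OF W(3,5)] cls_add[OF W(1) roofa[OF W(3,5)]]
        cls_add[OF roofa[OF W(1,3)] W(5)]
      using A.a_assoc[OF c[OF W(1)] c[OF W(3)] c[OF W(5)]] by simp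
  next
    fix x assume x: "x \<in> carrier (Hom U X Y)"
    obtain W s f where W: "roof X Y W s f" "x = cls X Y W s f" using arr_U_cases[OF ar[OF x]] .
    have z: "\<zero>\<^bsub>Hom U X Y\<^esub> = cls X Y W s (zr T W Y)" using cls_zero[OF roofD(1)[OF W(1)] o(2)] by simp
    have rz: "roof X Y W s (zr T W Y)" using roofD[OF W(1)] by (simp add: roof_def)
    have rn: "roof X Y W s (\<ominus>\<^bsub>Hom T W Y\<^esub> f)" using W(1) by (simp add: roof_def)
    show "\<zero>\<^bsub>Hom U X Y\<^esub> \<oplus>\<^bsub>Hom U X Y\<^esub> x = x"
      unfolding W(2) z cls_add[OF rz W(1)] using roofD(3)[OF W(1)] by simp
    show "\<exists>y\<in>carrier (Hom U X Y). y \<oplus>\<^bsub>Hom U X Y\<^esub> x = \<zero>\<^bsub>Hom U X Y\<^esub>"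
    proof (rule bexI[of _ "cls X Y W s (\<ominus>\<^bsub>Hom T W Y\<^esub> f)"])
      show "cls X Y W s (\<ominus>\<^bsub>Hom T W Y\<^esub> f) \<oplus>\<^bsub>Hom U X Y\<^esub> x = \<zero>\<^bsub>Hom U X Y\<^esub>"
        unfolding W(2) z cls_add[OF rn W(1)] using neg_add(1)[OF roofD(3)[OF W(1)]] by simp
      show "cls X Y W s (\<ominus>\<^bsub>Hom T W Y\<^esub> f) \<in> carrier (Hom U X Y)"
        using cls_arr[OF rn] by (simp add: arr_def Mor_def)
    qed
  qed
qed

lemma U_module: assumes o: "X \<in> Obj T" "Y \<in> Obj T" shows "Module.module k (Hom U X Y)"
proof -
  interpret k: field k by (rule field_k)
  have ar: "arr U X Y x" if "x \<in> carrier (Hom U X Y)" for x using that o by (simp add: arr_def Mor_def)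
  have md: "Module.module k (Hom T W Y)" if "roof X Y W s f" for W s f
    using Hom_module roofD[OF that] by blast
  have c: "f \<in> carrier (Hom T W Y)" if "roof X Y W s f" for W s f
    using roofD(3)[OF that] by (simp add: arr_def Mor_def)
  have rfa: "roof X Y W s (f \<oplus>\<^bsub>Hom T W Y\<^esub> g)" if "roof X Y W s f" "roof X Y W s g" for W s f g
    using that by (simp add: roof_def)
  have rfs: "roof X Y W s (a \<odot>\<^bsub>Hom T W Y\<^esub> f)" if "roof X Y W s f" "a \<in> carrier k" for W s f a
    using that by (simp add: roof_def)
  show ?thesis
  proof (rule moduleI)
    show "cring k" by (rule k.is_cring)
    show "abelian_group (Hom U X Y)" by (rule U_abelian[OF o])
    fix a x assume a: "a \<in> carrier k" and x: "x \<in> carrier (Hom U X Y)"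
    obtain W s f where W: "roof X Y W s f" "x = cls X Y W s f" using arr_U_cases[OF ar[OF x]] .
    interpret M: module k "Hom T W Y" by (rule md[OF W(1)])
    show "a \<odot>\<^bsub>Hom U X Y\<^esub> x \<in> carrier (Hom U X Y)"
      unfolding W(2) cls_smult[OF a W(1)] using cls_arr[OF rfs[OF W(1) a]] by (simp add: arr_def Mor_def)
    fix b assume b: "b \<in> carrier k"
    show "(a \<oplus>\<^bsub>k\<^esub> b) \<odot>\<^bsub>Hom U X Y\<^esub> x = a \<odot>\<^bsub>Hom U X Y\<^esub> x \<oplus>\<^bsub>Hom U X Y\<^esub> b \<odot>\<^bsub>Hom U X Y\<^esub> x"
      unfolding W(2) cls_smult[OF a W(1)] cls_smult[OF b W(1)] cls_smult[OF k.a_closed[OF a b] W(1)]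
        cls_add[OF rfs[OF W(1) a] rfs[OF W(1) b]] using M.smult_l_distr[OF a b c[OF W(1)]] by simp
    show "(a \<otimes>\<^bsub>k\<^esub> b) \<odot>\<^bsub>Hom U X Y\<^esub> x = a \<odot>\<^bsub>Hom U X Y\<^esub> (b \<odot>\<^bsub>Hom U X Y\<^esub> x)"
      unfolding W(2) cls_smult[OF b W(1)] cls_smult[OF k.m_closed[OF a b] W(1)]
        cls_smult[OF a rfs[OF W(1) b]] using M.smult_assoc1[OF a b c[OF W(1)]] by simp
  next
    fix a x y assume a: "a \<in> carrier k" and x: "x \<in> carrier (Hom U X Y)" and y: "y \<in> carrier (Hom U X Y)"
    obtain W s f g where W: "roof X Y W s f" "x = cls X Y W s f" "roof X Y W s g" "y = cls X Y W s g"
      using arr_U_cases2[OF ar[OF x] ar[OF y]] .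
    interpret M: module k "Hom T W Y" by (rule md[OF W(1)])
    show "a \<odot>\<^bsub>Hom U X Y\<^esub> (x \<oplus>\<^bsub>Hom U X Y\<^esub> y) = a \<odot>\<^bsub>Hom U X Y\<^esub> x \<oplus>\<^bsub>Hom U X Y\<^esub> a \<odot>\<^bsub>Hom U X Y\<^esub> y"
      unfolding W(2,4) cls_smult[OF a W(1)] cls_smult[OF a W(3)] cls_add[OF W(1,3)]
        cls_smult[OF a rfa[OF W(1,3)]] cls_add[OF rfs[OF W(1) a] rfs[OF W(3) a]]
      using M.smult_r_distr[OF a c[OF W(1)] c[OF W(3)]] by simp
  next
    fix x assume x: "x \<in> carrier (Hom U X Y)"
    obtain W s f where W: "roof X Y W s f" "x = cls X Y W s f" using arr_U_cases[OF ar[OF x]] .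
    interpret M: module k "Hom T W Y" by (rule md[OF W(1)])
    show "\<one>\<^bsub>k\<^esub> \<odot>\<^bsub>Hom U X Y\<^esub> x = x"
      unfolding W(2) cls_smult[OF k.one_closed W(1)] using M.smult_one[OF c[OF W(1)]] by simp
  qed
qed

lemma U_ident_arr: "X \<in> Obj T \<Longrightarrow> arr U X X (Ident U X)"
  using cls_arr[of X X X "Ident T X" "Ident T X"] denom_id by (simp add: roof_def)

lemma U_ident_right: assumes "arr U X Y \<alpha>" shows "Comp U X X Y \<alpha> (Ident U X) = \<alpha>"
proof -
  obtain W s f where W: "roof X Y W s f" "\<alpha> = cls X Y W s f" using arr_U_cases[OF assms] .
  note sa = roofD[OF W(1)]
  have ri: "roof X X X (Ident T X) (Ident T X)" using denom_id sa by (simp add: roof_def)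
  have "Ident U X = cls X X W s (Comp T W W X s (Ident T W))"
    using cls_refine[OF ri sa(1)] sa by simp
  then show ?thesis using cls_comp[OF W(1) sa(1) arr_id[OF sa(6)]] sa W(2) by simp
qed

lemma U_ident_left: assumes "arr U X Y \<alpha>" shows "Comp U X Y Y (Ident U Y) \<alpha> = \<alpha>"
proof -
  obtain W s f where W: "roof X Y W s f" "\<alpha> = cls X Y W s f" using arr_U_cases[OF assms] .
  note sa = roofD[OF W(1)]
  have ri: "roof Y Y Y (Ident T Y) (Ident T Y)" using denom_id sa by (simp add: roof_def)
  show ?thesis using cls_comp[OF ri sa(1) sa(3)] sa W(2) by simp
qed

lemma U_linear: "linear_category k U"
proof (rule linear_category.intro)
  \<comment> \<open>These rules would unfold \<open>Hom U\<close>, \<open>Comp U\<close> and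
    \<open>Ident U\<close> into the quotient constructions, and the facts stated in terms of
    \<open>U\<close> would no longer match.\<close>
  note [simp del] = U_simps(2,3,7)
  show "Ring.field k" by (rule field_k)
  show "Module.module k (Hom U X Y)" if "X \<in> Obj U" "Y \<in> Obj U" for X Y using U_module that by simp
  show "Ident U X \<in> Mor U X X" if "X \<in> Obj U" for X using U_ident_arr that by (simp add: arr_def)
  show "Comp U X Y Z g f \<in> Mor U X Z" if "X \<in> Obj U" "Y \<in> Obj U" "Z \<in> Obj U" "f \<in> Mor U X Y" "g \<in> Mor U Y Z"
    for X Y Z f g using U_comp_closed[OF arrI arrI] that by (simp add: arr_def)
  show "Comp U X X Y f (Ident U X) = f" if "X \<in> Obj U" "Y \<in> Obj U" "f \<in> Mor U X Y" for X Y f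
    using U_ident_right[OF arrI] that by simp
  show "Comp U X Y Y (Ident U Y) f = f" if "X \<in> Obj U" "Y \<in> Obj U" "f \<in> Mor U X Y" for X Y f
    using U_ident_left[OF arrI] that by simp
  show "Comp U W X Z (Comp U X Y Z h g) f = Comp U W Y Z h (Comp U W X Y g f)"
    if "W \<in> Obj U" "X \<in> Obj U" "Y \<in> Obj U" "Z \<in> Obj U" "f \<in> Mor U W X" "g \<in> Mor U X Y" "h \<in> Mor U Y Z"
    for W X Y Z f g h using U_assoc[OF arrI arrI arrI] that by simp
next
  note [simp del] = U_simps(2,3,7)
  fix X Y Z f f' g assume a: "X \<in> Obj U" "Y \<in> Obj U" "Z \<in> Obj U" "f \<in> Mor U X Y" "f' \<in> Mor U X Y" "g \<in> Mor U Y Z"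
  obtain V t h where V: "roof Y Z V t h" "g = cls Y Z V t h" using arr_U_cases[OF arrI[OF a(2,3,6)]] .
  obtain P \<sigma> p p' where P: "denom P X \<sigma>" "arr T P V p" "f = cls X Y P \<sigma> (Comp T P V Y t p)"
    "arr T P V p'" "f' = cls X Y P \<sigma> (Comp T P V Y t p')"
    using factor_reps2[OF arrI[OF a(1,2,4)] arrI[OF a(1,2,5)] V(1)] .
  note th = roofD(2,3)[OF V(1)]
  have 1: "f \<oplus>\<^bsub>Hom U X Y\<^esub> f' = cls X Y P \<sigma> (Comp T P V Y t (p \<oplus>\<^bsub>Hom T P V\<^esub> p'))"
    unfolding P(3,5) using P th by (subst cls_add) (auto simp: roof_def comp_add_right)
  have 2: "Comp U X Y Z g f = cls X Z P \<sigma> (Comp T P V Z h p)"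
    "Comp U X Y Z g f' = cls X Z P \<sigma> (Comp T P V Z h p')"
    unfolding P(3,5) V(2) using cls_comp[OF V(1) P(1)] P by auto
  show "Comp U X Y Z g (f \<oplus>\<^bsub>Hom U X Y\<^esub> f') = Comp U X Y Z g f \<oplus>\<^bsub>Hom U X Z\<^esub> Comp U X Y Z g f'"
    unfolding 2 unfolding 1 V(2) using P th
    by (subst cls_comp[OF V(1) P(1)], simp, subst cls_add) (auto simp: roof_def comp_add_right)
next
  note [simp del] = U_simps(2,3,7)
  fix X Y Z f g g' assume a: "X \<in> Obj U" "Y \<in> Obj U" "Z \<in> Obj U" "f \<in> Mor U X Y" "g \<in> Mor U Y Z" "g' \<in> Mor U Y Z"
  obtain V t h h' where V: "roof Y Z V t h" "g = cls Y Z V t h" "roof Y Z V t h'" "g' = cls Y Z V t h'"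
    using arr_U_cases2[OF arrI[OF a(2,3,5)] arrI[OF a(2,3,6)]] .
  obtain P \<sigma> p where P: "denom P X \<sigma>" "arr T P V p" "f = cls X Y P \<sigma> (Comp T P V Y t p)"
    using factor_reps[OF arrI[OF a(1,2,4)] V(1)] .
  have rs: "roof Y Z V t (h \<oplus>\<^bsub>Hom T V Z\<^esub> h')" using V by (simp add: roof_def)
  show "Comp U X Y Z (g \<oplus>\<^bsub>Hom U Y Z\<^esub> g') f = Comp U X Y Z g f \<oplus>\<^bsub>Hom U X Z\<^esub> Comp U X Y Z g' f"
    unfolding P(3) V(2,4) cls_add[OF V(1,3)] cls_comp[OF V(1) P(1,2)] cls_comp[OF V(3) P(1,2)] cls_comp[OF rs P(1,2)]
    using P V by (subst cls_add) (auto simp: roof_def comp_add_left)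
next
  note [simp del] = U_simps(2,3,7)
  fix X Y Z c f g assume a: "X \<in> Obj U" "Y \<in> Obj U" "Z \<in> Obj U" "c \<in> carrier k" "f \<in> Mor U X Y" "g \<in> Mor U Y Z"
  obtain V t h P \<sigma> p where V: "roof Y Z V t h" "g = cls Y Z V t h" "denom P X \<sigma>" "arr T P V p"
    "f = cls X Y P \<sigma> (Comp T P V Y t p)" "Comp U X Y Z g f = cls X Z P \<sigma> (Comp T P V Z h p)"
    "roof X Z P \<sigma> (Comp T P V Z h p)" using cls_comp_arr[OF arrI[OF a(1,2,5)] arrI[OF a(2,3,6)]] .
  note th = roofD[OF V(1)]
  have rp: "roof X Y P \<sigma> (Comp T P V Y t p)" using V th by (simp add: roof_def)
  have m: "Comp T P V A u (c \<odot>\<^bsub>Hom T P V\<^esub> p) = c \<odot>\<^bsub>Hom T P A\<^esub> Comp T P V A u p" if "arr T V A u" for A u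
    using that V(4) a(4) by (intro Comp_smult_right) (auto simp: arr_def)
  have m': "Comp T P V Z (c \<odot>\<^bsub>Hom T V Z\<^esub> h) p = c \<odot>\<^bsub>Hom T P Z\<^esub> Comp T P V Z h p"
    using th(3) V(4) a(4) by (intro Comp_smult_left) (auto simp: arr_def)
  have rs: "roof Y Z V t (c \<odot>\<^bsub>Hom T V Z\<^esub> h)" using V a by (simp add: roof_def)
  show "Comp U X Y Z g (c \<odot>\<^bsub>Hom U X Y\<^esub> f) = c \<odot>\<^bsub>Hom U X Z\<^esub> Comp U X Y Z g f"
    unfolding V(6) cls_smult[OF a(4) V(7)] unfolding V(2,5) cls_smult[OF a(4) rp] m[OF th(2), symmetric]
    using cls_comp[OF V(1) V(3) arr_smult[OF a(4) V(4)]] m[OF th(3)] by simp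
  show "Comp U X Y Z (c \<odot>\<^bsub>Hom U Y Z\<^esub> g) f = c \<odot>\<^bsub>Hom U X Z\<^esub> Comp U X Y Z g f"
    unfolding V(6) cls_smult[OF a(4) V(7)] unfolding V(2,5) cls_smult[OF a(4) V(1)]
    using cls_comp[OF rs V(3,4)] m' by simp
qed

section \<open>The quotient functor\<close>

abbreviation Q where "Q \<equiv> quotient_mor T N"

lemma Q_cls: "Q X Y f = cls X Y X (Ident T X) f"
  by (simp add: quotient_mor_def)

lemma roof_Q: "arr T X Y f \<Longrightarrow> roof X Y X (Ident T X) f"
  using denom_id[OF arrD(1)] by (simp add: roof_def)

sublocale U: linear_category k U by (rule U_linear)

lemma Q_additive: "additive_functor T U (\<lambda>X. X) Q"
  unfolding additive_functor_def is_functor_def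
proof (intro conjI ballI)
  note [simp del] = U_simps(2,3,7)
  fix X assume "X \<in> Obj T"
  then show "X \<in> Obj U" "Q X X (Ident T X) = Ident U X" by (simp_all add: Q_cls U_simps(7))
next
  fix X Y f assume "X \<in> Obj T" "Y \<in> Obj T" "f \<in> Mor T X Y"
  then show "Q X Y f \<in> Mor U X Y" using cls_arr[OF roof_Q[OF arrI]] by (simp add: Q_cls arr_def)
next
  fix X Y Z f g assume o: "X \<in> Obj T" "Y \<in> Obj T" "Z \<in> Obj T" "f \<in> Mor T X Y" "g \<in> Mor T Y Z"
  then have a: "arr T X Y f" "arr T Y Z g" by (auto intro: arrI)
  show "Q X Z (Comp T X Y Z g f) = Comp U X Y Z (Q Y Z g) (Q X Y f)"
    using cls_comp[OF roof_Q[OF a(2)] denom_id[OF o(1)] a(1)] a by (simp add: Q_cls)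
next
  fix X Y f g assume o: "X \<in> Obj T" "Y \<in> Obj T" "f \<in> Mor T X Y" "g \<in> Mor T X Y"
  then have a: "arr T X Y f" "arr T X Y g" by (auto intro: arrI)
  show "Q X Y (f \<oplus>\<^bsub>Hom T X Y\<^esub> g) = Q X Y f \<oplus>\<^bsub>Hom U X Y\<^esub> Q X Y g"
    using cls_add[OF roof_Q[OF a(1)] roof_Q[OF a(2)]] by (simp add: Q_cls)
qed

sublocale Q: linear_functor_pair k T U "\<lambda>X. X" Q
  by unfold_locales (rule Q_additive)

lemma Q_smult: "c \<in> carrier k \<Longrightarrow> arr T X Y f \<Longrightarrow> Q X Y (c \<odot>\<^bsub>Hom T X Y\<^esub> f) = c \<odot>\<^bsub>Hom U X Y\<^esub> Q X Y f"
  using cls_smult[OF _ roof_Q] by (simp add: Q_cls)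

lemma Q_eq_iff:
  assumes "arr T X Y f" "arr T X Y g"
  shows "Q X Y f = Q X Y g \<longleftrightarrow> (\<exists>V t. denom V X t \<and> Comp T V X Y f t = Comp T V X Y g t)"
  unfolding Q_cls by (rule cls_eq_common[OF roof_Q[OF assms(1)] roof_Q[OF assms(2)]])

text \<open>The inverse is the roof with denominator \<open>t\<close> and numerator the
  identity.\<close>

lemma Q_denom_iso:
  assumes t: "denom V W t" shows "isomorphic U V W"
proof -
  note [simp del] = U_simps(2,3,7)
  note ta = denom_arr[OF t]
  note o = arrD(1,2)[OF ta]
  have r: "roof W V V t (Ident T V)" using t o by (simp add: roof_def)
  have 1: "Comp U W V W (Q V W t) (cls W V V t (Ident T V)) = Ident U W"
  proof -
    have "Comp U W V W (Q V W t) (cls W V V t (Ident T V)) = cls W W V t t"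
      using cls_comp[OF roof_Q[OF ta] t arr_id[OF o(1)]] ta o by (simp add: Q_cls)
    also have "\<dots> = Ident U W"
      using cls_refine[OF roof_Q[OF arr_id[OF o(2)]] t] ta by (simp add: U_simps(7))
    finally show ?thesis .
  qed
  have 2: "Comp U V W V (cls W V V t (Ident T V)) (Q V W t) = Ident U V"
    using cls_comp[OF r denom_id[OF o(1)] arr_id[OF o(1)]] ta o by (simp add: Q_cls U_simps(7))
  have "iso_mor U V W (Q V W t)"
    by (rule U.iso_morI[OF Q.F_arr[OF ta] cls_arr[OF r] 2 1])
  then show ?thesis using U.isomorphicI o by simp
qed

lemma tri_N_iso:
  assumes "tri X Y Z" shows "Z \<in> N \<Longrightarrow> isomorphic U X Y" "X \<in> N \<Longrightarrow> isomorphic U Y Z"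
proof -
  show "isomorphic U X Y" if "Z \<in> N" using assms Q_denom_iso sigI that unfolding tri_def by blast
  show "isomorphic U Y Z" if X: "X \<in> N"
  proof -
    have "Susp T X \<in> N" using thick_subcategoryD(1,4)[OF thick_N] X by blast
    then show ?thesis using tri_rotate[OF assms] Q_denom_iso sigI unfolding tri_def by blast
  qed
qed

lemma N_zero: assumes "Z \<in> N" shows "zero_object U Z"
proof -
  obtain E where E: "zero_object T E" using exists_zero .
  have "tri E Z Z" using tri_zero E assms thick_subcategoryD(1)[OF thick_N] by blast
  from tri_N_iso(1)[OF this assms] show ?thesis using U.zero_object_iso Q.F_zero_object[OF E] by blast
qed

lemma U_additive: "additive_category k U"
  unfolding additive_category_def
proof (intro conjI allI impI U_linear)
  fix Ys assume "set Ys \<subseteq> Obj U"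
  then obtain X where "direct_sum T X Ys" using additive by (auto simp: additive_category_def)
  then show "\<exists>X. direct_sum U X Ys" using Q.F_direct_sum[of X Ys] by auto
qed

text \<open>Three rotations give the suspended triangle, but with minus the suspended
  \<open>s\<close> as its first map; the automorphism minus identity of the source removes the sign
  and keeps the cone.\<close>

lemma susp_denom: assumes "denom W X s" shows "denom (Susp T W) (Susp T X) (SuspMor T W X s)"
proof -
  obtain Z g h where Z: "Tri T W X Z s g h" "Z \<in> N" using sigE[OF assms] .
  note ar = Tri_arr[OF Z(1)] note o = Tri_obj[OF Z(1)]
  let ?W = "Susp T W" and ?X = "Susp T X"
  let ?s = "SuspMor T W X s"
  obtain u v where 1: "Tri T ?W ?X (Susp T Z) (\<ominus>\<^bsub>Hom T ?W ?X\<^esub> ?s) u v"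
    using Tri_rotate[OF Tri_rotate[OF Tri_rotate[OF Z(1)]]] by blast
  note ar1 = Tri_arr[OF 1]
  have sa: "arr T ?W ?X ?s" using ar by simp
  have nn: "arr T ?W ?W (\<ominus>\<^bsub>Hom T ?W ?W\<^esub> Ident T ?W)" using o by simp
  have nid: "Comp T ?W ?W ?W (\<ominus>\<^bsub>Hom T ?W ?W\<^esub> Ident T ?W) (\<ominus>\<^bsub>Hom T ?W ?W\<^esub> Ident T ?W) = Ident T ?W"
    using o nn by (simp add: comp_neg_left neg_add(3))
  have XZ: "arr T ?X ?X (Ident T ?X)" "arr T (Susp T Z) (Susp T Z) (Ident T (Susp T Z))" using o by auto
  obtain u' v' where "Tri T ?W ?X (Susp T Z) (Comp T ?W ?W ?X (Comp T ?W ?X ?X (Ident T ?X)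
    (\<ominus>\<^bsub>Hom T ?W ?X\<^esub> ?s)) (\<ominus>\<^bsub>Hom T ?W ?W\<^esub> Ident T ?W)) u' v'"
    using Tri_iso[OF 1 nn nn nid nid XZ(1) XZ(1) _ _ XZ(2) XZ(2)] XZ by simp
  moreover have "Comp T ?W ?W ?X (Comp T ?W ?X ?X (Ident T ?X) (\<ominus>\<^bsub>Hom T ?W ?X\<^esub> ?s))
    (\<ominus>\<^bsub>Hom T ?W ?W\<^esub> Ident T ?W) = ?s"
    using sa o by (simp add: comp_neg_right neg_add(3))
  moreover have "Susp T Z \<in> N" using thick_subcategoryD(4)[OF thick_N o(3)] Z(2) by blast
  ultimately show ?thesis using sigI by simp
qed

text \<open>The image of a triangle is compared with itself by identities, for which
  \<open>quotient_Tri\<close> asks for the suspension of an identity class, a union over all its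
  representatives.\<close>

lemma susp_Ident_U:
  assumes X: "X \<in> Obj T" shows "quotient_SuspMor T N X X (Ident U X) = Ident U (Susp T X)"
proof -
  have i: "roof X X X (Ident T X) (Ident T X)" using roof_Q X by simp
  have j: "roof (Susp T X) (Susp T X) (Susp T X) (Ident T (Susp T X)) (Ident T (Susp T X))" using roof_Q X by simp
  show ?thesis unfolding quotient_SuspMor_def U_simps(7)
  proof (rule Union_eq_single)
    have "(X, Ident T X, Ident T X) \<in> cls X X X (Ident T X) (Ident T X)" using mem_cls_iff[OF i] i by blast
    then show "cls (Susp T X) (Susp T X) (Susp T X) (SuspMor T X X (Ident T X)) (SuspMor T X X (Ident T X)) \<in>
      {roof_class T N (Susp T X) (Susp T X) (Susp T W, SuspMor T W X s, SuspMor T W X f) |W s f.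
         (W, s, f) \<in> cls X X X (Ident T X) (Ident T X)}" by blast
    fix b assume "b \<in> {roof_class T N (Susp T X) (Susp T X) (Susp T W, SuspMor T W X s, SuspMor T W X f) |W s f.
         (W, s, f) \<in> cls X X X (Ident T X) (Ident T X)}"
    then obtain W s f where b: "b = cls (Susp T X) (Susp T X) (Susp T W) (SuspMor T W X s) (SuspMor T W X f)"
      and m: "(W, s, f) \<in> cls X X X (Ident T X) (Ident T X)" by blast
    have w: "roof X X W s f" "cls X X W s f = cls X X X (Ident T X) (Ident T X)"
      using m unfolding mem_cls_iff[OF i] by auto
    note sa = roofD[OF w(1)]
    \<comment> \<open>In a representative of the identity, numerator and denominator agree after a
      further denominator; suspending keeps this relation.\<close>
    have "cls X X W s f = cls X X W s s"
      using w(2) cls_refine[OF i sa(1)] sa by simp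
    moreover have "roof X X W s s" using sa by (simp add: roof_def)
    ultimately obtain V t where t: "denom V W t" "Comp T V W X f t = Comp T V W X s t"
      using cls_eq_common[OF w(1)] by blast
    note ta = denom_arr[OF t(1)]
    have r1: "roof (Susp T X) (Susp T X) (Susp T W) (SuspMor T W X s) (SuspMor T W X f)"
      "roof (Susp T X) (Susp T X) (Susp T W) (SuspMor T W X s) (SuspMor T W X s)"
      using susp_denom[OF sa(1)] sa by (auto simp: roof_def)
    have "Comp T (Susp T V) (Susp T W) (Susp T X) (SuspMor T W X f) (SuspMor T V W t)
      = Comp T (Susp T V) (Susp T W) (Susp T X) (SuspMor T W X s) (SuspMor T V W t)"
      using t(2) ta sa by (simp add: susp_comp[symmetric])
    then have "b = cls (Susp T X) (Susp T X) (Susp T W) (SuspMor T W X s) (SuspMor T W X s)"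
      unfolding b cls_eq_common[OF r1] using susp_denom[OF t(1)] by blast
    also have "\<dots> = cls (Susp T X) (Susp T X) (Susp T X) (Ident T (Susp T X)) (Ident T (Susp T X))"
      using cls_refine[OF j susp_denom[OF sa(1)]] sa by simp
    finally show "b = cls (Susp T X) (Susp T X) (Susp T X) (Ident T (Susp T X)) (Ident T (Susp T X))" .
  qed
qed

lemma Tri_U:
  assumes t: "Tri T X Y Z f g h" shows "Tri U X Y Z (Q X Y f) (Q Y Z g) (Q Z (Susp T X) h)"
proof -
  note [simp del] = U_simps(2,3,7)
  note ar = Tri_arr[OF t] note o = Tri_obj[OF t]
  note qa = Q.F_arr[OF ar(1)] Q.F_arr[OF ar(2)] Q.F_arr[OF ar(3)]
  have oU: "X \<in> Obj U" "Y \<in> Obj U" "Z \<in> Obj U" "Susp T X \<in> Obj U" using o by auto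
  have "quotient_Tri T N X Y Z (Q X Y f) (Q Y Z g) (Q Z (Susp T X) h)"
    unfolding quotient_Tri_def Let_def
  proof (intro conjI exI)
    show "Tri T X Y Z f g h" by (rule t)
    \<comment> \<open>\<open>quotient_Tri\<close> speaks of \<open>quotient_cat\<close>, the
      available facts of its extension \<open>verdier_quotient\<close>; the fields involved
      coincide.\<close>
    have eq: "iso_mor (quotient_cat T N) A B c \<longleftrightarrow> iso_mor U A B c" for A B c
      by (simp add: iso_mor_def Mor_def U_simps(2,3,7)) (simp add: quotient_cat_def)
    show "iso_mor (quotient_cat T N) X X (Ident U X)" "iso_mor (quotient_cat T N) Y Y (Ident U Y)"
      "iso_mor (quotient_cat T N) Z Z (Ident U Z)"
      unfolding eq using U.iso_mor_id oU by auto
    have e: "Obj (quotient_cat T N) = Obj U" "Mor (quotient_cat T N) = Mor U" "Comp (quotient_cat T N) = Comp U"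
      by (simp_all add: quotient_cat_def Mor_def U_simps(2,3) fun_eq_iff)
    show "X \<in> Obj (quotient_cat T N)" "Y \<in> Obj (quotient_cat T N)" "Z \<in> Obj (quotient_cat T N)"
      "Q X Y f \<in> Mor (quotient_cat T N) X Y" "Q Y Z g \<in> Mor (quotient_cat T N) Y Z"
      "Q Z (Susp T X) h \<in> Mor (quotient_cat T N) Z (Susp T X)"
      unfolding e using oU qa by (auto simp: arr_def)
    show "Comp (quotient_cat T N) X Y Y (Ident U Y) (Q X Y f) = Comp (quotient_cat T N) X X Y (Q X Y f) (Ident U X)"
      "Comp (quotient_cat T N) Y Z Z (Ident U Z) (Q Y Z g) = Comp (quotient_cat T N) Y Y Z (Q Y Z g) (Ident U Y)"
      unfolding e using qa by simp_all
    show "Comp (quotient_cat T N) Z (Susp T X) (Susp T X) (quotient_SuspMor T N X X (Ident U X)) (Q Z (Susp T X) h)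
      = Comp (quotient_cat T N) Z Z (Susp T X) (Q Z (Susp T X) h) (Ident U Z)"
      unfolding e susp_Ident_U[OF o(1)] using qa by simp
  qed
  then show ?thesis by simp
qed

text \<open>Membership in a thick subcategory depends on the vertices up to isomorphism, so the
  comparison maps can be forgotten.\<close>

lemma Tri_U_cases:
  assumes "Tri U X Y Z \<alpha> \<beta> \<gamma>"
  obtains X' Y' Z' where "tri X' Y' Z'" "isomorphic U X X'" "isomorphic U Y Y'" "isomorphic U Z Z'"
proof -
  have "quotient_Tri T N X Y Z \<alpha> \<beta> \<gamma>" using assms by simp
  then obtain X' Y' Z' f g h a b c where t: "Tri T X' Y' Z' f g h" and o: "X \<in> Obj T" "Y \<in> Obj T" "Z \<in> Obj T"
    and i: "iso_mor (quotient_cat T N) X X' a" "iso_mor (quotient_cat T N) Y Y' b"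
      "iso_mor (quotient_cat T N) Z Z' c"
    unfolding quotient_Tri_def Let_def by (auto simp: quotient_cat_def)
  have eq: "iso_mor (quotient_cat T N) A B c \<longleftrightarrow> iso_mor U A B c" for A B c
    by (simp add: iso_mor_def Mor_def) (simp add: quotient_cat_def)
  have "isomorphic U X X'" "isomorphic U Y Y'" "isomorphic U Z Z'"
    using i o Tri_obj[OF t] unfolding eq by (auto intro: U.isomorphicI)
  then show ?thesis using that triI[OF t] by blast
qed

text \<open>\<open>Q\<close> is the identity on objects and carries triangles, isomorphisms, zero
  objects and sums of \<open>T\<close> to those of \<open>U\<close>; so the same set of objects
  works.\<close>

lemma thick_U_to_T:
  assumes P: "thick_subcategory U P" shows "thick_subcategory T P"
proof -
  note P' = P[unfolded thick_subcategory_def iso_closed_def]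
  show ?thesis
    unfolding thick_subcategory_def iso_closed_def
  proof (intro conjI allI impI ballI)
    show "P \<subseteq> Obj T" using P' by simp
    fix X Y assume "X \<in> P" "isomorphic T X Y"
    then show "Y \<in> P" using P' Q.F_isomorphic by blast
  next
    fix X assume "zero_object T X"
    then show "X \<in> P" using P' Q.F_zero_object by blast
  next
    fix X assume X: "X \<in> Obj T"
    have "\<forall>X\<in>Obj U. X \<in> P \<longleftrightarrow> Susp U X \<in> P" using P' by blast
    then show "X \<in> P \<longleftrightarrow> Susp T X \<in> P" using X unfolding U_simps(1,4) by blast
  next
    fix X Y Z f g h assume "Tri T X Y Z f g h" "X \<in> P" "Y \<in> P"
    then show "Z \<in> P" using P' Tri_U by blast
  next
    fix X Y Z assume d: "direct_sum T X [Y, Z]" and X: "X \<in> P"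
    have "direct_sum U X [Y, Z]" using Q.F_direct_sum[OF d] by (simp only: list.map)
    then show "Y \<in> P" using P' X by blast
  qed
qed

lemma shift_U [simp]: "shift U X i = sh X i"
  unfolding shift_def U_simps(1,4) ..

end

section \<open>Full subcategories and transport of dimensions\<close>

lemma has_dim_01_iff:
  assumes V: "Module.module k V" and W: "Module.module k W"
    and bij: "bij_betw \<phi> (carrier V) (carrier W)"
    and smult: "\<And>c v. c \<in> carrier k \<Longrightarrow> v \<in> carrier V \<Longrightarrow> \<phi> (c \<odot>\<^bsub>V\<^esub> v) = c \<odot>\<^bsub>W\<^esub> \<phi> v"
    and n: "n = 0 \<or> n = 1"
  shows "has_dim k V n \<longleftrightarrow> has_dim k W n"
proof
  show "has_dim k V n \<Longrightarrow> has_dim k W n" by (rule has_dim_01_transport[OF V W bij smult n])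
  interpret V: module k V by fact
  interpret W: module k W by fact
  let ?\<psi> = "inv_into (carrier V) \<phi>"
  have "?\<psi> (c \<odot>\<^bsub>W\<^esub> w) = c \<odot>\<^bsub>V\<^esub> ?\<psi> w" if c: "c \<in> carrier k" and w: "w \<in> carrier W" for c w
  proof -
    obtain v where v: "v \<in> carrier V" "w = \<phi> v" using bij w by (auto simp: bij_betw_def)
    have "?\<psi> (c \<odot>\<^bsub>W\<^esub> w) = ?\<psi> (\<phi> (c \<odot>\<^bsub>V\<^esub> v))" using smult[OF c v(1)] v(2) by simp
    then show ?thesis
      using bij_betw_inv_into_left[OF bij V.smult_closed[OF c v(1)]] bij_betw_inv_into_left[OF bij v(1)] v(2)
      by simp
  qed
  then show "has_dim k W n \<Longrightarrow> has_dim k V n"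
    by (rule has_dim_01_transport[OF W V bij_betw_inv_into[OF bij] _ n])
qed

lemma full_subcategory_simps [simp]:
  "Obj (full_subcategory C P) = P" "Hom (full_subcategory C P) = Hom C"
  "Ident (full_subcategory C P) = Ident C" "Comp (full_subcategory C P) = Comp C"
  "Mor (full_subcategory C P) = Mor C"
  by (simp_all add: full_subcategory_def Mor_def fun_eq_iff)

context linear_category
begin

text \<open>Conjugation by the two isomorphisms is a bijection compatible with scalars.\<close>

lemma has_dim_01_iso:
  assumes X: "isomorphic C X X'" and Y: "isomorphic C Y Y'" and n: "n = 0 \<or> n = 1"
  shows "has_dim k (Hom C X Y) n \<longleftrightarrow> has_dim k (Hom C X' Y') n"
proof -
  obtain p q where p: "arr C X X' p" "arr C X' X q" "Comp C X X' X q p = Ident C X"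
    "Comp C X' X X' p q = Ident C X'" using isomorphicE[OF X] by metis
  obtain r s where r: "arr C Y Y' r" "arr C Y' Y s" "Comp C Y Y' Y s r = Ident C Y"
    "Comp C Y' Y Y' r s = Ident C Y'" using isomorphicE[OF Y] by metis
  note o = arrD(1,2)[OF p(1)] arrD(1,2)[OF r(1)]
  let ?f = "\<lambda>f. Comp C X' Y Y' r (Comp C X' X Y f q)"
  let ?g = "\<lambda>f. Comp C X Y' Y s (Comp C X X' Y' f p)"
  have ca: "f \<in> carrier (Hom C A B) \<longleftrightarrow> arr C A B f" if "A \<in> Obj C" "B \<in> Obj C" for A B f
    using that by (simp add: arr_def Mor_def)
  show ?thesis
  proof (rule has_dim_01_iff[OF Hom_module Hom_module _ _ n])
    show "bij_betw ?f (carrier (Hom C X Y)) (carrier (Hom C X' Y'))"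
    proof (rule bij_betw_byWitness[where f' = ?g])
      show "\<forall>f\<in>carrier (Hom C X Y). ?g (?f f) = f"
      proof
        fix f assume "f \<in> carrier (Hom C X Y)"
        then have f: "arr C X Y f" using ca o by simp
        show "?g (?f f) = f" using f p r comp_reassoc[OF r(3) _ r(1,2)] by (simp add: comp_assoc)
      qed
      show "\<forall>f\<in>carrier (Hom C X' Y'). ?f (?g f) = f"
      proof
        fix f assume "f \<in> carrier (Hom C X' Y')"
        then have f: "arr C X' Y' f" using ca o by simp
        show "?f (?g f) = f" using f p r comp_reassoc[OF r(4) _ r(2,1)] by (simp add: comp_assoc)
      qed
    qed (use ca o p r in auto)
    fix c f assume c: "c \<in> carrier k" and "f \<in> carrier (Hom C X Y)"
    then have f: "arr C X Y f" using ca o by simp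
    have "Comp C X' X Y (c \<odot>\<^bsub>Hom C X Y\<^esub> f) q = c \<odot>\<^bsub>Hom C X' Y\<^esub> Comp C X' X Y f q"
      using c f p o by (intro Comp_smult_left) (auto simp: arr_def)
    moreover have "Comp C X' Y Y' r (c \<odot>\<^bsub>Hom C X' Y\<^esub> Comp C X' X Y f q) = c \<odot>\<^bsub>Hom C X' Y'\<^esub> ?f f"
      using c arr_comp[OF p(2) f] r o by (intro Comp_smult_right) (auto simp: arr_def)
    ultimately show "?f (c \<odot>\<^bsub>Hom C X Y\<^esub> f) = c \<odot>\<^bsub>Hom C X' Y'\<^esub> ?f f" by simp
  qed (use o in auto)
qed

lemma full_subcategory_linear:
  assumes P: "P \<subseteq> Obj C" shows "linear_category k (full_subcategory C P)"
proof -
  note s = subsetD[OF P]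
  show ?thesis
    by (rule linear_category.intro)
      (simp_all add: field_k s Hom_module Ident_closed Comp_closed Comp_Ident_right Comp_Ident_left
        Comp_assoc Comp_add_right Comp_add_left Comp_smult_right Comp_smult_left)
qed

lemma direct_sum_vanish:
  assumes d: "direct_sum C X Ys" and A: "A \<in> Obj C"
  shows "(\<And>Y. Y \<in> set Ys \<Longrightarrow> Hom_vanishes C A Y) \<Longrightarrow> Hom_vanishes C A X"
    "(\<And>Y. Y \<in> set Ys \<Longrightarrow> Hom_vanishes C Y A) \<Longrightarrow> Hom_vanishes C X A"
proof -
  have o: "X \<in> Obj C" "set Ys \<subseteq> Obj C" using d by (auto simp: direct_sum_def)
  obtain \<iota> \<pi> where a: "\<And>i. i<length Ys \<Longrightarrow> \<iota> i \<in> Mor C (Ys ! i) X \<and> \<pi> i \<in> Mor C X (Ys ! i)"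
    and c: "(\<Oplus>\<^bsub>Hom C X X\<^esub>i\<in>{..<length Ys}. Comp C X (Ys ! i) X (\<iota> i) (\<pi> i)) = Ident C X"
    using d unfolding direct_sum_def by (elim conjE exE) (rule that, blast+)
  have ar: "arr C (Ys ! i) X (\<iota> i)" "arr C X (Ys ! i) (\<pi> i)" if "i < length Ys" for i
    using a[OF that] o that by (auto simp: arr_def)
  interpret abelian_group "Hom C X X" using o Hom_abelian by simp
  let ?t = "\<lambda>i. Comp C X (Ys ! i) X (\<iota> i) (\<pi> i)"
  have t: "arr C X X (?t i)" if "i < length Ys" for i using ar that by simp
  \<comment> \<open>An induction principle for the identity of \<open>X\<close>: it arises from zero
    by adding the projectors onto the summands one at a time.\<close>
  have sum: "P (Ident C X)" if z: "P (zr C X X)" and s: "\<And>i f. i < length Ys \<Longrightarrow> arr C X X f \<Longrightarrow> P f \<Longrightarrow>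
    P (?t i \<oplus>\<^bsub>Hom C X X\<^esub> f)" for P
  proof -
    have "I \<subseteq> {..<length Ys} \<Longrightarrow> P (finsum (Hom C X X) ?t I) \<and> arr C X X (finsum (Hom C X X) ?t I)"
      if "finite I" for I using that
    proof (induction I)
      case empty
      then show ?case using z o by simp
    next
      case (insert i I)
      have 1: "?t \<in> I \<rightarrow> carrier (Hom C X X)" "?t i \<in> carrier (Hom C X X)"
        using insert.prems t by (auto simp: arr_def Mor_def)
      have "finsum (Hom C X X) ?t (insert i I) = ?t i \<oplus>\<^bsub>Hom C X X\<^esub> finsum (Hom C X X) ?t I"
        by (rule finsum_insert[OF insert.hyps 1])
      then show ?case using insert s t by simp
    qed
    then show ?thesis using c by (metis finite_lessThan subset_refl)
  qed
  show "Hom_vanishes C A X" if v: "\<And>Y. Y \<in> set Ys \<Longrightarrow> Hom_vanishes C A Y"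
  proof -
    have "f = zr C A X" if f: "arr C A X f" for f
    proof -
      have "Comp C A X X (Ident C X) f = zr C A X"
      proof (rule sum)
        fix i g assume i: "i < length Ys" and g: "arr C X X g" "Comp C A X X g f = zr C A X"
        have "Comp C A X (Ys ! i) (\<pi> i) f = zr C A (Ys ! i)"
          by (rule vanishesD[OF v]) (use i ar f in auto)
        then have "Comp C A X X (?t i) f = zr C A X" using ar[OF i] f A by (simp add: comp_assoc)
        then show "Comp C A X X (?t i \<oplus>\<^bsub>Hom C X X\<^esub> g) f = zr C A X"
          using comp_add_left[OF f t[OF i] g(1)] g(2) A o by simp
      qed (use f o in simp)
      then show ?thesis using f by simp
    qed
    then show ?thesis using vanishes_iff A o by simp
  qed
  show "Hom_vanishes C X A" if v: "\<And>Y. Y \<in> set Ys \<Longrightarrow> Hom_vanishes C Y A"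
  proof -
    have "f = zr C X A" if f: "arr C X A f" for f
    proof -
      have "Comp C X X A f (Ident C X) = zr C X A"
      proof (rule sum)
        fix i g assume i: "i < length Ys" and g: "arr C X X g" "Comp C X X A f g = zr C X A"
        have "Comp C (Ys ! i) X A f (\<iota> i) = zr C (Ys ! i) A"
          by (rule vanishesD[OF v]) (use i ar f in auto)
        then have "Comp C X X A f (?t i) = zr C X A"
          using comp_assoc[OF ar(2)[OF i] ar(1)[OF i] f] ar[OF i] A by simp
        then show "Comp C X X A f (?t i \<oplus>\<^bsub>Hom C X X\<^esub> g) = zr C X A"
          using comp_add_right[OF t[OF i] g(1) f] g(2) A o by simp
      qed (use f o in simp)
      then show ?thesis using f by simp
    qed
    then show ?thesis using vanishes_iff A o by simp
  qed
qed

end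

section \<open>Simple-minded reduction\<close>

context simple_minded_reduction
begin

sublocale V: verdier k T "thick T R"
  by unfold_locales (rule thick_subcategory_thick[OF R_obj])

abbreviation Zr where "Zr \<equiv> reduction_subcategory T R"
text \<open>The halves of \<open>reduction_subcategory\<close> are kept apart because full
  faithfulness needs \<open>lp\<close> for the source and \<open>rp\<close> for the target. The
  negative shifts that occur in \<open>pre_SMC\<close> stay in \<open>rp\<close> but need not stay
  in \<open>Zr\<close>.\<close>

abbreviation lp where "lp \<equiv> left_perp T (shifts T R {..0})"
abbreviation rp where "rp \<equiv> right_perp T (shifts T R {0..})"

lemma Zr_eq: "Zr = rp \<inter> lp" by (simp add: reduction_subcategory_def)

lemma Zr_obj: "X \<in> Zr \<Longrightarrow> X \<in> Obj T" by (auto simp: Zr_eq right_perp_def)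

lemma Zr_iso: assumes "X \<in> Zr" "isomorphic T X Y" shows "Y \<in> Zr"
  using extension_closedD(2)[OF extension_closed_right_perp[OF shifts_obj[OF R_obj]] _ assms(2)]
    extension_closedD(2)[OF extension_closed_left_perp[OF shifts_obj[OF R_obj]] _ assms(2)] assms(1)
  by (auto simp: Zr_eq)

text \<open>A denominator over \<open>X\<close> can be refined to one whose cone is filtered by positive shifts, since the
  nonpositive part of the cone receives no map from \<open>X\<close>.\<close>

lemma refine_denominator:
  assumes X: "X \<in> lp" and s: "V.denom W X s"
  obtains P v w D q d where "Tri T P X D v q d" "D \<in> FR {0<..}" "arr T P W w" "v = Comp T P W X s w"
proof -
  obtain D' q d where t: "Tri T W X D' s q d" "D' \<in> thick T R" using V.sigE[OF s] .
  note ar = Tri_arr[OF t(1)]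
  obtain D1 D2 i j e where D: "D1 \<in> FR {0<..}" "D2 \<in> FR {..0}" "Tri T D1 D' D2 i j e"
    using thick_split[of 0] t(2) by (auto simp: star_def tri_def)
  note ar' = Tri_arr[OF D(3)]
  have "Comp T X D' D2 j q = zr T X D2"
    by (rule vanishesD[OF FR_vanish_perp_left[OF D(2) X] arr_comp[OF ar(2) ar'(2)]])
  from Tri_lift[OF D(3) ar(2) this] obtain q1 where q1: "arr T X D1 q1" "Comp T X D1 D' i q1 = q" .
  obtain P v d' where P: "Tri T P X D1 v q1 d'" using TR1_fibre[OF q1(1)] .
  note par = Tri_arr[OF P]
  have "Comp T P X D' q v = Comp T P D1 D' i (Comp T P X D1 q1 v)"
    using comp_assoc[OF par(1) q1(1) ar'(1)] q1(2) by simp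
  then have "Comp T P X D' q v = zr T P D'"
    using Tri_comp_zero[OF P] ar'(1) Tri_obj[OF P] by simp
  from Tri_lift[OF t(1) par(1) this] obtain w where "arr T P W w" "Comp T P W X s w = v" .
  then show ?thesis using that P D(1) by blast
qed

text \<open>All shifts in \<open>D\<close> are positive, so those in its desuspension are still
  nonnegative. The first vanishing gives faithfulness, the second fullness.\<close>

lemma FR_pos_vanish: assumes "D \<in> FR {0<..}" "Y \<in> rp"
  shows "Hom_vanishes T D Y" "Hom_vanishes T (dsp D) Y"
proof -
  have "{0<..} \<subseteq> {0::int..}" by auto
  from subsetD[OF FR_mono[OF this] assms(1)] have "D \<in> FR {0..}" .
  then show "Hom_vanishes T D Y" using FR_vanish_perp_right assms(2) by blast
  have "dsp D \<in> FR {0..}" using FR_shift[OF assms(1), of "-1" "{0..}"] FR_obj[OF assms(1)] by simp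
  then show "Hom_vanishes T (dsp D) Y" using FR_vanish_perp_right assms(2) by blast
qed

text \<open>Over the refined denominator \<open>v\<close> the numerator extends from
  \<open>P\<close> to \<open>X\<close>, since the obstruction is a map from \<open>dsp D\<close> to
  \<open>Y\<close>.\<close>

lemma Q_full:
  assumes X: "X \<in> lp" and Y: "Y \<in> rp" and a: "arr V.U X Y \<alpha>"
  obtains g where "arr T X Y g" "V.Q X Y g = \<alpha>"
proof -
  obtain W s f where W: "V.roof X Y W s f" "\<alpha> = V.cls X Y W s f" using V.arr_U_cases[OF a] .
  note r = V.roofD[OF W(1)]
  obtain P v w D q d where P: "Tri T P X D v q d" "D \<in> FR {0<..}" "arr T P W w" "v = Comp T P W X s w"
    using refine_denominator[OF X r(1)] .
  note par = Tri_arr[OF P(1)]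
  have v: "V.denom P X v" using V.sigI[OF P(1)] FR_thick P(2) by blast
  have w: "V.denom P W w" using V.denom_cancel[OF P(3) r(1)] v P(4) by simp
  obtain c where c: "Tri T (dsp D) P X c v q" using Tri_rotate_back[OF P(1)] by metis
  have fw: "arr T P Y (Comp T P W Y f w)" using P(3) r by simp
  have "Comp T (dsp D) P Y (Comp T P W Y f w) c = zr T (dsp D) Y"
    by (rule vanishesD[OF FR_pos_vanish(2)[OF P(2) Y] arr_comp[OF Tri_arr(1)[OF c] fw]])
  from Tri_extend[OF c fw this] obtain g where g: "arr T X Y g" "Comp T P X Y g v = Comp T P W Y f w" .
  have "\<alpha> = V.cls X Y P v (Comp T P W Y f w)" using V.cls_refine[OF W(1) w] W(2) P(4) by simp
  also have "\<dots> = V.Q X Y g" using V.cls_refine[OF V.roof_Q[OF g(1)] v] g(2) par by (simp add: V.Q_cls)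
  finally show ?thesis using that g(1) by simp
qed

text \<open>Maps identified in the quotient agree after a denominator, hence after its refinement
  \<open>v\<close>; their difference factors through the cone \<open>D\<close> of
  \<open>v\<close>.\<close>

lemma Q_faithful:
  assumes X: "X \<in> lp" and Y: "Y \<in> rp" and a: "arr T X Y f" "arr T X Y g" and e: "V.Q X Y f = V.Q X Y g"
  shows "f = g"
proof -
  obtain W s where s: "V.denom W X s" "Comp T W X Y f s = Comp T W X Y g s"
    using e unfolding V.Q_eq_iff[OF a] by blast
  obtain P v w D q d where P: "Tri T P X D v q d" "D \<in> FR {0<..}" "arr T P W w" "v = Comp T P W X s w"
    using refine_denominator[OF X s(1)] .
  have m: "arr T X Y (f \<ominus>\<^bsub>Hom T X Y\<^esub> g)" using a by simp
  have "Comp T P X Y f v = Comp T P X Y g v"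
    unfolding P(4) using comp_reassoc[OF s(2) P(3) V.denom_arr[OF s(1)] a(1)]
      comp_assoc[OF P(3) V.denom_arr[OF s(1)] a(2)] by simp
  then have "Comp T P X Y (f \<ominus>\<^bsub>Hom T X Y\<^esub> g) v = zr T P Y"
    using Tri_arr[OF P(1)] a by (simp add: comp_minus_left minus_zero_iff)
  from Tri_extend[OF P(1) m this] obtain b where b: "arr T D Y b" "Comp T X D Y b q = f \<ominus>\<^bsub>Hom T X Y\<^esub> g" .
  have "b = zr T D Y" by (rule vanishesD[OF FR_pos_vanish(1)[OF P(2) Y] b(1)])
  then have "f \<ominus>\<^bsub>Hom T X Y\<^esub> g = zr T X Y" using b Tri_arr[OF P(1)] arrD(2)[OF b(1)] by simp
  then show ?thesis using minus_zero_iff[OF a] by simp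
qed

lemma perp_objD: "X \<in> lp \<Longrightarrow> X \<in> Obj T" "Y \<in> rp \<Longrightarrow> Y \<in> Obj T"
  by (auto simp: left_perp_def right_perp_def)

lemma Q_bij:
  assumes X: "X \<in> lp" and Y: "Y \<in> rp"
  shows "bij_betw (V.Q X Y) (Mor T X Y) (Mor V.U X Y)"
proof -
  note o = perp_objD(1)[OF X] perp_objD(2)[OF Y]
  have oU: "X \<in> Obj V.U" "Y \<in> Obj V.U" using o by simp_all
  show ?thesis unfolding bij_betw_def
  proof (intro conjI equalityI subsetI)
    show "inj_on (V.Q X Y) (Mor T X Y)"
      by (rule inj_onI) (rule Q_faithful[OF X Y arrI[OF o] arrI[OF o]])
    fix a assume "a \<in> Mor V.U X Y"
    from Q_full[OF X Y arrI[OF oU this]] obtain g where g: "arr T X Y g" "V.Q X Y g = a" .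
    show "a \<in> V.Q X Y ` Mor T X Y" unfolding g(2)[symmetric] by (rule imageI[OF arrD(3)[OF g(1)]])
  next
    fix a assume "a \<in> V.Q X Y ` Mor T X Y"
    then obtain f where f: "f \<in> Mor T X Y" "a = V.Q X Y f" by blast
    show "a \<in> Mor V.U X Y" unfolding f(2) by (rule arrD(3)[OF V.Q.F_arr[OF arrI[OF o f(1)]]])
  qed
qed

lemma Q_vanish_iff:
  assumes X: "X \<in> lp" and Y: "Y \<in> rp"
  shows "Hom_vanishes V.U X Y \<longleftrightarrow> Hom_vanishes T X Y"
proof -
  note o = perp_objD(1)[OF X] perp_objD(2)[OF Y]
  note b = Q_bij[OF X Y]
  have z: "V.Q X Y (zr T X Y) = zr V.U X Y" using V.Q.F_zero o by blast
  have z0: "zr T X Y \<in> Mor T X Y" using arrD(3)[OF arr_zero[OF o]] .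
  show ?thesis
  proof
    assume "Hom_vanishes V.U X Y"
    then have "Mor V.U X Y = {zr V.U X Y}" by (simp only: Hom_vanishes_def)
    then have e: "V.Q X Y f = V.Q X Y (zr T X Y)" if "f \<in> Mor T X Y" for f
      using bij_betw_apply[OF b that] z by simp
    have "f = zr T X Y" if "f \<in> Mor T X Y" for f
      by (rule inj_onD[OF bij_betw_imp_inj_on[OF b] e[OF that] that z0])
    then show "Hom_vanishes T X Y" unfolding Hom_vanishes_def using z0 by blast
  next
    assume "Hom_vanishes T X Y"
    then have "Mor V.U X Y = V.Q X Y ` {zr T X Y}"
      using bij_betw_imp_surj_on[OF b] by (simp add: Hom_vanishes_def)
    then show "Hom_vanishes V.U X Y" unfolding Hom_vanishes_def using z by simp
  qed
qed

lemma Q_dim_iff: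
  assumes X: "X \<in> lp" and Y: "Y \<in> rp" and n: "n = 0 \<or> n = 1"
  shows "has_dim k (Hom V.U X Y) n \<longleftrightarrow> has_dim k (Hom T X Y) n"
proof -
  note o = perp_objD(1)[OF X] perp_objD(2)[OF Y]
  show ?thesis
    by (rule has_dim_01_iff[OF Hom_module[OF o] V.U_module[OF o] Q_bij[OF X Y, unfolded Mor_def] _ n, symmetric])
      (rule V.Q_smult, auto simp: arr_def Mor_def o)
qed

lemma Zr_iso_reflect:
  assumes X: "X \<in> Zr" and Y: "Y \<in> Zr" and i: "isomorphic V.U X Y"
  shows "isomorphic T X Y"
proof -
  have X': "X \<in> lp" "X \<in> rp" and Y': "Y \<in> lp" "Y \<in> rp" using X Y by (auto simp: Zr_eq)
  note o = Zr_obj[OF X] Zr_obj[OF Y]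
  obtain a b where ab: "arr V.U X Y a" "arr V.U Y X b" "Comp V.U X Y X b a = Ident V.U X"
    "Comp V.U Y X Y a b = Ident V.U Y" using V.U.isomorphicE[OF i] by metis
  obtain f where f: "arr T X Y f" "V.Q X Y f = a" using Q_full[OF X'(1) Y'(2) ab(1)] .
  obtain g where g: "arr T Y X g" "V.Q Y X g = b" using Q_full[OF Y'(1) X'(2) ab(2)] .
  have 1: "V.Q X X (Comp T X Y X g f) = V.Q X X (Ident T X)"
    unfolding V.Q.F_comp[OF f(1) g(1)] f(2) g(2) V.Q.F_id[OF o(1)] by (rule ab(3))
  have 2: "V.Q Y Y (Comp T Y X Y f g) = V.Q Y Y (Ident T Y)"
    unfolding V.Q.F_comp[OF g(1) f(1)] f(2) g(2) V.Q.F_id[OF o(2)] by (rule ab(4))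
  have "Comp T X Y X g f = Ident T X"
    by (rule Q_faithful[OF X' arr_comp[OF f(1) g(1)] arr_id[OF o(1)] 1])
  moreover have "Comp T Y X Y f g = Ident T Y"
    by (rule Q_faithful[OF Y' arr_comp[OF g(1) f(1)] arr_id[OF o(2)] 2])
  ultimately show ?thesis using isomorphicI[OF o iso_morI[OF f(1) g(1)]] by blast
qed

text \<open>Both truncation triangles live in \<open>T\<close>, so they can be shifted there before
  passing to the quotient. They also show that \<open>X\<close> and \<open>Z\<close> lie in the same
  thick subcategories containing \<open>R\<close>.\<close>

lemma Zr_representative:
  assumes X: "X \<in> Obj T"
  obtains Z where "Z \<in> Zr" "\<And>i. isomorphic V.U (sh Z i) (sh X i)"
    "\<And>P. thick_subcategory T P \<Longrightarrow> R \<subseteq> P \<Longrightarrow> X \<in> P \<longleftrightarrow> Z \<in> P"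
proof -
  obtain P X' where P: "P \<in> FR {0..}" "X' \<in> rp" "tri P X X'"
    using truncate_right[OF X, of 0] by (auto simp: star_def)
  note o = tri_obj[OF P(3)]
  obtain Z M where Z: "Z \<in> lp" "M \<in> FR {..0}" "tri Z X' M"
    using truncate_left[OF o(3), of 0] by (auto simp: star_def)
  note o' = tri_obj[OF Z(3)]
  \<comment> \<open>The second truncation does not spoil the first: \<open>dsp M\<close> is filtered
    by negative shifts, which receive no map from nonnegative shifts of \<open>R\<close>.\<close>
  have dM: "dsp M \<in> FR {..-1}" using FR_shift[OF Z(2), of "-1" "{..-1}"] o' by simp
  have "Hom_vanishes T (sh A i) Z" if A: "A \<in> R" and i: "i \<ge> 0" for A i
  proof (rule tri_vanish_right[OF tri_rotate_back[OF Z(3)]])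
    show "Hom_vanishes T (sh A i) (dsp M)"
      by (rule FR_vanish[OF FR_gen[OF A] dM, of i "{0..}"]) (use i in auto)
    show "Hom_vanishes T (sh A i) X'" using P(2) A i by (simp add: right_perp_shifts_iff)
    show "sh A i \<in> Obj T" using R_objD[OF A] by simp
  qed
  then have ZZ: "Z \<in> Zr" using Z(1) o' by (simp add: Zr_eq right_perp_shifts_iff)
  have N: "P \<in> thick T R" "M \<in> thick T R" using P Z FR_thick by blast+
  show ?thesis
  proof (rule that[OF ZZ])
    fix i
    have "isomorphic V.U (sh X i) (sh X' i)"
      by (rule V.tri_N_iso(2)[OF tri_shift[OF P(3)] thick_subcategory_shift[OF V.thick_N N(1)]])
    moreover have "isomorphic V.U (sh Z i) (sh X' i)"
      by (rule V.tri_N_iso(1)[OF tri_shift[OF Z(3)] thick_subcategory_shift[OF V.thick_N N(2)]])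
    ultimately show "isomorphic V.U (sh Z i) (sh X i)"
      using V.U.isomorphic_trans V.U.isomorphic_sym by blast
  next
    fix L assume L: "thick_subcategory T L" "R \<subseteq> L"
    have "thick T R \<subseteq> L" by (rule thick_least[OF L])
    then have "P \<in> L" "M \<in> L" using N by blast+
    then have "X \<in> L \<longleftrightarrow> X' \<in> L" "Z \<in> L \<longleftrightarrow> X' \<in> L"
      using thick_subcategoryD(5)[OF L(1) P(3)] thick_subcategory_tri[OF L(1) P(3)]
        thick_subcategoryD(5)[OF L(1) Z(3)] thick_subcategory_tri[OF L(1) Z(3)] by blast+
    then show "X \<in> L \<longleftrightarrow> Z \<in> L" by simp
  qed
qed

text \<open>Passing to representatives in \<open>Zr\<close> reduces this to \<open>T\<close>,
  because there an isomorphism of the quotient lifts to one of \<open>T\<close>.\<close>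

lemma U_iso_thick:
  assumes L: "thick_subcategory T L" "R \<subseteq> L" and i: "isomorphic V.U X Y" and X: "X \<in> L"
  shows "Y \<in> L"
proof -
  have o: "X \<in> Obj T" "Y \<in> Obj T" using V.U.isomorphicD[OF i] by simp_all
  obtain X' where X': "X' \<in> Zr" "isomorphic V.U (sh X' 0) (sh X 0)" "X \<in> L \<longleftrightarrow> X' \<in> L"
    using Zr_representative[OF o(1)] L by metis
  obtain Y' where Y': "Y' \<in> Zr" "isomorphic V.U (sh Y' 0) (sh Y 0)" "Y \<in> L \<longleftrightarrow> Y' \<in> L"
    using Zr_representative[OF o(2)] L by metis
  have "isomorphic V.U X' Y'"
    using X'(2) Y'(2) i V.U.isomorphic_trans V.U.isomorphic_sym unfolding shift_0 by blast
  then have "isomorphic T X' Y'" by (rule Zr_iso_reflect[OF X'(1) Y'(1)])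
  then show ?thesis using thick_subcategoryD(2)[OF L(1)] X X' Y' by blast
qed

text \<open>Both objects are replaced by representatives in \<open>Zr\<close>; their isomorphism
  lifts to \<open>T\<close> and is shifted there.\<close>

lemma U_iso_shift:
  assumes i: "isomorphic V.U X Y" shows "isomorphic V.U (sh X n) (sh Y n)"
proof -
  have o: "X \<in> Obj T" "Y \<in> Obj T" using V.U.isomorphicD[OF i] by simp_all
  obtain X' where X': "X' \<in> Zr" "\<And>i. isomorphic V.U (sh X' i) (sh X i)"
    using Zr_representative[OF o(1)] by metis
  obtain Y' where Y': "Y' \<in> Zr" "\<And>i. isomorphic V.U (sh Y' i) (sh Y i)"
    using Zr_representative[OF o(2)] by metis
  have "isomorphic V.U X' Y'"
    using X'(2)[of 0] Y'(2)[of 0] i V.U.isomorphic_trans V.U.isomorphic_sym unfolding shift_0 by blast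
  then have "isomorphic T X' Y'" by (rule Zr_iso_reflect[OF X'(1) Y'(1)])
  then have "isomorphic V.U (sh X' n) (sh Y' n)" using V.Q.F_isomorphic[OF iso_shift] by blast
  from V.U.isomorphic_trans[OF this Y'(2)] show ?thesis
    by (rule V.U.isomorphic_trans[OF V.U.isomorphic_sym[OF X'(2)]])
qed

text \<open>Both perpendiculars are closed under finite direct sums, so a sum formed in
  \<open>T\<close> already lies in \<open>Zr\<close>.\<close>

lemma full_subcategory_Zr_additive: "additive_category k (full_subcategory T Zr)"
  unfolding additive_category_def
proof (intro conjI allI impI)
  show "linear_category k (full_subcategory T Zr)"
    by (rule full_subcategory_linear) (use Zr_obj in blast)
  fix Ys assume "set Ys \<subseteq> Obj (full_subcategory T Zr)"
  then have Ys: "set Ys \<subseteq> Zr" by (simp add: full_subcategory_def)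
  then have "set Ys \<subseteq> Obj T" using Zr_obj by blast
  then obtain X where X: "direct_sum T X Ys" using additive unfolding additive_category_def by blast
  have o: "X \<in> Obj T" using X by (simp add: direct_sum_def)
  have "Hom_vanishes T (sh A i) X" if A: "A \<in> R" "i \<ge> 0" for A i
    by (rule direct_sum_vanish(1)[OF X])
      (use A Ys R_objD in \<open>auto simp: Zr_eq right_perp_shifts_iff\<close>)
  moreover have "Hom_vanishes T X (sh A i)" if A: "A \<in> R" "i \<le> 0" for A i
    by (rule direct_sum_vanish(2)[OF X])
      (use A Ys R_objD in \<open>auto simp: Zr_eq left_perp_shifts_iff\<close>)
  ultimately have "X \<in> Zr" using o by (simp add: Zr_eq right_perp_shifts_iff left_perp_shifts_iff)
  then have "direct_sum (full_subcategory T Zr) X Ys"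
    using X Ys unfolding direct_sum_def full_subcategory_simps by blast
  then show "\<exists>X. direct_sum (full_subcategory T Zr) X Ys" by blast
qed

lemma equivalence:
  "additive_equivalence k (full_subcategory T Zr) V.U (\<lambda>X. X) V.Q"
proof -
  interpret F: linear_functor_pair k "full_subcategory T Zr" V.U "\<lambda>X. X" V.Q
  proof (rule linear_functor_pair.intro)
    show "linear_category k (full_subcategory T Zr)"
      using full_subcategory_Zr_additive by (simp add: additive_category_def)
    show "linear_category k V.U" by (rule V.U_linear)
    show "linear_functor_pair_axioms (full_subcategory T Zr) V.U (\<lambda>X. X) V.Q"
      using V.Q_additive Zr_obj
      by (simp add: linear_functor_pair_axioms_def additive_functor_def is_functor_def)
  qed
  show ?thesis
  proof (rule F.additive_equivalenceI[OF full_subcategory_Zr_additive V.U_additive])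
    fix X Y assume "X \<in> Obj (full_subcategory T Zr)" "Y \<in> Obj (full_subcategory T Zr)"
    then show "bij_betw (V.Q X Y) (Mor (full_subcategory T Zr) X Y) (Mor V.U X Y)"
      using Q_bij by (simp add: Zr_eq)
  next
    fix Y assume "Y \<in> Obj V.U"
    then have "Y \<in> Obj T" by simp
    then obtain Z where "Z \<in> Zr" "isomorphic V.U (sh Z 0) (sh Y 0)" using Zr_representative by metis
    then show "\<exists>X\<in>Obj (full_subcategory T Zr). isomorphic V.U X Y" by auto
  qed
qed

section \<open>The bijection of simple-minded collections\<close>

lemma rp_shift_neg: assumes "Y \<in> rp" "i \<le> 0" shows "sh Y i \<in> rp"
  by (rule right_perp_shift[OF R_obj assms(1)]) (use assms(2) in auto)

text \<open>\<open>A\<close> has a nonzero endomorphism, whereas objects of \<open>Zr\<close>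
  receive no map from \<open>A\<close>. Hence removing \<open>R\<close> from
  \<open>R \<union> (W \<inter> Zr)\<close> gives back \<open>W \<inter> Zr\<close>.\<close>

lemma R_Zr_disjoint: "A \<in> R \<Longrightarrow> A \<notin> Zr"
  using R_not_vanish[of A] by (auto simp: Zr_eq right_perp_shifts_iff dest!: bspec[of R _ A] bspec[of "{0..}" _ 0])

text \<open>A member of \<open>S\<close> outside \<open>R\<close> is isomorphic to no member of
  \<open>R\<close>, so at shift 0 the Kronecker delta of \<open>S\<close> applies; at the other
  shifts it is the vanishing in negative degrees.\<close>

lemma SMC_complement_subset:
  assumes S: "pre_SMC k T S" "R \<subseteq> S" shows "S - R \<subseteq> Zr"
proof
  interpret S: pre_simple_minded k T S by unfold_locales (rule S(1))
  fix X assume X: "X \<in> S - R"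
  have "\<not> isomorphic T A X" "\<not> isomorphic T X A" if "A \<in> R" for A
    using iso_closedD[OF R_iso_closed that] isomorphic_sym X by blast+
  then have v: "Hom_vanishes T A X" "Hom_vanishes T X A" if "A \<in> R" for A
    using S.R_vanish_noniso that S(2) X by blast+
  have "Hom_vanishes T (sh A i) X" if "A \<in> R" "i \<ge> 0" for A i
    using v(1)[OF that(1)] S.R_vanish_shift[of A X 0 i] that S(2) X by (cases "i = 0") auto
  moreover have "Hom_vanishes T X (sh A i)" if "A \<in> R" "i \<le> 0" for A i
    using v(2)[OF that(1)] S.R_vanish_shift[of X A i 0] that S(2) X by (cases "i = 0") auto
  ultimately show "X \<in> Zr"
    using S.R_objD X by (auto simp: Zr_eq right_perp_shifts_iff left_perp_shifts_iff)
qed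

lemma thick_U_Obj: "thick_subcategory V.U (Obj V.U)"
  unfolding thick_subcategory_def iso_closed_def
proof (intro conjI allI impI ballI)
  fix X Y Z f g h assume "Tri V.U X Y Z f g h"
  then show "Z \<in> Obj V.U" using V.Tri_U_cases V.U.isomorphicD(1) by metis
qed (auto simp: V.U.isomorphicD direct_sum_def zero_object_def dest: V.U.isomorphicD)

text \<open>\<open>S - R\<close> is closed under isomorphisms of \<open>T\<close>, which need not
  exhaust those of the quotient; hence the closure. Dimensions and vanishing are compared on the
  representatives in \<open>S - R\<close>, which lie in \<open>Zr\<close>.\<close>

lemma SMC_image:
  assumes S: "SMC k T S" "R \<subseteq> S" shows "SMC k V.U (iso_closure V.U (S - R))"
proof -
  let ?V = "iso_closure V.U (S - R)"
  have pre: "pre_SMC k T S" and th: "thick T S = Obj T" using S(1) by (auto simp: SMC_def)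
  note sub = SMC_complement_subset[OF pre S(2)]
  have ic: "iso_closed V.U ?V"
    unfolding iso_closed_def iso_closure_def
    using V.U.isomorphicD(2) V.U.isomorphic_trans by blast
  have main: "(\<forall>i<0. Hom_vanishes V.U X (shift V.U Y i)) \<and>
        has_dim k (Hom V.U X Y) (if isomorphic V.U X Y then 1 else 0)" if "X \<in> ?V" "Y \<in> ?V" for X Y
  proof -
    obtain X0 where X0: "X0 \<in> S - R" "isomorphic V.U X0 X" using \<open>X \<in> ?V\<close> by (auto simp: iso_closure_def)
    obtain Y0 where Y0: "Y0 \<in> S - R" "isomorphic V.U Y0 Y" using \<open>Y \<in> ?V\<close> by (auto simp: iso_closure_def)
    have z: "X0 \<in> Zr" "Y0 \<in> Zr" using sub X0 Y0 by blast+
    then have l: "X0 \<in> lp" and r: "Y0 \<in> rp" by (auto simp: Zr_eq)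
    have p: "\<forall>i<0. Hom_vanishes T X0 (sh Y0 i)" "has_dim k (Hom T X0 Y0) (if isomorphic T X0 Y0 then 1 else 0)"
      using pre X0(1) Y0(1) unfolding pre_SMC_def by blast+
    have "isomorphic V.U X Y \<longleftrightarrow> isomorphic V.U X0 Y0"
      using X0(2) Y0(2) V.U.isomorphic_trans V.U.isomorphic_sym by blast
    also have "\<dots> \<longleftrightarrow> isomorphic T X0 Y0" using Zr_iso_reflect[OF z] V.Q.F_isomorphic by blast
    finally have iso: "isomorphic V.U X Y \<longleftrightarrow> isomorphic T X0 Y0" .
    have n: "(if isomorphic V.U X Y then 1 else 0) = (0::nat) \<or> (if isomorphic V.U X Y then 1 else 0) = (1::nat)" by simp
    have "has_dim k (Hom V.U X0 Y0) (if isomorphic V.U X Y then 1 else 0)"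
      unfolding Q_dim_iff[OF l r n] unfolding iso by (rule p(2))
    then have 1: "has_dim k (Hom V.U X Y) (if isomorphic V.U X Y then 1 else 0)"
      unfolding V.U.has_dim_01_iso[OF X0(2) Y0(2) n] .
    have 2: "Hom_vanishes V.U X (shift V.U Y i)" if i: "i < 0" for i
      unfolding V.shift_U
    proof (rule V.U.vanishes_iso[OF X0(2) U_iso_shift[OF Y0(2)]])
      show "Hom_vanishes V.U X0 (sh Y0 i)"
        unfolding Q_vanish_iff[OF l rp_shift_neg[OF r less_imp_le[OF i]]] using p(1) i by blast
    qed
    show ?thesis using 1 2 by blast
  qed
  have "thick V.U ?V = Obj V.U"
  proof
    show "thick V.U ?V \<subseteq> Obj V.U"
      by (rule thick_least[OF thick_U_Obj]) (use ic in \<open>simp only: iso_closed_def\<close>)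
    show "Obj V.U \<subseteq> thick V.U ?V"
    proof (rule thick_greatest)
      \<comment> \<open>A thick \<open>P\<close> of the quotient is thick in \<open>T\<close>. It
        contains \<open>R\<close>, whose members become zero, hence all of \<open>S\<close>, which
        generates \<open>T\<close>.\<close>
      fix P assume P: "thick_subcategory V.U P" "?V \<subseteq> P"
      have "R \<subseteq> P"
      proof
        fix A assume "A \<in> R"
        then have "zero_object V.U A" using V.N_zero thick_incl by blast
        then show "A \<in> P" using P(1) unfolding thick_subcategory_def by blast
      qed
      moreover have "S - R \<subseteq> ?V"
      proof
        fix X assume X: "X \<in> S - R"
        then have "X \<in> Obj V.U" using sub Zr_obj by auto
        then show "X \<in> ?V" using X V.U.isomorphic_refl unfolding iso_closure_def by blast
      qed
      ultimately have "S \<subseteq> P" using P(2) by blast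
      then have "thick T S \<subseteq> P" by (rule thick_least[OF V.thick_U_to_T[OF P(1)]])
      then show "Obj V.U \<subseteq> P" using th by simp
    qed
  qed
  then show ?thesis using ic main unfolding SMC_def pre_SMC_def by blast
qed

text \<open>Between \<open>R\<close> and \<open>Zr\<close> the conditions are the perpendicularity
  that defines \<open>Zr\<close>; within \<open>W \<inter> Zr\<close> they are those of
  \<open>W\<close>, by full faithfulness.\<close>

lemma SMC_lift:
  assumes W: "SMC k V.U W" shows "SMC k T (R \<union> (W \<inter> Zr))"
proof -
  let ?S = "R \<union> (W \<inter> Zr)"
  have icW: "iso_closed V.U W" and thW: "thick V.U W = Obj V.U"
    and pre: "\<And>X Y i. X \<in> W \<Longrightarrow> Y \<in> W \<Longrightarrow> i < 0 \<Longrightarrow> Hom_vanishes V.U X (shift V.U Y i)"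
    and dim: "\<And>X Y. X \<in> W \<Longrightarrow> Y \<in> W \<Longrightarrow> has_dim k (Hom V.U X Y) (if isomorphic V.U X Y then 1 else 0)"
    using W unfolding SMC_def pre_SMC_def by blast+
  have obj: "?S \<subseteq> Obj T" using R_obj Zr_obj by blast
  have ic: "iso_closed T ?S"
    unfolding iso_closed_def
  proof (intro conjI allI impI obj)
    fix X Y assume X: "X \<in> ?S" and i: "isomorphic T X Y"
    show "Y \<in> ?S"
    proof (cases "X \<in> R")
      case True then show ?thesis using iso_closedD[OF R_iso_closed _ i] by blast
    next
      case False
      then have "X \<in> W" "X \<in> Zr" using X by auto
      then show ?thesis using iso_closedD[OF icW _ V.Q.F_isomorphic[OF i]] Zr_iso[OF _ i] by blast
    qed
  qed
  have mixed: "has_dim k (Hom T X Y) (if isomorphic T X Y then 1 else 0)"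
    if v: "Hom_vanishes T X Y" and o: "X \<in> Obj T" "Y \<in> Obj T" and ni: "\<not> isomorphic T X Y" for X Y
    using has_dim_0_iff[OF Hom_module[OF o]] v ni by (simp add: Hom_vanishes_def Mor_def)
  have main: "(\<forall>i<0. Hom_vanishes T X (sh Y i)) \<and>
        has_dim k (Hom T X Y) (if isomorphic T X Y then 1 else 0)" if X: "X \<in> ?S" and Y: "Y \<in> ?S" for X Y
  proof -
    have o: "X \<in> Obj T" "Y \<in> Obj T" using X Y obj by blast+
    consider "X \<in> R" "Y \<in> R" | "X \<in> R" "Y \<in> W" "Y \<in> Zr" | "X \<in> W" "X \<in> Zr" "Y \<in> R"
      | "X \<in> W" "X \<in> Zr" "Y \<in> W" "Y \<in> Zr" using X Y by blast
    then show ?thesis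
    proof cases
      case 1
      then show ?thesis using pre_SMC unfolding pre_SMC_def by blast
    next
      case 2
      have v: "Hom_vanishes T (sh X i) Y" if "i \<ge> 0" for i
        using 2 that by (simp add: Zr_eq right_perp_shifts_iff)
      have "Hom_vanishes T X (sh Y i)" if "i < 0" for i
        using v[of "-i"] that vanish_shift[OF o, of i 0 0 "-i"] by simp
      moreover have "\<not> isomorphic T X Y"
        using 2 iso_closedD[OF R_iso_closed] R_Zr_disjoint by blast
      ultimately show ?thesis using mixed[OF _ o] v[of 0] by simp
    next
      case 3
      have v: "Hom_vanishes T X (sh Y i)" if "i \<le> 0" for i
        using 3 that by (simp add: Zr_eq left_perp_shifts_iff)
      moreover have "\<not> isomorphic T X Y"
        using 3 iso_closedD[OF R_iso_closed] R_Zr_disjoint isomorphic_sym by blast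
      ultimately show ?thesis using mixed[OF _ o] v[of 0] by simp
    next
      case 4
      then have l: "X \<in> lp" and r: "Y \<in> rp" by (auto simp: Zr_eq)
      have iso: "isomorphic V.U X Y \<longleftrightarrow> isomorphic T X Y"
        using Zr_iso_reflect[OF 4(2,4)] V.Q.F_isomorphic by blast
      have n: "(if isomorphic T X Y then 1 else 0) = (0::nat) \<or> (if isomorphic T X Y then 1 else 0) = (1::nat)" by simp
      have "has_dim k (Hom T X Y) (if isomorphic T X Y then 1 else 0)"
        unfolding Q_dim_iff[OF l r n, symmetric] using dim[OF 4(1,3)] unfolding iso .
      moreover have "Hom_vanishes T X (sh Y i)" if "i < 0" for i
        using pre[OF 4(1,3) that] Q_vanish_iff[OF l rp_shift_neg[OF r less_imp_le[OF that]]]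
        unfolding V.shift_U by blast
      ultimately show ?thesis by blast
    qed
  qed
  let ?P = "thick T ?S"
  have P: "thick_subcategory T ?P" by (rule thick_subcategory_thick[OF obj])
  have RP: "R \<subseteq> ?P" using thick_incl[of ?S] by blast
  \<comment> \<open>\<open>?P\<close> contains \<open>R\<close>, so it is closed under isomorphisms
    of the quotient; triangles and direct sums of the quotient can then be replaced by ones coming
    from \<open>T\<close>.\<close>
  have PU: "thick_subcategory V.U ?P"
    unfolding thick_subcategory_def iso_closed_def
  proof (intro conjI allI impI ballI)
    show "?P \<subseteq> Obj V.U" using thick_subcategoryD(1)[OF P] by simp
    fix X Y assume "X \<in> ?P" "isomorphic V.U X Y"
    then show "Y \<in> ?P" using U_iso_thick[OF P RP] by blast
  next
    fix X assume X: "zero_object V.U X"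
    obtain E where E: "zero_object T E" using exists_zero .
    have "isomorphic V.U E X" by (rule V.U.zero_objects_isomorphic[OF V.Q.F_zero_object[OF E] X])
    then show "X \<in> ?P" using U_iso_thick[OF P RP] thick_subcategoryD(3)[OF P E] by blast
  next
    fix X assume "X \<in> Obj V.U"
    then show "X \<in> ?P \<longleftrightarrow> Susp V.U X \<in> ?P" using thick_subcategoryD(4)[OF P] by simp
  next
    fix X Y Z f g h assume t: "Tri V.U X Y Z f g h" and XY: "X \<in> ?P" "Y \<in> ?P"
    obtain X' Y' Z' where t': "tri X' Y' Z'" "isomorphic V.U X X'" "isomorphic V.U Y Y'" "isomorphic V.U Z Z'"
      using V.Tri_U_cases[OF t] .
    have "X' \<in> ?P" "Y' \<in> ?P" using U_iso_thick[OF P RP] t' XY by blast+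
    then have "Z' \<in> ?P" using thick_subcategoryD(5)[OF P t'(1)] by blast
    then show "Z \<in> ?P" using U_iso_thick[OF P RP V.U.isomorphic_sym[OF t'(4)]] by blast
  next
    fix X Y Z assume d: "direct_sum V.U X [Y, Z]" and X: "X \<in> ?P"
    have o: "Y \<in> Obj T" "Z \<in> Obj T" using d by (simp_all add: direct_sum_def)
    obtain X' where X': "direct_sum T X' [Y, Z]" using exists_direct_sum[OF o] .
    have "direct_sum V.U X' [Y, Z]" using V.Q.F_direct_sum[OF X'] by simp
    then have "isomorphic V.U X X'" by (rule V.U.direct_sum_pair_unique[OF d])
    then have "X' \<in> ?P" using U_iso_thick[OF P RP] X by blast
    then show "Y \<in> ?P" using thick_subcategoryD(6)[OF P X'] by blast
  qed
  have "W \<subseteq> ?P"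
  proof
    fix X assume X: "X \<in> W"
    then have "X \<in> Obj T" using icW by (auto simp: iso_closed_def)
    then obtain Z where Z: "Z \<in> Zr" "isomorphic V.U (sh Z 0) (sh X 0)" using Zr_representative by metis
    have "Z \<in> W" using iso_closedD[OF icW X V.U.isomorphic_sym] Z(2) unfolding shift_0 by blast
    then have "Z \<in> ?P" using Z(1) thick_incl[of ?S] by blast
    then show "X \<in> ?P" using U_iso_thick[OF P RP] Z(2) unfolding shift_0 by blast
  qed
  then have "thick V.U W \<subseteq> ?P" by (rule thick_least[OF PU])
  then have "?P = Obj T" using thW thick_subcategoryD(1)[OF P] by simp
  then show ?thesis using ic main unfolding SMC_def pre_SMC_def by blast
qed

text \<open>\<open>S\<close> is recovered because objects of \<open>Zr\<close> isomorphic in the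
  quotient are isomorphic in \<open>T\<close>, and \<open>W\<close> because each of its members has
  a representative in \<open>Zr\<close>.\<close>

lemma SMC_bijection:
  "bij_betw (\<lambda>S. iso_closure V.U (S - R)) {S. SMC k T S \<and> R \<subseteq> S} {S. SMC k V.U S}"
proof (rule bij_betw_byWitness[where f' = "\<lambda>W. R \<union> (W \<inter> Zr)"])
  show "\<forall>S\<in>{S. SMC k T S \<and> R \<subseteq> S}. R \<union> (iso_closure V.U (S - R) \<inter> Zr) = S"
  proof
    fix S assume "S \<in> {S. SMC k T S \<and> R \<subseteq> S}"
    then have S: "pre_SMC k T S" "R \<subseteq> S" by (auto simp: SMC_def)
    note sub = SMC_complement_subset[OF S]
    have ic: "iso_closed T S" using S by (simp add: pre_SMC_def)
    show "R \<union> (iso_closure V.U (S - R) \<inter> Zr) = S"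
    proof (intro equalityI subsetI)
      fix X assume "X \<in> R \<union> (iso_closure V.U (S - R) \<inter> Zr)"
      then consider "X \<in> R" | Y where "Y \<in> S - R" "isomorphic V.U Y X" "X \<in> Zr"
        by (auto simp: iso_closure_def)
      then show "X \<in> S"
      proof cases
        case 2
        then have "isomorphic T Y X" using Zr_iso_reflect sub by blast
        then show ?thesis using iso_closedD[OF ic] 2 by blast
      qed (use S in blast)
    next
      fix X assume X: "X \<in> S"
      show "X \<in> R \<union> (iso_closure V.U (S - R) \<inter> Zr)"
      proof (cases "X \<in> R")
        case False
        then have "X \<in> Zr" using X sub by blast
        moreover have "isomorphic V.U X X" using V.U.isomorphic_refl[of X] Zr_obj calculation by simp
        ultimately show ?thesis using X False unfolding iso_closure_def by blast
      qed simp
    qed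
  qed
  show "\<forall>W\<in>{S. SMC k V.U S}. iso_closure V.U (R \<union> (W \<inter> Zr) - R) = W"
  proof
    fix W assume "W \<in> {S. SMC k V.U S}"
    then have ic: "iso_closed V.U W" by (simp add: SMC_def pre_SMC_def)
    have e: "R \<union> (W \<inter> Zr) - R = W \<inter> Zr" using R_Zr_disjoint by blast
    show "iso_closure V.U (R \<union> (W \<inter> Zr) - R) = W"
      unfolding e
    proof (intro equalityI subsetI)
      fix X assume "X \<in> iso_closure V.U (W \<inter> Zr)"
      then obtain Y where "Y \<in> W" "isomorphic V.U Y X" unfolding iso_closure_def by blast
      then show "X \<in> W" by (rule iso_closedD[OF ic])
    next
      fix X assume X: "X \<in> W"
      then have "X \<in> Obj T" using ic by (auto simp: iso_closed_def)
      then obtain Z where Z: "Z \<in> Zr" "isomorphic V.U (sh Z 0) (sh X 0)" using Zr_representative by metis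
      then have i: "isomorphic V.U Z X" unfolding shift_0 by blast
      then have "Z \<in> W" using iso_closedD[OF ic X] V.U.isomorphic_sym by blast
      then show "X \<in> iso_closure V.U (W \<inter> Zr)" using Z(1) i unfolding iso_closure_def by blast
    qed
  qed
  show "(\<lambda>S. iso_closure V.U (S - R)) ` {S. SMC k T S \<and> R \<subseteq> S} \<subseteq> {S. SMC k V.U S}"
    using SMC_image by blast
  show "(\<lambda>W. R \<union> (W \<inter> Zr)) ` {S. SMC k V.U S} \<subseteq> {S. SMC k T S \<and> R \<subseteq> S}"
    using SMC_lift by blast
qed

end

theorem theorem1p1:
  fixes k :: "('k, 'r) ring_scheme"
    and T :: "('o, 'k, 'm, 'z) tricat_scheme"
    and R :: "'o set"
  assumes "triangulated_category k T"
    and "krull_schmidt T"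
    and "pre_SMC k T R"
    and R1_contra: "contravariantly_finite T (Filt T R) (right_perp T (shifts T R {0<..}))"
    and R1_co: "covariantly_finite T (Filt T R) (left_perp T (shifts T R {..<0}))"
    and R2: "\<forall>X\<in>Obj T. \<exists>n. \<forall>i\<le>n. \<forall>A\<in>Filt T R.
      Hom_vanishes T X (shift T A i) \<and> Hom_vanishes T A (shift T X i)"
  shows "additive_equivalence k
      (full_subcategory T (reduction_subcategory T R))
      (verdier_quotient T (thick T R))
      (\<lambda>X. X) (quotient_mor T (thick T R))
    \<and> bij_betw (\<lambda>S. iso_closure (verdier_quotient T (thick T R)) (S - R))
      {S. SMC k T S \<and> R \<subseteq> S}
      {S. SMC k (verdier_quotient T (thick T R)) S}"
proof -
  interpret simple_minded_reduction k T R
    by (intro simple_minded_reduction.intro pre_simple_minded.intro pre_simple_minded_axioms.intro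
        simple_minded_reduction_axioms.intro assms)
  show ?thesis using equivalence SMC_bijection by blast
qed

end
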